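(* Let $G$ be a connected imperfect $(P_7, C_5, \text{kite}, \text{paraglider})$-free graph with $\delta(G)\geq \omega(G)+1$. If $G$ is not isomorphic to the graph $F$, then $G$ has a clique cutset, or a comparable pair, or a universal clique.
   Context: All graphs are finite and simple. $\delta(G)$ is the minimum degree of $G$, $\omega(G)$ its clique number (maximum size of a set of mutually adjacent vertices), $\chi(G)$ its chromatic number, and $N(v)$ the (open) neighborhood of a vertex $v$. A graph $G$ is perfect if $\chi(H)=\omega(H)$ for every induced subgraph $H$ of $G$, and imperfect otherwise. $G$ is $(H_1,H_2,\ldots)$-free if no induced subgraph of $G$ is isomorphic to any $H_i$. $P_t$ and $C_t$ denote the path and the cycle on $t$ vertices. A kite is the 5-vertex graph consisting of a $P_4$ and a new vertex adjacent to exactly three consecutive vertices of the $P_4$. A paraglider is the 5-vertex graph consisting of a $C_4$ and a new vertex adjacent to exactly three vertices of the $C_4$. A clique cutset of $G$ is a clique $K$ in $G$ such that $G-K$ has more components than $G$. A comparable pair is a pair $(u,v)$ of distinct non-adjacent vertices with $N(u)\subseteq N(v)$ or $N(v)\subseteq N(u)$. A universal clique is a nonempty clique $K$ such that every vertex of $K$ is adjacent to every vertex of $V(G)\setminus K$ (equivalently, a nonempty set of vertices each having degree $|V(G)|-1$). The graph $F$ has 12 vertices $v_1,\ldots,v_7,a_5,a_7,b_3,\bar b_1,d_1$ and exactly the following 24 edges: the 7-cycle edges $v_1v_2, v_2v_3, v_3v_4, v_4v_5, v_5v_6, v_6v_7, v_7v_1$; the edges $a_5v_5, a_5v_7$; the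 edges $a_7v_7, a_7v_2$; the edges $b_3v_3, b_3v_5, b_3v_6$; the edges $\bar b_1v_1, \bar b_1v_2, \bar b_1v_4$; the edges $d_1v_1, d_1v_3, d_1v_4, d_1v_6$; and the edges $a_5a_7, a_5\bar b_1, a_7b_3$. *)

theory Defs
  imports Main
begin

section \<open>Finite simple graphs\<close>

record 'a ugraph =
  vertices :: "'a set"
  edges :: "'a set set"

locale simple_graph =
  fixes G :: "'a ugraph"
  assumes finite_vertices: "finite (vertices G)"
    and edges_subset: "edges G \<subseteq> {{u, v} | u v. u \<in> vertices G \<and> v \<in> vertices G \<and> u \<noteq> v}"

definition adj :: "'a ugraph \<Rightarrow> 'a \<Rightarrow> 'a \<Rightarrow> bool" where
  "adj G u v \<longleftrightarrow> {u, v} \<in> edges G"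

definition neighborhood :: "'a ugraph \<Rightarrow> 'a \<Rightarrow> 'a set" where
  "neighborhood G v = {u \<in> vertices G. adj G u v}"

definition degree :: "'a ugraph \<Rightarrow> 'a \<Rightarrow> nat" where
  "degree G v = card (neighborhood G v)"

text \<open>Only meaningful if \<open>G\<close> has at least one vertex, because \<open>Min {}\<close> is unspecified.\<close>

definition min_degree :: "'a ugraph \<Rightarrow> nat" where
  "min_degree G = Min (degree G ` vertices G)"

definition induced_subgraph :: "'a ugraph \<Rightarrow> 'a set \<Rightarrow> 'a ugraph" where
  "induced_subgraph G S = \<lparr>vertices = vertices G \<inter> S, edges = {e \<in> edges G. e \<subseteq> S}\<rparr>"

definition delete_vertices :: "'a ugraph \<Rightarrow> 'a set \<Rightarrow> 'a ugraph" where
  "delete_vertices G S = induced_subgraph G (vertices G - S)"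

definition graph_iso :: "'a ugraph \<Rightarrow> 'b ugraph \<Rightarrow> bool" where
  "graph_iso G H \<longleftrightarrow>
    (\<exists>f. bij_betw f (vertices G) (vertices H) \<and>
         (\<forall>u\<in>vertices G. \<forall>v\<in>vertices G. adj G u v \<longleftrightarrow> adj H (f u) (f v)))"

definition graph_free :: "'a ugraph \<Rightarrow> 'b ugraph set \<Rightarrow> bool" where
  "graph_free G \<H> \<longleftrightarrow>
    (\<forall>S\<subseteq>vertices G. \<forall>H\<in>\<H>. \<not> graph_iso (induced_subgraph G S) H)"

section \<open>Connectivity\<close>

definition connection_rel :: "'a ugraph \<Rightarrow> ('a \<times> 'a) set" where
  "connection_rel G =
    {(u, v). u \<in> vertices G \<and> v \<in> vertices G \<and> (u, v) \<in> {(x, y). adj G x y}\<^sup>*}"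

definition graph_components :: "'a ugraph \<Rightarrow> 'a set set" where
  "graph_components G = vertices G // connection_rel G"

text \<open>The graph without vertices is not counted as connected.\<close>

definition connected_graph :: "'a ugraph \<Rightarrow> bool" where
  "connected_graph G \<longleftrightarrow> vertices G \<noteq> {} \<and>
    (\<forall>u\<in>vertices G. \<forall>v\<in>vertices G. (u, v) \<in> connection_rel G)"

section \<open>Cliques, colourings and perfection\<close>

definition is_clique :: "'a ugraph \<Rightarrow> 'a set \<Rightarrow> bool" where
  "is_clique G K \<longleftrightarrow> K \<subseteq> vertices G \<and> (\<forall>u\<in>K. \<forall>v\<in>K. u \<noteq> v \<longrightarrow> adj G u v)"

definition clique_number :: "'a ugraph \<Rightarrow> nat" where
  "clique_number G = Max (card ` {K. is_clique G K})"

definition proper_coloring :: "'a ugraph \<Rightarrow> nat \<Rightarrow> ('a \<Rightarrow> nat) \<Rightarrow> bool" where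
  "proper_coloring G k c \<longleftrightarrow> c ` vertices G \<subseteq> {..<k} \<and>
    (\<forall>u\<in>vertices G. \<forall>v\<in>vertices G. adj G u v \<longrightarrow> c u \<noteq> c v)"

definition chromatic_number :: "'a ugraph \<Rightarrow> nat" where
  "chromatic_number G = (LEAST k. \<exists>c. proper_coloring G k c)"

definition perfect_graph :: "'a ugraph \<Rightarrow> bool" where
  "perfect_graph G \<longleftrightarrow>
    (\<forall>S\<subseteq>vertices G.
      chromatic_number (induced_subgraph G S) = clique_number (induced_subgraph G S))"

abbreviation imperfect_graph :: "'a ugraph \<Rightarrow> bool" where
  "imperfect_graph G \<equiv> \<not> perfect_graph G"

definition clique_cutset :: "'a ugraph \<Rightarrow> 'a set \<Rightarrow> bool" where
  "clique_cutset G K \<longleftrightarrow> is_clique G K \<and>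
    card (graph_components (delete_vertices G K)) > card (graph_components G)"

definition comparable_pair :: "'a ugraph \<Rightarrow> 'a \<Rightarrow> 'a \<Rightarrow> bool" where
  "comparable_pair G u v \<longleftrightarrow> u \<in> vertices G \<and> v \<in> vertices G \<and> u \<noteq> v \<and> \<not> adj G u v \<and>
    (neighborhood G u \<subseteq> neighborhood G v \<or> neighborhood G v \<subseteq> neighborhood G u)"

definition universal_clique :: "'a ugraph \<Rightarrow> 'a set \<Rightarrow> bool" where
  "universal_clique G K \<longleftrightarrow> K \<noteq> {} \<and> is_clique G K \<and>
    (\<forall>u\<in>K. \<forall>w\<in>vertices G - K. adj G u w)"

section \<open>Particular graphs\<close>

definition path_graph :: "nat \<Rightarrow> nat ugraph" where
  "path_graph t = \<lparr>vertices = {..<t}, edges = {{i, Suc i} | i. Suc i < t}\<rparr>"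

text \<open>A simple graph, and a cycle, only for \<open>t \<ge> 3\<close>.\<close>

definition cycle_graph :: "nat \<Rightarrow> nat ugraph" where
  "cycle_graph t = \<lparr>vertices = {..<t}, edges = {{i, Suc i mod t} | i. i < t}\<rparr>"

definition add_vertex :: "'a ugraph \<Rightarrow> 'a \<Rightarrow> 'a set \<Rightarrow> 'a ugraph" where
  "add_vertex G x N =
    \<lparr>vertices = insert x (vertices G), edges = edges G \<union> {{x, y} | y. y \<in> N}\<rparr>"

text \<open>The choice of the three neighbours of the new vertex \<open>4\<close> is immaterial up to
  isomorphism, by the symmetries of \<open>P\<^sub>4\<close> and \<open>C\<^sub>4\<close>.\<close>

definition kite :: "nat ugraph" where
  "kite = add_vertex (path_graph 4) 4 {0, 1, 2}"

definition paraglider :: "nat ugraph" where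
  "paraglider = add_vertex (cycle_graph 4) 4 {0, 1, 2}"

text \<open>\<open>BB1\<close> stands for the vertex written $\bar b_1$.\<close>

datatype F_vertex = V1 | V2 | V3 | V4 | V5 | V6 | V7 | A5 | A7 | B3 | BB1 | D1

definition graph_F :: "F_vertex ugraph" where
  "graph_F =
    \<lparr>vertices = {V1, V2, V3, V4, V5, V6, V7, A5, A7, B3, BB1, D1},
     edges =
      {{V1, V2}, {V2, V3}, {V3, V4}, {V4, V5}, {V5, V6}, {V6, V7}, {V7, V1},
       {A5, V5}, {A5, V7},
       {A7, V7}, {A7, V2},
       {B3, V3}, {B3, V5}, {B3, V6},
       {BB1, V1}, {BB1, V2}, {BB1, V4},
       {D1, V1}, {D1, V3}, {D1, V4}, {D1, V6},
       {A5, A7}, {A5, BB1}, {A7, B3}}\<rparr>"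

end

theory Submission
  imports Defs
begin

text \<open>
  A graph is coloured with as many colours as its largest clique by showing that a minimal counterexample
  has no star cutset: two colourings of the sides can be combined along the colour class of the centre.
  If a minimal counterexample without odd holes contains a diamond and obeys the adjacency rule that kite-
  and paraglider-freeness put on diamonds, then the neighbourhood of a vertex of the diamond yields a dominated vertex.
  If it is diamond-free, detach a vertex \<open>x\<close> from a maximal clique \<open>K\<close>: a colouring of the smaller graph
  is repaired by a Kempe exchange, and detaching creates no odd hole, because two even holes through \<open>x\<close>
  and two further vertices of \<open>K\<close> would be linked by a path avoiding the neighbourhood of \<open>x\<close>, and the
  lengths of the four resulting paths have contradictory parities. Hence an imperfect graph of the
  class contains an induced cycle of length 5 or 7, so of length 7, and the strong perfect graph theorem is not needed.

  Every other vertex sees an induced seven-cycle in \<open>{v1, v3}\<close>, \<open>{v3, v5, v6}\<close> or \<open>{v1, v3, v4, v6}\<close> up to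
  rotation and reflection, since vertices with all or no neighbours on the cycle give a universal
  clique, a clique cutset or a comparable pair. The degree condition and the absence of comparable pairs then
  force, one vertex at a time, the twelve vertices of \<open>F\<close>, and no further vertex can be attached.
\<close>

section \<open>Parities along induced paths\<close>

text \<open>The induction is on colourability under an upper bound for clique sizes, not on
  perfection, because combining colourings needs the hypothesis for both \<open>k\<close> and
  \<open>k - 1\<close>. The obstacle in the diamond-free case is that the neighbours of two vertices
  may interleave arbitrarily along the path joining the two holes. The cure is to measure the
  stretch from the last neighbour of one vertex to the first neighbour of the other: its parity
  splits into one term for each vertex. On the seven-cycle the constants come from gaps: consecutive
  neighbours at distance \<open>g\<close> close with the outside vertex to an induced cycle of
  length \<open>g + 2\<close>, so \<open>g = 3\<close> is excluded. A vertex that sees two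
  consecutive cycle vertices yields a triangle, hence all degrees are at least four, and any vertex
  with only three known neighbours must have another one. This is what drives the construction of
  \<open>F\<close>.\<close>

lemma last_in_interval:
  fixes s t :: nat
  assumes "s \<in> P" "s \<le> t"
  obtains i where "i \<in> P" "s \<le> i" "i \<le> t" "\<And>k. i < k \<Longrightarrow> k \<le> t \<Longrightarrow> k \<notin> P"
proof -
  let ?S = "{i \<in> P. s \<le> i \<and> i \<le> t}"
  have "Max ?S \<in> ?S" using assms by (intro Max_in) auto
  moreover have "k \<le> Max ?S" if "k \<in> ?S" for k using that by (intro Max_ge) auto
  ultimately show thesis by (intro that[of "Max ?S"]) fastforce+
qed

lemma first_in_interval:
  fixes s t :: nat
  assumes "t \<in> P" "s \<le> t"
  obtains i where "i \<in> P" "s \<le> i" "i \<le> t" "\<And>k. s \<le> k \<Longrightarrow> k < i \<Longrightarrow> k \<notin> P"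
proof -
  let ?S = "{i \<in> P. s \<le> i \<and> i \<le> t}"
  have "Min ?S \<in> ?S" using assms by (intro Min_in) auto
  moreover have "Min ?S \<le> k" if "k \<in> ?S" for k using that by (intro Min_le) auto
  ultimately show thesis by (intro that[of "Min ?S"]) fastforce+
qed

text \<open>Models the neighbours of one vertex on an induced path when all holes are even: two
  consecutive ones close with the vertex to a triangle if they are successive, and otherwise to a
  hole with \<open>j - i + 2\<close> vertices.\<close>

definition even_gaps :: "nat set \<Rightarrow> bool" where
  "even_gaps P \<longleftrightarrow> (\<forall>i\<in>P. \<forall>j\<in>P. i < j \<longrightarrow> (\<forall>k. i < k \<and> k < j \<longrightarrow> k \<notin> P) \<longrightarrow> j = Suc i \<or> even (i + j))"

text \<open>Models two vertices that close a hole with the stretch from \<open>i\<close> to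
  \<open>j\<close>: directly by an edge between them (\<open>c = 1\<close>), or through a common
  neighbour away from the path (\<open>c = 0\<close>).\<close>

definition parity_linked :: "nat \<Rightarrow> nat set \<Rightarrow> nat set \<Rightarrow> bool" where
  "parity_linked c P Q \<longleftrightarrow> (\<forall>i\<in>P. \<forall>j\<in>Q. i \<le> j \<longrightarrow> (\<forall>k. i < k \<and> k \<le> j \<longrightarrow> k \<notin> P) \<longrightarrow>
     (\<forall>k. i \<le> k \<and> k < j \<longrightarrow> k \<notin> Q) \<longrightarrow> even (i + j + c))"

lemma even_gapsD:
  assumes "even_gaps P" "i \<in> P" "j \<in> P" "i < j" "\<And>k. i < k \<Longrightarrow> k < j \<Longrightarrow> k \<notin> P" "j \<noteq> Suc i"
  shows "even (i + j)"
  using assms unfolding even_gaps_def by blast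

lemma parity_linkedD:
  assumes "parity_linked c P Q" "i \<in> P" "j \<in> Q" "i \<le> j"
    and "\<And>k. i < k \<Longrightarrow> k \<le> j \<Longrightarrow> k \<notin> P" "\<And>k. i \<le> k \<Longrightarrow> k < j \<Longrightarrow> k \<notin> Q"
  shows "even (i + j + c)"
  using assms unfolding parity_linked_def by blast

text \<open>\<open>P\<close> and \<open>Q\<close> are the positions of the neighbours of two vertices on an induced path. The parity of
  the distance between the last \<open>P\<close> and the first \<open>Q\<close> does not depend on how they interleave in between.\<close>

lemma last_first_parity:
  assumes "even_gaps P" "even_gaps Q" "parity_linked c P Q" "parity_linked c Q P"
    and "\<And>i. i \<in> P \<Longrightarrow> i \<in> Q \<Longrightarrow> Suc i \<in> P \<Longrightarrow> Suc i \<notin> Q"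
    and "s \<in> P" "t \<in> Q" "s \<le> t"
    and "i \<in> P" "s \<le> i" "i \<le> t" "\<And>k. i < k \<Longrightarrow> k \<le> t \<Longrightarrow> k \<notin> P"
    and "j \<in> Q" "s \<le> j" "j \<le> t" "\<And>k. s \<le> k \<Longrightarrow> k < j \<Longrightarrow> k \<notin> Q"
  shows "even (i + j + c)"
  using assms
proof (induction "t - s" arbitrary: P Q s t i j rule: less_induct)
  case less
  note eP = less.prems(1) and eQ = less.prems(2) and PQ = less.prems(3) and QP = less.prems(4)
    and no2 = less.prems(5) and st = less.prems(6-8)
    and i = less.prems(9-12) and j = less.prems(13-16)
  note linkPQ = parity_linkedD[OF PQ]
  consider "i \<le> j" | "j < i" "s < j \<or> i < t" | "j < i" "j = s" "i = t"
    using i j by linarith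
  then show ?case
  proof cases
    case 1
    show ?thesis by (rule linkPQ) (use 1 i j in simp_all)
  next
    \<comment> \<open>The induction hypothesis is applied to the shorter interval from
      \<open>j\<close> to \<open>i\<close> with the roles of \<open>P\<close> and \<open>Q\<close>
      exchanged. The pairs \<open>a\<close>, \<open>j'\<close> and \<open>i'\<close>,
      \<open>b\<close> coincide or are consecutive around \<open>j\<close> and \<open>i\<close>, so
      their sums are even, and the links \<open>a\<close> to \<open>j\<close> and \<open>i\<close>
      to \<open>b\<close> carry the parity outwards.\<close>
    case 2
    obtain i' where i': "i' \<in> Q" "j \<le> i'" "i' \<le> i" "\<And>k. i' < k \<Longrightarrow> k \<le> i \<Longrightarrow> k \<notin> Q"
      using last_in_interval[of j Q i] j(1) 2(1) by auto
    obtain j' where j': "j' \<in> P" "j \<le> j'" "j' \<le> i" "\<And>k. j \<le> k \<Longrightarrow> k < j' \<Longrightarrow> k \<notin> P"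
      using first_in_interval[of i P j] i(1) 2(1) by auto
    have inner: "even (i' + j' + c)"
      by (rule less.hyps[of i j Q P i' j'])
        (use i(1-3) j(1-3) st 2 i' j' eP eQ PQ QP no2 in auto)
    obtain a where a: "a \<in> P" "s \<le> a" "a \<le> j" "\<And>k. a < k \<Longrightarrow> k \<le> j \<Longrightarrow> k \<notin> P"
      using last_in_interval[of s P j] st j by auto
    obtain b where b: "b \<in> Q" "i \<le> b" "b \<le> t" "\<And>k. i \<le> k \<Longrightarrow> k < b \<Longrightarrow> k \<notin> Q"
      using first_in_interval[of t Q i] st i by auto
    have aj: "even (a + j + c)" by (rule linkPQ) (use a j in auto)
    have ib: "even (i + b + c)" by (rule linkPQ) (use i b in auto)
    have "even (a + j')"
    proof (cases "a = j")
      case True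
      then have "j' = j" using a(1) j'(2) j'(4)[of j] by fastforce
      then show ?thesis using True by simp
    next
      case False
      then have "a < j" using a(3) by simp
      then have "j \<notin> P" using a(4)[of j] by simp
      then have "j < j'" using j'(1,2) by (cases "j = j'") auto
      moreover have "k \<notin> P" if "a < k" "k < j'" for k
        using a(4)[of k] j'(4)[of k] that by (cases "k \<le> j") auto
      ultimately show ?thesis
        using \<open>a < j\<close> by (intro even_gapsD[OF eP a(1) j'(1)]) auto
    qed
    moreover have "even (i' + b)"
    proof (cases "b = i")
      case True
      then have "i' = i" using b(1) i'(3) i'(4)[of i] by fastforce
      then show ?thesis using True by simp
    next
      case False
      then have "i < b" using b(2) by simp
      then have "i \<notin> Q" using b(4)[of i] by simp
      then have "i' < i" using i'(1,3) by (cases "i = i'") auto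
      moreover have "k \<notin> Q" if "i' < k" "k < b" for k
        using i'(4)[of k] b(4)[of k] that by (cases "k \<le> i") auto
      ultimately show ?thesis
        using \<open>i < b\<close> by (intro even_gapsD[OF eQ i'(1) b(1)]) auto
    qed
    ultimately show ?thesis using inner aj ib by presburger
  next
    \<comment> \<open>Both ends lie in \<open>P\<close> and in \<open>Q\<close>, so exchanging the
      roles does not shrink the interval. An inner point \<open>m\<close> of \<open>P\<close> splits
      it in two; without one, \<open>s\<close> and \<open>t\<close> are consecutive in
      \<open>P\<close>, and successive common positions are excluded by \<open>no2\<close>.\<close>
    case 3
    have c: "even c"
      using linkPQ[of s s] st 3 j by simp
    have "even (s + t)"
    proof (cases "\<exists>k\<in>P. s < k \<and> k < t")
      case True
      then obtain k where "k \<in> P" "Suc s \<le> k" "k < t" by auto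
      then obtain m where m: "m \<in> P" "Suc s \<le> m" "m < t" "\<And>l. Suc s \<le> l \<Longrightarrow> l < m \<Longrightarrow> l \<notin> P"
        using first_in_interval[of k P "Suc s"] by (metis order.strict_trans1)
      obtain h where h: "h \<in> Q" "s \<le> h" "h \<le> m" "\<And>k. h < k \<Longrightarrow> k \<le> m \<Longrightarrow> k \<notin> Q"
        using last_in_interval[of s Q m] 3 j m by auto
      obtain k where k: "k \<in> Q" "m \<le> k" "k \<le> t" "\<And>l. m \<le> l \<Longrightarrow> l < k \<Longrightarrow> l \<notin> Q"
        using first_in_interval[of t Q m] st m by auto
      have "even (h + s + c)"
        by (rule less.hyps[of m s Q P h s])
          (use h m st 3 j(1) i(1) eP eQ PQ QP no2 in auto)
      moreover have "even (t + k + c)"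
        by (rule less.hyps[of t m P Q t k])
          (use k m st 3 j(1) i(1) eP eQ PQ QP no2 in auto)
      moreover have "even (h + k)"
      proof (cases "h = k")
        case False
        have "m \<notin> Q"
        proof
          assume "m \<in> Q"
          then have "h = m" "k = m" using h(3) h(4)[of m] k(2) k(4)[of m] by (fastforce)+
          then show False using False by simp
        qed
        then have "h \<noteq> m" "k \<noteq> m" using h(1) k(1) by auto
        then have "h < m" "m < k" using h(3) k(2) by simp_all
        moreover have "l \<notin> Q" if "h < l" "l < k" for l
          using h(4)[of l] k(4)[of l] that by (cases "l \<le> m") auto
        ultimately show ?thesis
          by (intro even_gapsD[OF eQ h(1) k(1)]) auto
      qed simp
      ultimately show ?thesis using c by presburger
    next
      case False
      then have "t = Suc s \<or> even (s + t)"
        using even_gapsD[OF eP st(1), of t] i(1) 3 by blast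
      then show ?thesis using no2[of s] st i j 3 by auto
    qed
    then show ?thesis using 3 c by presburger
  qed
qed

section \<open>Induced paths and holes as lists, and positions of neighbours on them\<close>

locale adjacency =
  fixes E :: "'a \<Rightarrow> 'a \<Rightarrow> bool"
  assumes sym: "E a b \<Longrightarrow> E b a"
    and irrefl: "\<not> E a a"
begin

lemma commute: "E a b \<longleftrightarrow> E b a"
  using sym by blast

end

definition ipath :: "('a \<Rightarrow> 'a \<Rightarrow> bool) \<Rightarrow> 'a list \<Rightarrow> bool" where
  "ipath E xs \<longleftrightarrow> distinct xs \<and>
    (\<forall>i<length xs. \<forall>j<length xs. E (xs ! i) (xs ! j) \<longleftrightarrow> i = Suc j \<or> j = Suc i)"

text \<open>The vertex \<open>x\<close> closes the induced path \<open>xs\<close>, so the hole has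
  one vertex more than \<open>xs\<close>; an even hole is one with \<open>length xs\<close>
  odd.\<close>

definition hole :: "('a \<Rightarrow> 'a \<Rightarrow> bool) \<Rightarrow> 'a \<Rightarrow> 'a list \<Rightarrow> bool" where
  "hole E x xs \<longleftrightarrow> x \<notin> set xs \<and> ipath E xs \<and> 3 \<le> length xs \<and>
     (\<forall>i<length xs. E x (xs ! i) \<longleftrightarrow> i = 0 \<or> Suc i = length xs)"

definition odd_hole_free :: "('a \<Rightarrow> 'a \<Rightarrow> bool) \<Rightarrow> 'a set \<Rightarrow> bool" where
  "odd_hole_free E V \<longleftrightarrow> (\<forall>x\<in>V. \<forall>xs. set xs \<subseteq> V \<longrightarrow> hole E x xs \<longrightarrow> odd (length xs))"

definition diamond_free :: "('a \<Rightarrow> 'a \<Rightarrow> bool) \<Rightarrow> 'a set \<Rightarrow> bool" where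
  "diamond_free E V \<longleftrightarrow> (\<forall>a\<in>V. \<forall>c\<in>V. \<forall>b\<in>V. \<forall>d\<in>V.
     E b d \<longrightarrow> E a b \<longrightarrow> E a d \<longrightarrow> E c b \<longrightarrow> E c d \<longrightarrow> a \<noteq> c \<longrightarrow> E a c)"

lemma diamond_freeD:
  "diamond_free E V \<Longrightarrow> {a, c, b, d} \<subseteq> V \<Longrightarrow> E b d \<Longrightarrow> E a b \<Longrightarrow> E a d \<Longrightarrow> E c b \<Longrightarrow> E c d \<Longrightarrow> a \<noteq> c \<Longrightarrow> E a c"
  unfolding diamond_free_def by blast

lemma odd_hole_freeD:
  assumes "odd_hole_free E V" "x \<in> V" "set xs \<subseteq> V" "x \<notin> set xs" "ipath E xs" "3 \<le> length xs"
    and "\<And>i. i < length xs \<Longrightarrow> E x (xs ! i) \<longleftrightarrow> i = 0 \<or> Suc i = length xs"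
  shows "odd (length xs)"
  using assms unfolding odd_hole_free_def hole_def by blast

lemma ipath_nth:
  "ipath E xs \<Longrightarrow> i < length xs \<Longrightarrow> j < length xs \<Longrightarrow> E (xs ! i) (xs ! j) \<longleftrightarrow> i = Suc j \<or> j = Suc i"
  unfolding ipath_def by blast

lemma ipath_distinct: "ipath E xs \<Longrightarrow> distinct xs"
  unfolding ipath_def by blast

lemma ipath_take: "ipath E xs \<Longrightarrow> ipath E (take n xs)"
  unfolding ipath_def by auto

lemma ipath_drop:
  assumes "ipath E xs"
  shows "ipath E (drop n xs)"
  unfolding ipath_def
proof (intro conjI allI impI)
  show "distinct (drop n xs)" using ipath_distinct[OF assms] by simp
  fix i j assume "i < length (drop n xs)" "j < length (drop n xs)"
  then show "E (drop n xs ! i) (drop n xs ! j) \<longleftrightarrow> i = Suc j \<or> j = Suc i"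
    using ipath_nth[OF assms, of "n + i" "n + j"] by auto
qed

lemma ipath_rev:
  assumes "ipath E xs"
  shows "ipath E (rev xs)"
  unfolding ipath_def
proof (intro conjI allI impI)
  show "distinct (rev xs)" using ipath_distinct[OF assms] by simp
  fix i j assume ij: "i < length (rev xs)" "j < length (rev xs)"
  then have "E (rev xs ! i) (rev xs ! j) \<longleftrightarrow>
      length xs - Suc i = Suc (length xs - Suc j) \<or> length xs - Suc j = Suc (length xs - Suc i)"
    using ipath_nth[OF assms, of "length xs - Suc i" "length xs - Suc j"] by (simp add: rev_nth)
  also have "\<dots> \<longleftrightarrow> i = Suc j \<or> j = Suc i" using ij by auto
  finally show "E (rev xs ! i) (rev xs ! j) \<longleftrightarrow> i = Suc j \<or> j = Suc i" .
qed

context adjacency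
begin

lemma ipath_append:
  assumes xs: "ipath E xs" "xs \<noteq> []" and ys: "ipath E ys" "ys \<noteq> []"
    and disj: "set xs \<inter> set ys = {}"
    and adj: "\<And>x y. x \<in> set xs \<Longrightarrow> y \<in> set ys \<Longrightarrow> E x y \<longleftrightarrow> x = last xs \<and> y = hd ys"
  shows "ipath E (xs @ ys)"
  unfolding ipath_def
proof (intro conjI allI impI)
  show "distinct (xs @ ys)" using ipath_distinct[OF xs(1)] ipath_distinct[OF ys(1)] disj by simp
  have cross: "E (xs ! i) (ys ! j) \<longleftrightarrow> Suc i = length xs \<and> j = 0" if "i < length xs" "j < length ys" for i j
  proof -
    have "xs ! i = last xs \<longleftrightarrow> i = length xs - 1"
      using that xs nth_eq_iff_index_eq[OF ipath_distinct[OF xs(1)], of i "length xs - 1"]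
      by (simp add: last_conv_nth)
    moreover have "ys ! j = hd ys \<longleftrightarrow> j = 0"
      using that ys nth_eq_iff_index_eq[OF ipath_distinct[OF ys(1)], of j 0] by (simp add: hd_conv_nth)
    ultimately show ?thesis using that adj[of "xs ! i" "ys ! j"] by auto
  qed
  fix i j assume "i < length (xs @ ys)" "j < length (xs @ ys)"
  then show "E ((xs @ ys) ! i) ((xs @ ys) ! j) \<longleftrightarrow> i = Suc j \<or> j = Suc i"
    using ipath_nth[OF xs(1), of i j] ipath_nth[OF ys(1), of "i - length xs" "j - length xs"]
      cross[of i "j - length xs"] cross[of j "i - length xs"]
      commute[of "ys ! (i - length xs)" "xs ! j"]
    by (cases "i < length xs"; cases "j < length xs") (auto simp: nth_append)
qed

lemma ipath_single: "ipath E [x]"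
  unfolding ipath_def using irrefl by simp

lemma ipath_Cons:
  assumes "ipath E xs" "xs \<noteq> []" "x \<notin> set xs"
    and "\<And>y. y \<in> set xs \<Longrightarrow> E x y \<longleftrightarrow> y = hd xs"
  shows "ipath E (x # xs)"
  using ipath_append[OF ipath_single[of x] _ assms(1,2)] assms(3,4) by simp

end

definition events :: "('a \<Rightarrow> 'a \<Rightarrow> bool) \<Rightarrow> 'a \<Rightarrow> 'a list \<Rightarrow> nat set" where
  "events E u xs = {i. i < length xs \<and> E u (xs ! i)}"

text \<open>Counted by \<open>takeWhile\<close>, so that prepending a list without neighbours of
  \<open>u\<close> just adds its length. The value is \<open>length xs\<close> if \<open>u\<close>
  has no neighbour on \<open>xs\<close>.\<close>

definition first_event :: "('a \<Rightarrow> 'a \<Rightarrow> bool) \<Rightarrow> 'a \<Rightarrow> 'a list \<Rightarrow> nat" where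
  "first_event E u xs = length (takeWhile (\<lambda>y. \<not> E u y) xs)"

locale odd_hole_free_graph = adjacency +
  fixes V :: "'a set"
  assumes dfree: "diamond_free E V" and ohf: "odd_hole_free E V"
begin

context
  fixes xs :: "'a list"
  assumes ip: "ipath E xs" and sub: "set xs \<subseteq> V"
begin

lemma segment:
  assumes "i \<le> j" "j < length xs"
  defines "ys \<equiv> take (Suc (j - i)) (drop i xs)"
  shows "ipath E ys" "set ys \<subseteq> set xs" "length ys = Suc (j - i)" "\<And>k. k \<le> j - i \<Longrightarrow> ys ! k = xs ! (i + k)"
    "hd ys = xs ! i" "last ys = xs ! j" "ys \<noteq> []"
    "\<And>y. y \<in> set ys \<Longrightarrow> \<exists>k. i \<le> k \<and> k \<le> j \<and> y = xs ! k"
proof -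
  show ipy: "ipath E ys" unfolding ys_def using ip by (intro ipath_take ipath_drop)
  show "set ys \<subseteq> set xs" unfolding ys_def by (meson order_trans set_drop_subset set_take_subset)
  show len: "length ys = Suc (j - i)" using assms by simp
  show nth: "ys ! k = xs ! (i + k)" if "k \<le> j - i" for k using assms that by simp
  show ne: "ys \<noteq> []" using len by auto
  show "hd ys = xs ! i" using nth[of 0] ne by (simp add: hd_conv_nth)
  show "last ys = xs ! j" using nth[of "j - i"] ne len assms by (simp add: last_conv_nth)
  fix y assume "y \<in> set ys"
  then obtain k where "k < length ys" "y = ys ! k" by (metis in_set_conv_nth)
  then show "\<exists>k. i \<le> k \<and> k \<le> j \<and> y = xs ! k"
    using nth[of k] len assms by (intro exI[of _ "i + k"]) auto
qed

lemma even_gaps_events: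
  assumes "u \<in> V" "u \<notin> set xs"
  shows "even_gaps (events E u xs)"
  unfolding even_gaps_def
proof (intro ballI impI)
  fix i j
  assume i: "i \<in> events E u xs" and j: "j \<in> events E u xs" and "i < j"
    and no: "\<forall>k. i < k \<and> k < j \<longrightarrow> k \<notin> events E u xs"
  have jl: "i \<le> j" "j < length xs" using j \<open>i < j\<close> by (auto simp: events_def)
  note seg = segment[OF this]
  show "j = Suc i \<or> even (i + j)"
  proof (cases "j = Suc i")
    case False
    have "odd (length (take (Suc (j - i)) (drop i xs)))"
    proof (rule odd_hole_freeD[OF ohf \<open>u \<in> V\<close>])
      fix k assume k: "k < length (take (Suc (j - i)) (drop i xs))"
      then have k': "k \<le> j - i" using seg(3) by simp
      show "E u (take (Suc (j - i)) (drop i xs) ! k) \<longleftrightarrow> k = 0 \<or> Suc k = length (take (Suc (j - i)) (drop i xs))"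
        unfolding seg(4)[OF k'] seg(3)
        using no i j k' jl by (cases "k = 0"; cases "k = j - i") (auto simp: events_def)
    qed (use seg sub assms jl False \<open>i < j\<close> in auto)
    then show ?thesis using seg(3) \<open>i < j\<close> by simp
  qed simp
qed

text \<open>The hole consists of \<open>v\<close> closing the path formed by \<open>u\<close> and
  the stretch. A common neighbour would allow \<open>i = j\<close>, and the hole would degenerate to
  a triangle.\<close>

lemma parity_linked_adjacent:
  assumes "u \<in> V" "u \<notin> set xs" "v \<in> V" "v \<notin> set xs" "E u v"
    and no_common: "\<And>y. y \<in> set xs \<Longrightarrow> \<not> (E u y \<and> E v y)"
  shows "parity_linked 1 (events E u xs) (events E v xs)"
  unfolding parity_linked_def
proof (intro ballI impI)
  fix i j
  assume i: "i \<in> events E u xs" and j: "j \<in> events E v xs" and "i \<le> j"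
    and nou: "\<forall>k. i < k \<and> k \<le> j \<longrightarrow> k \<notin> events E u xs"
    and nov: "\<forall>k. i \<le> k \<and> k < j \<longrightarrow> k \<notin> events E v xs"
  have jl: "i \<le> j" "j < length xs" using j \<open>i \<le> j\<close> by (auto simp: events_def)
  note seg = segment[OF this]
  define ys where "ys = take (Suc (j - i)) (drop i xs)"
  note seg = seg[folded ys_def]
  have "i \<noteq> j" using i j no_common[of "xs ! i"] by (auto simp: events_def)
  have nth: "E u (xs ! k) \<longleftrightarrow> k = i" "E v (xs ! k) \<longleftrightarrow> k = j" if "i \<le> k" "k \<le> j" for k
    using nou nov i j that jl by (cases "k = i"; cases "k = j"; auto simp: events_def)+
  have d: "distinct xs" using ip ipath_distinct by blast
  have ipc: "ipath E (u # ys)"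
  proof (rule ipath_Cons[OF seg(1) seg(7)])
    show "u \<notin> set ys" using seg(2) assms by auto
    fix y assume "y \<in> set ys"
    then obtain k where k: "i \<le> k" "k \<le> j" "y = xs ! k" using seg(8) by blast
    then show "E u y \<longleftrightarrow> y = hd ys" using nth(1)[of k] seg(5) d jl by (auto simp: nth_eq_iff_index_eq)
  qed
  have "odd (length (u # ys))"
  proof (rule odd_hole_freeD[OF ohf \<open>v \<in> V\<close> _ _ ipc])
    show "set (u # ys) \<subseteq> V" using seg(2) sub assms by auto
    show "v \<notin> set (u # ys)" using seg(2) assms irrefl by auto
    show "3 \<le> length (u # ys)" using seg(3) jl \<open>i \<noteq> j\<close> by auto
    fix k assume k: "k < length (u # ys)"
    show "E v ((u # ys) ! k) \<longleftrightarrow> k = 0 \<or> Suc k = length (u # ys)"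
    proof (cases k)
      case 0 then show ?thesis using sym[OF assms(5)] by simp
    next
      case (Suc l)
      then have "l \<le> j - i" using k seg(3) by simp
      then show ?thesis using Suc seg(3,4) nth(2)[of "i + l"] jl by auto
    qed
  qed
  then show "even (i + j + 1)" using seg(3) jl by simp
qed

text \<open>The hole consists of \<open>x\<close> closing the path from \<open>u\<close> through the
  stretch to \<open>v\<close>; for \<open>i = j\<close> it is a four-cycle.\<close>

lemma parity_linked_common_neighbour:
  assumes "u \<in> V" "u \<notin> set xs" "v \<in> V" "v \<notin> set xs" "u \<noteq> v" "\<not> E u v"
    and "x \<in> V" "x \<notin> set xs" "E x u" "E x v" and anti: "\<And>y. y \<in> set xs \<Longrightarrow> \<not> E x y"
  shows "parity_linked 0 (events E u xs) (events E v xs)"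
  unfolding parity_linked_def
proof (intro ballI impI)
  fix i j
  assume i: "i \<in> events E u xs" and j: "j \<in> events E v xs" and "i \<le> j"
    and nou: "\<forall>k. i < k \<and> k \<le> j \<longrightarrow> k \<notin> events E u xs"
    and nov: "\<forall>k. i \<le> k \<and> k < j \<longrightarrow> k \<notin> events E v xs"
  have jl: "i \<le> j" "j < length xs" using j \<open>i \<le> j\<close> by (auto simp: events_def)
  note seg = segment[OF this]
  define ys where "ys = take (Suc (j - i)) (drop i xs)"
  note seg = seg[folded ys_def]
  have nth: "E u (xs ! k) \<longleftrightarrow> k = i" "E v (xs ! k) \<longleftrightarrow> k = j" if "i \<le> k" "k \<le> j" for k
    using nou nov i j that jl by (cases "k = i"; cases "k = j"; auto simp: events_def)+
  have d: "distinct xs" using ip ipath_distinct by blast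
  have ends: "E u y \<longleftrightarrow> y = hd ys" "E v y \<longleftrightarrow> y = last ys" if y: "y \<in> set ys" for y
  proof -
    obtain k where k: "i \<le> k" "k \<le> j" "y = xs ! k" using seg(8)[OF y] by blast
    then show "E u y \<longleftrightarrow> y = hd ys" "E v y \<longleftrightarrow> y = last ys"
      using nth[of k] seg(5,6) d jl by (auto simp: nth_eq_iff_index_eq)
  qed
  have ip1: "ipath E (ys @ [v])"
    by (rule ipath_append[OF seg(1,7) ipath_single])
      (use seg(2) assms ends in \<open>auto simp: commute[of _ v]\<close>)
  have ipc: "ipath E (u # ys @ [v])"
    by (rule ipath_Cons[OF ip1]) (use seg(2,7) assms ends irrefl in auto)
  have "odd (length (u # ys @ [v]))"
  proof (rule odd_hole_freeD[OF ohf \<open>x \<in> V\<close> _ _ ipc])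
    show "set (u # ys @ [v]) \<subseteq> V" using seg(2) sub assms by auto
    show "x \<notin> set (u # ys @ [v])" using seg(2) assms irrefl by auto
    show "3 \<le> length (u # ys @ [v])" using seg(3) by auto
    fix k assume k: "k < length (u # ys @ [v])"
    show "E x ((u # ys @ [v]) ! k) \<longleftrightarrow> k = 0 \<or> Suc k = length (u # ys @ [v])"
    proof (cases k)
      case 0 then show ?thesis using assms by simp
    next
      case (Suc l)
      show ?thesis
      proof (cases "l < length ys")
        case True
        then have "ys ! l \<in> set xs" using seg(2) by auto
        then show ?thesis using Suc True anti by (simp add: nth_append)
      next
        case False
        then show ?thesis using Suc k assms by (simp add: nth_append)
      qed
    qed
  qed
  then show "even (i + j + 0)" using seg(3) jl by simp
qed

end

end

section \<open>Shortest walks between two sets of vertices\<close>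

definition link :: "('a \<Rightarrow> 'a \<Rightarrow> bool) \<Rightarrow> 'a set \<Rightarrow> 'a set \<Rightarrow> 'a set \<Rightarrow> 'a list \<Rightarrow> bool" where
  "link E W A B zs \<longleftrightarrow> zs \<noteq> [] \<and> set zs \<subseteq> W \<and> successively E zs \<and> hd zs \<in> A \<and> last zs \<in> B"

definition shortest_link :: "('a \<Rightarrow> 'a \<Rightarrow> bool) \<Rightarrow> 'a set \<Rightarrow> 'a set \<Rightarrow> 'a set \<Rightarrow> 'a list \<Rightarrow> bool" where
  "shortest_link E W A B zs \<longleftrightarrow> link E W A B zs \<and> (\<forall>ys. link E W A B ys \<longrightarrow> length zs \<le> length ys)"

lemma shortest_link_exists:
  assumes "link E W A B zs"
  obtains ys where "shortest_link E W A B ys"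
proof -
  have "\<exists>ys. link E W A B ys \<and> (\<forall>zs. link E W A B zs \<longrightarrow> length ys \<le> length zs)"
    using assms by (intro ex_has_least_nat)
  then show thesis using that unfolding shortest_link_def by blast
qed

lemma successively_take: "successively P xs \<Longrightarrow> successively P (take n xs)"
  by (metis append_take_drop_id successively_append_iff)

lemma successively_drop: "successively P xs \<Longrightarrow> successively P (drop n xs)"
  by (metis append_take_drop_id successively_append_iff)

lemma last_take_Suc: "i < length xs \<Longrightarrow> last (take (Suc i) xs) = xs ! i"
  by (simp add: take_Suc_conv_app_nth)

lemma first_event:
  assumes "\<exists>y\<in>set xs. E u y"
  shows "first_event E u xs < length xs" "E u (xs ! first_event E u xs)"
    "k < first_event E u xs \<Longrightarrow> \<not> E u (xs ! k)"
proof -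
  let ?P = "\<lambda>y. \<not> E u y"
  have "takeWhile ?P xs \<noteq> xs" using assms by (auto simp: takeWhile_eq_all_conv)
  then show len: "first_event E u xs < length xs"
    unfolding first_event_def by (metis length_takeWhile_le nat_less_le takeWhile_eq_take take_all order_refl)
  then show "E u (xs ! first_event E u xs)"
    using nth_length_takeWhile[of ?P xs] unfolding first_event_def by blast
  assume k: "k < first_event E u xs"
  then have "takeWhile ?P xs ! k \<in> set (takeWhile ?P xs)" unfolding first_event_def by (intro nth_mem)
  then show "\<not> E u (xs ! k)"
    using k takeWhile_nth[of k ?P xs] set_takeWhileD[of _ ?P xs] unfolding first_event_def by metis
qed

lemma shortest_linkD: "shortest_link E W A B zs \<Longrightarrow> link E W A B zs"
  unfolding shortest_link_def by blast

text \<open>The vertex \<open>w\<close> could replace everything before position \<open>i\<close>.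
  The other facts about shortest links cut and reconnect the walk in the same manner.\<close>

lemma shortest_link_start:
  assumes sl: "shortest_link E W A B zs" and i: "i < length zs" and w: "w \<in> W \<inter> A" "E w (zs ! i)"
  shows "i \<le> 1"
proof -
  have "link E W A B (w # drop i zs)"
    using shortest_linkD[OF sl] i w set_drop_subset[of i zs]
    by (auto simp: link_def successively_Cons hd_drop_conv_nth intro!: successively_drop)
  then have "length zs \<le> length (w # drop i zs)" using sl unfolding shortest_link_def by blast
  then show ?thesis using i by simp
qed

lemma shortest_link_in_start:
  assumes sl: "shortest_link E W A B zs" and i: "i < length zs" and w: "zs ! i \<in> A"
  shows "i = 0"
proof -
  have "link E W A B (drop i zs)"
    using shortest_linkD[OF sl] i w set_drop_subset[of i zs]
    by (auto simp: link_def hd_drop_conv_nth intro!: successively_drop)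
  then have "length zs \<le> length (drop i zs)" using sl unfolding shortest_link_def by blast
  then show ?thesis using i by auto
qed

lemma shortest_link_end:
  assumes sl: "shortest_link E W A B zs" and i: "i < length zs" and w: "w \<in> W \<inter> B" "E (zs ! i) w"
  shows "length zs \<le> i + 2"
proof -
  have "link E W A B (take (Suc i) zs @ [w])"
    using shortest_linkD[OF sl] i w set_take_subset[of "Suc i" zs]
    by (auto simp: link_def successively_append_iff last_take_Suc successively_take)
  then have "length zs \<le> length (take (Suc i) zs @ [w])" using sl unfolding shortest_link_def by blast
  then show ?thesis using i by simp
qed

lemma shortest_link_in_end:
  assumes sl: "shortest_link E W A B zs" and i: "i < length zs" and w: "zs ! i \<in> B"
  shows "Suc i = length zs"
proof -
  have "link E W A B (take (Suc i) zs)"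
    using shortest_linkD[OF sl] i w set_take_subset[of "Suc i" zs]
    by (auto simp: link_def last_take_Suc successively_take)
  then have "length zs \<le> length (take (Suc i) zs)" using sl unfolding shortest_link_def by blast
  then show ?thesis using i by simp
qed

lemma shortest_link_jump:
  assumes sl: "shortest_link E W A B zs" and ij: "i < j" "j < length zs"
    and "E (zs ! i) (zs ! j)"
  shows "j = Suc i"
proof -
  have "link E W A B (take (Suc i) zs @ drop j zs)"
    using shortest_linkD[OF sl] assms set_take_subset[of "Suc i" zs] set_drop_subset[of j zs]
    by (auto simp: link_def successively_append_iff successively_take successively_drop hd_drop_conv_nth
        last_take_Suc)
  then have "length zs \<le> length (take (Suc i) zs @ drop j zs)" using sl unfolding shortest_link_def by blast
  then show ?thesis using ij by simp
qed

lemma shortest_link_distinct: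
  assumes sl: "shortest_link E W A B zs"
  shows "distinct zs"
proof (rule ccontr)
  assume "\<not> distinct zs"
  then obtain i j where "i < length zs" "j < length zs" "i \<noteq> j" "zs ! i = zs ! j"
    by (auto simp: distinct_conv_nth)
  then obtain i j where ij: "i < j" "j < length zs" "zs ! i = zs ! j"
    by (metis linorder_neqE_nat)
  have "link E W A B (take i zs @ drop j zs)"
  proof (cases i)
    case 0
    then show ?thesis using shortest_linkD[OF sl] ij set_drop_subset[of j zs]
      by (auto simp: link_def hd_drop_conv_nth hd_conv_nth successively_drop)
  next
    case (Suc k)
    have "E (zs ! k) (zs ! j)"
      using shortest_linkD[OF sl] ij Suc by (auto simp: link_def successively_conv_nth simp flip: ij(3))
    then show ?thesis
      using shortest_linkD[OF sl] ij Suc set_take_subset[of i zs] set_drop_subset[of j zs]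
      by (auto simp: link_def successively_append_iff successively_take successively_drop hd_drop_conv_nth
        last_take_Suc)
  qed
  then have "length zs \<le> length (take i zs @ drop j zs)" using sl unfolding shortest_link_def by blast
  then show False using ij by simp
qed

lemma (in adjacency) shortest_link_ipath:
  assumes sl: "shortest_link E W A B zs"
  shows "ipath E zs"
  unfolding ipath_def
proof (intro conjI allI impI)
  show "distinct zs" using shortest_link_distinct[OF sl] .
  fix i j assume "i < length zs" "j < length zs"
  then show "E (zs ! i) (zs ! j) \<longleftrightarrow> i = Suc j \<or> j = Suc i"
    using shortest_link_jump[OF sl, of i j] shortest_link_jump[OF sl, of j i]
      shortest_linkD[OF sl] irrefl commute[of "zs ! j" "zs ! i"]
    by (cases i j rule: linorder_cases) (auto simp: link_def successively_conv_nth dest: sym)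
qed

text \<open>Connectivity by closed subsets: its failure directly supplies the two sides of a
  cutset.\<close>

definition connected_on :: "('a \<Rightarrow> 'a \<Rightarrow> bool) \<Rightarrow> 'a set \<Rightarrow> bool" where
  "connected_on E W \<longleftrightarrow> (\<forall>X\<subseteq>W. X \<noteq> {} \<longrightarrow> (\<forall>x\<in>X. \<forall>y\<in>W. E x y \<longrightarrow> y \<in> X) \<longrightarrow> X = W)"

lemma connected_on_link:
  assumes "connected_on E W" "A \<subseteq> W" "B \<subseteq> W" "A \<noteq> {}" "B \<noteq> {}"
  obtains zs where "link E W A B zs"
proof -
  let ?X = "{w \<in> W. \<exists>zs. link E W A {w} zs}"
  have "?X = W"
  proof (rule assms(1)[unfolded connected_on_def, rule_format])
    show "?X \<subseteq> W" by auto
    obtain a where a: "a \<in> A" using assms by auto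
    then have "link E W A {a} [a]" using assms by (auto simp: link_def)
    then show "?X \<noteq> {}" using a assms by blast
    fix w y assume "w \<in> ?X" "y \<in> W" "E w y"
    then obtain zs where "link E W A {w} zs" by blast
    then have "link E W A {y} (zs @ [y])" using \<open>y \<in> W\<close> \<open>E w y\<close>
      by (auto simp: link_def successively_append_iff)
    then show "y \<in> ?X" using \<open>y \<in> W\<close> by blast
  qed
  moreover obtain b where "b \<in> B" using assms by auto
  ultimately obtain zs where "link E W A {b} zs" using assms(3) by blast
  then show thesis using that \<open>b \<in> B\<close> by (auto simp: link_def)
qed

context adjacency
begin

text \<open>\<open>Q\<close> is the interior of a shortest walk from \<open>A\<close> to
  \<open>B\<close>. It is nonempty because the two sets are disjoint and no edge joins them, and by
  minimality only its ends touch \<open>A\<close> and \<open>B\<close>.\<close>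

lemma shortest_connection:
  assumes "connected_on E W" "A \<subseteq> W" "B \<subseteq> W" "A \<noteq> {}" "B \<noteq> {}" "A \<inter> B = {}"
    and anti: "\<And>a b. a \<in> A \<Longrightarrow> b \<in> B \<Longrightarrow> \<not> E a b"
  obtains Q where "Q \<noteq> []" "ipath E Q" "set Q \<subseteq> W - A - B"
    "\<And>y. y \<in> set Q \<Longrightarrow> (\<exists>a\<in>A. E y a) \<longleftrightarrow> y = hd Q"
    "\<And>y. y \<in> set Q \<Longrightarrow> (\<exists>b\<in>B. E y b) \<longleftrightarrow> y = last Q"
proof -
  obtain zs where sl: "shortest_link E W A B zs"
    by (rule connected_on_link[OF assms(1-5)], rule shortest_link_exists)
  have lk: "zs \<noteq> []" "set zs \<subseteq> W" "hd zs \<in> A" "last zs \<in> B"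
    using shortest_linkD[OF sl] by (auto simp: link_def)
  note ip = shortest_link_ipath[OF sl]
  define n where "n = length zs"
  have n: "n > 0" using lk n_def by auto
  have z0: "zs ! 0 \<in> A" "zs ! (n - 1) \<in> B" using lk n_def by (auto simp: hd_conv_nth last_conv_nth)
  have "n \<noteq> 1" using z0 \<open>A \<inter> B = {}\<close> by auto
  moreover have "n \<noteq> 2"
  proof
    assume "n = 2"
    then show False using z0 anti[of "zs ! 0" "zs ! 1"] ipath_nth[OF ip, of 0 1] by (simp add: n_def)
  qed
  ultimately have n3: "n \<ge> 3" using n by linarith
  define Q where "Q = take (n - 2) (drop 1 zs)"
  have lenQ: "length Q = n - 2" using n3 by (simp add: Q_def n_def)
  have nthQ: "Q ! k = zs ! Suc k" if "k < n - 2" for k using that by (simp add: Q_def n_def)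
  have inQ: "\<exists>k. Suc k < n - 1 \<and> y = zs ! Suc k \<and> y = Q ! k" if y: "y \<in> set Q" for y
  proof -
    obtain k where k: "k < n - 2" "y = Q ! k" using y unfolding in_set_conv_nth lenQ by blast
    then have "Suc k < n - 1" "y = zs ! Suc k" using nthQ[of k] by simp_all
    then show ?thesis using k(2) by blast
  qed
  have Qne: "Q \<noteq> []" using lenQ n3 by auto
  have dQ: "distinct Q" unfolding Q_def using ipath_distinct[OF ip] by simp
  have idx: "Q ! k = hd Q \<longleftrightarrow> k = 0" "Q ! k = last Q \<longleftrightarrow> k = n - 3" if "k < n - 2" for k
    using that dQ Qne lenQ n3 by (auto simp: hd_conv_nth last_conv_nth nth_eq_iff_index_eq)
  show thesis
  proof (rule that[OF Qne])
    show "ipath E Q" unfolding Q_def by (intro ipath_take ipath_drop ip)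
    show "set Q \<subseteq> W - A - B"
    proof
      fix y assume "y \<in> set Q"
      then obtain k where k: "Suc k < n - 1" "y = zs ! Suc k" using inQ by blast
      then have "y \<in> W" using lk n_def by auto
      moreover have len: "Suc k < length zs" using k(1) n_def by simp
      moreover have "y \<notin> A" using shortest_link_in_start[OF sl len] k(2) by auto
      moreover have "y \<notin> B" using shortest_link_in_end[OF sl len] k n_def by auto
      ultimately show "y \<in> W - A - B" by blast
    qed
    fix y assume "y \<in> set Q"
    then obtain k where k: "Suc k < n - 1" "y = zs ! Suc k" "y = Q ! k" using inQ by blast
    have len: "Suc k < length zs" using k(1) n_def by simp
    show "(\<exists>a\<in>A. E y a) \<longleftrightarrow> y = hd Q"
    proof
      assume "\<exists>a\<in>A. E y a"
      then obtain a where "a \<in> A" "E a y" using commute by blast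
      then have "Suc k \<le> 1" using shortest_link_start[OF sl len, of a] k assms(2) by auto
      then show "y = hd Q" using idx(1)[of k] k by auto
    next
      assume "y = hd Q"
      then have "k = 0" using idx(1)[of k] k by auto
      then show "\<exists>a\<in>A. E y a" using z0 k len lk(1) ipath_nth[OF ip, of 1 0] by auto
    qed
    show "(\<exists>b\<in>B. E y b) \<longleftrightarrow> y = last Q"
    proof
      assume "\<exists>b\<in>B. E y b"
      then obtain b where "b \<in> B" "E y b" by blast
      then have "n \<le> Suc k + 2" using shortest_link_end[OF sl len, of b] k n_def assms(3) by auto
      then show "y = last Q" using idx(2)[of k] k by auto
    next
      assume "y = last Q"
      then have "n - 1 = Suc (Suc k)" using idx(2)[of k] k n3 by auto
      then have "E y (zs ! (n - 1))" using k(2) len n_def ipath_nth[OF ip, of "Suc k" "n - 1"] by auto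
      then show "\<exists>b\<in>B. E y b" using z0 by blast
    qed
  qed
qed

lemma path_to_first_neighbour:
  assumes "ipath E As" "\<exists>a\<in>set As. E q a"
  obtains L where "ipath E L" "L \<noteq> []" "set L \<subseteq> set As" "hd L = hd As"
    "\<And>y. y \<in> set L \<Longrightarrow> E q y \<longleftrightarrow> y = last L"
proof -
  define m where "m = first_event E q As"
  have m: "m < length As" "E q (As ! m)" "\<And>k. k < m \<Longrightarrow> \<not> E q (As ! k)"
    using first_event[of As E q] assms(2) by (simp_all add: m_def)
  let ?L = "take (Suc m) As"
  have last: "last ?L = As ! m" using m by (simp add: take_Suc_conv_app_nth)
  show thesis
  proof (rule that)
    show "ipath E ?L" by (intro ipath_take assms)
    show "?L \<noteq> []" "hd ?L = hd As" using m by auto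
    show "set ?L \<subseteq> set As" by (rule set_take_subset)
    fix y assume "y \<in> set ?L"
    then obtain k where "k < length ?L" "y = ?L ! k" unfolding in_set_conv_nth by blast
    then have k: "k \<le> m" "y = As ! k" "k < length As" using m(1) by simp_all
    show "E q y \<longleftrightarrow> y = last ?L" unfolding last k(2)
      using m k ipath_distinct[OF assms(1)] by (cases "k = m") (auto simp: nth_eq_iff_index_eq)
  qed
qed

end

section \<open>Parities on a path glued from three pieces\<close>

context odd_hole_free_graph
begin

text \<open>If \<open>i\<close> is the last position of a neighbour of \<open>u\<close> and
  \<open>j\<close> the first of a neighbour of \<open>v\<close>, then
  \<open>first_event E u (rev xs)\<close> is \<open>length xs - 1 - i\<close>, so this is the parity
  of \<open>i + j + of_bool (E u v)\<close>. Counting \<open>u\<close> from the back gives each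
  vertex a summand of its own.\<close>

lemma last_event_first_event_parity:
  assumes ip: "ipath E xs" "xs \<noteq> []" and W: "set xs \<subseteq> {w \<in> V. w \<noteq> x \<and> \<not> E x w}"
    and uv: "x \<in> V" "u \<in> V" "v \<in> V" "E x u" "E x v" "u \<noteq> v"
    and ends: "E u (hd xs)" "E v (last xs)"
  shows "even (first_event E u (rev xs) + first_event E v xs + length xs + 1 + of_bool (E u v))"
proof -
  have sub: "set xs \<subseteq> V" using W by auto
  have notin: "u \<notin> set xs" "v \<notin> set xs" "x \<notin> set xs" using W uv by auto
  have anti: "\<not> E x y" if "y \<in> set xs" for y using W that by auto
  define P where "P = events E u xs"
  define Q where "Q = events E v xs"
  define c :: nat where "c = of_bool (E u v)"
  \<comment> \<open>Otherwise \<open>x\<close> and \<open>y\<close> are the nonadjacent tips of a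
    diamond over the edge \<open>u v\<close>.\<close>
  have no_common: "\<not> (E u y \<and> E v y)" if "y \<in> set xs" "E u v" for y
  proof
    assume "E u y \<and> E v y"
    then have "E x y" using that W uv notin
      by (intro diamond_freeD[OF dfree, of x y u v]) (auto simp: commute)
    then show False using anti that by blast
  qed
  have linked: "parity_linked c P Q \<and> parity_linked c Q P"
  proof (cases "E u v")
    case True
    then show ?thesis
      unfolding c_def P_def Q_def
      using parity_linked_adjacent[OF ip(1) sub, of u v] parity_linked_adjacent[OF ip(1) sub, of v u]
        uv notin no_common by (auto simp: commute)
  next
    case False
    then show ?thesis
      unfolding c_def P_def Q_def
      using parity_linked_common_neighbour[OF ip(1) sub, of u v x]
        parity_linked_common_neighbour[OF ip(1) sub, of v u x] uv notin anti
      by (auto simp: commute)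
  qed
  \<comment> \<open>Two successive common neighbours are adjacent, so diamond-freeness makes
    \<open>u\<close> and \<open>v\<close> adjacent, against \<open>no_common\<close>.\<close>
  have no2: "Suc k \<notin> Q" if "k \<in> P" "k \<in> Q" "Suc k \<in> P" for k
  proof
    assume "Suc k \<in> Q"
    then have k: "Suc k < length xs" "E u (xs ! k)" "E v (xs ! k)" "E u (xs ! Suc k)" "E v (xs ! Suc k)"
      using that by (auto simp: P_def Q_def events_def)
    then have "E (xs ! k) (xs ! Suc k)" using ipath_nth[OF ip(1)] by auto
    then have "E u v" using k uv sub by (intro diamond_freeD[OF dfree, of u v "xs ! k" "xs ! Suc k"]) auto
    then show False using no_common[of "xs ! k"] k by auto
  qed
  define j where "j = first_event E v xs"
  define d where "d = first_event E u (rev xs)"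
  define n where "n = length xs"
  have n: "n > 0" using ip n_def by auto
  have j: "j < n" "E v (xs ! j)" "\<And>k. k < j \<Longrightarrow> \<not> E v (xs ! k)"
    using first_event[of xs E v] ends(2) ip(2) last_in_set[of xs] unfolding j_def n_def by blast+
  have d: "d < n" "E u (rev xs ! d)" "\<And>k. k < d \<Longrightarrow> \<not> E u (rev xs ! k)"
    using first_event[of "rev xs" E u] ends(1) ip(2) hd_in_set[of xs] unfolding d_def n_def
    by (metis length_rev set_rev)+
  define i where "i = n - Suc d"
  have i: "i < n" "E u (xs ! i)" using d by (auto simp: i_def n_def rev_nth)
  have i': "\<not> E u (xs ! k)" if "i < k" "k < n" for k
    using d(3)[of "n - Suc k"] that n_def by (auto simp: i_def rev_nth)
  have "even (i + j + c)"
  proof (rule last_first_parity[of P Q c 0 "n - 1" i j])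
    show "even_gaps P" "even_gaps Q" unfolding P_def Q_def
      using even_gaps_events[OF ip(1) sub] uv notin by auto
    show "0 \<in> P" "n - 1 \<in> Q" using ends ip n
      by (auto simp: P_def Q_def events_def hd_conv_nth last_conv_nth n_def)
    show "i \<in> P" "j \<in> Q" using i j by (auto simp: P_def Q_def events_def n_def)
    show "k \<notin> P" if "i < k" "k \<le> n - 1" for k using i'[of k] that n by (auto simp: P_def events_def n_def)
    show "k \<notin> Q" if "0 \<le> k" "k < j" for k using j(3)[of k] that by (auto simp: Q_def events_def)
  qed (use linked no2 i j n in auto)
  moreover have "d + i + 1 = n" using d by (simp add: i_def)
  ultimately have "even (d + j + n + 1 + c)" by presburger
  then show ?thesis by (simp add: d_def j_def n_def c_def)
qed

text \<open>As \<open>u\<close> misses \<open>R\<close> and \<open>v\<close> misses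
  \<open>L\<close>, the term of \<open>u\<close> depends only on \<open>L @ Q\<close> and that of
  \<open>v\<close> only on \<open>Q @ R\<close>. Thus \<open>u\<close> with its \<open>L\<close> and
  \<open>v\<close> with its \<open>R\<close> can be varied independently while the other term stays
  fixed.\<close>

lemma glued_path_parity:
  assumes L: "ipath E L" "L \<noteq> []" and Q: "ipath E Q" "Q \<noteq> []" and R: "ipath E R" "R \<noteq> []"
    and W: "set L \<union> set Q \<union> set R \<subseteq> {w \<in> V. w \<noteq> x \<and> \<not> E x w}"
    and disj: "set L \<inter> set Q = {}" "set L \<inter> set R = {}" "set Q \<inter> set R = {}"
    and LQ: "\<And>a y. a \<in> set L \<Longrightarrow> y \<in> set Q \<Longrightarrow> E a y \<longleftrightarrow> a = last L \<and> y = hd Q"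
    and QR: "\<And>y b. y \<in> set Q \<Longrightarrow> b \<in> set R \<Longrightarrow> E y b \<longleftrightarrow> y = last Q \<and> b = hd R"
    and LR: "\<And>a b. a \<in> set L \<Longrightarrow> b \<in> set R \<Longrightarrow> \<not> E a b"
    and uv: "x \<in> V" "u \<in> V" "v \<in> V" "E x u" "E x v" "u \<noteq> v"
    and u: "E u (hd L)" "\<And>b. b \<in> set R \<Longrightarrow> \<not> E u b"
    and v: "E v (last R)" "\<And>a. a \<in> set L \<Longrightarrow> \<not> E v a"
  shows "even (first_event E u (rev (L @ Q)) + first_event E v (Q @ R) + length Q + 1 + of_bool (E u v))"
proof -
  have ipQR: "ipath E (Q @ R)"
    by (rule ipath_append) (use assms in auto)
  have ip: "ipath E (L @ Q @ R)"
    by (rule ipath_append[OF L ipQR]) (use Q R disj LQ LR in auto)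
  have "even (first_event E u (rev (L @ Q @ R)) + first_event E v (L @ Q @ R) + length (L @ Q @ R) + 1 + of_bool (E u v))"
    by (rule last_event_first_event_parity[OF ip _ _ uv]) (use L R W u v in auto)
  moreover have "first_event E u (rev (L @ Q @ R)) = length R + first_event E u (rev (L @ Q))"
    using u(2) takeWhile_append2[of "rev R" "\<lambda>y. \<not> E u y" "rev Q @ rev L"] by (simp add: first_event_def)
  moreover have "first_event E v (L @ Q @ R) = length L + first_event E v (Q @ R)"
    using v(2) takeWhile_append2[of L "\<lambda>y. \<not> E v y" "Q @ R"] by (simp add: first_event_def)
  moreover have "length (L @ Q @ R) = length L + length Q + length R" by simp
  ultimately show ?thesis by (cases "E u v") (simp_all only: of_bool_eq, presburger+)
qed

end

lemma ipath_appendD: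
  assumes "ipath E (xs @ ys)"
  shows "ipath E xs" "ipath E ys" "set xs \<inter> set ys = {}"
    "x \<in> set xs \<Longrightarrow> y \<in> set ys \<Longrightarrow> E x y \<longleftrightarrow> x = last xs \<and> y = hd ys"
proof -
  have d: "distinct (xs @ ys)" using ipath_distinct[OF assms] .
  show "ipath E xs" using ipath_take[OF assms, of "length xs"] by simp
  show "ipath E ys" using ipath_drop[OF assms, of "length xs"] by simp
  show "set xs \<inter> set ys = {}" using d by simp
  assume "x \<in> set xs" "y \<in> set ys"
  then obtain i j where ij: "i < length xs" "x = xs ! i" "j < length ys" "y = ys ! j"
    by (auto simp: in_set_conv_nth)
  have "xs \<noteq> []" "ys \<noteq> []" using ij by auto
  then have "x = last xs \<longleftrightarrow> Suc i = length xs" "y = hd ys \<longleftrightarrow> j = 0"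
    using ij d by (auto simp: last_conv_nth hd_conv_nth nth_eq_iff_index_eq)
  then show "E x y \<longleftrightarrow> x = last xs \<and> y = hd ys"
    using ipath_nth[OF assms, of i "length xs + j"] ij by (auto simp: nth_append)
qed

context odd_hole_free_graph
begin

text \<open>A shortest path joining the two holes outside the neighbourhood of \<open>x\<close> extends to four paths, from
  \<open>p\<close> or \<open>a\<close> to \<open>b\<close> or \<open>q\<close>; only the one between the adjacent vertices \<open>a\<close> and \<open>b\<close> has the opposite
  parity, although the four parities add up to zero.\<close>

lemma no_two_even_holes_on_triangle:
  assumes "x \<in> V" and ip: "ipath E (p # A @ [a, b] @ B @ [q])" and sub: "set (p # A @ [a, b] @ B @ [q]) \<subseteq> V"
    and ne: "A \<noteq> []" "B \<noteq> []" and x: "E x p" "E x a" "E x b" "E x q"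
    and anti: "\<And>y. y \<in> set A \<union> set B \<Longrightarrow> y \<noteq> x \<and> \<not> E x y"
    and conn: "connected_on E {w \<in> V. w \<noteq> x \<and> \<not> E x w}"
  shows False
proof -
  define W where "W = {w \<in> V. w \<noteq> x \<and> \<not> E x w}"
  have s1: "ipath E ([p] @ (A @ [a, b] @ B @ [q]))" using ip by simp
  have s2: "ipath E ((p # A) @ ([a, b] @ B @ [q]))" using ip by simp
  have s3: "ipath E ((p # A @ [a]) @ ([b] @ B @ [q]))" using ip by simp
  have s4: "ipath E ((p # A @ [a, b]) @ (B @ [q]))" using ip by simp
  have s5: "ipath E ((p # A @ [a, b] @ B) @ [q])" using ip by simp
  have ipA: "ipath E A" using ipath_appendD(1)[OF ipath_appendD(2)[OF s1]] .
  have ipB: "ipath E B" using ipath_appendD(1)[OF ipath_appendD(2)[OF s4]] .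
  have d: "distinct (p # A @ [a, b] @ B @ [q])" using ipath_distinct[OF ip] .
  have AB: "set A \<inter> set B = {}" using d by auto
  have nAB: "\<not> E y z" if "y \<in> set A" "z \<in> set B" for y z
    using ipath_appendD(4)[OF s2, of y z] that d by auto
  have pA: "E p y \<longleftrightarrow> y = hd A" if "y \<in> set A" for y
    using ipath_appendD(4)[OF s1, of p y] that ne by simp
  have pB: "\<not> E p y" if "y \<in> set B" for y
    using ipath_appendD(4)[OF s1, of p y] that ne d hd_in_set[OF ne(1)] by (auto simp: disjoint_iff)
  have aA: "E a y \<longleftrightarrow> y = last A" if "y \<in> set A" for y
    using ipath_appendD(4)[OF s2, of y a] that ne by (simp add: commute)
  have aB: "\<not> E a y" if "y \<in> set B" for y
    using ipath_appendD(4)[OF s3, of a y] that d by auto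
  have bA: "\<not> E b y" if "y \<in> set A" for y
    using ipath_appendD(4)[OF s2, of y b] that d by (auto simp: commute)
  have bB: "E b y \<longleftrightarrow> y = hd B" if "y \<in> set B" for y
    using ipath_appendD(4)[OF s4, of b y] that ne by simp
  have qA: "\<not> E q y" if "y \<in> set A" for y
    using ipath_appendD(4)[OF s5, of y q] that ne d last_in_set[of B] by (auto simp: commute)
  have qB: "E q y \<longleftrightarrow> y = last B" if "y \<in> set B" for y
    using ipath_appendD(4)[OF s5, of y q] that ne by (simp add: commute)
  have nE: "E a b" "\<not> E p b" "\<not> E p q" "\<not> E a q"
    using ipath_appendD(4)[OF s3, of a b] ipath_appendD(4)[OF s1, of p b] ipath_appendD(4)[OF s1, of p q]
      ipath_appendD(4)[OF s3, of a q] ne d hd_in_set[of A] by auto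
  have W: "set A \<subseteq> W" "set B \<subseteq> W" using anti sub by (auto simp: W_def)
  obtain Q where Q: "Q \<noteq> []" "ipath E Q" "set Q \<subseteq> W - set A - set B"
    and QA: "\<And>y. y \<in> set Q \<Longrightarrow> (\<exists>a\<in>set A. E y a) \<longleftrightarrow> y = hd Q"
    and QB: "\<And>y. y \<in> set Q \<Longrightarrow> (\<exists>b\<in>set B. E y b) \<longleftrightarrow> y = last Q"
    by (rule shortest_connection[of W "set A" "set B"])
      (use conn W ne AB nAB in \<open>auto simp: W_def\<close>)
  \<comment> \<open>\<open>L\<close> runs inside \<open>X\<close> from a chosen end \<open>u\<close>
    up to the first neighbour of \<open>c\<close>, the end of \<open>Q\<close> where it will be
    glued. Both ends of \<open>A\<close> and of \<open>B\<close> are needed as starting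
    points.\<close>
  define ends where "ends u X c L \<longleftrightarrow> ipath E L \<and> L \<noteq> [] \<and> set L \<subseteq> set X \<and> hd L = u \<and>
    (\<forall>y\<in>set L. E c y \<longleftrightarrow> y = last L)" for u :: 'a and X c L
  have ends_ex: "\<exists>L. ends (hd X) X c L" if "ipath E X" "\<exists>y\<in>set X. E c y" for X c
    using path_to_first_neighbour[OF that] unfolding ends_def by metis
  have hdQ: "\<exists>y\<in>set A. E (hd Q) y" using QA[of "hd Q"] Q by simp
  have lastQ: "\<exists>y\<in>set B. E (last Q) y" using QB[of "last Q"] Q by simp
  obtain Lp where Lp: "ends (hd A) A (hd Q) Lp" using ends_ex[OF ipA hdQ] by blast
  obtain La where La: "ends (last A) A (hd Q) La"
    using ends_ex[OF ipath_rev[OF ipA], of "hd Q"] hdQ ne by (auto simp: hd_rev ends_def)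
  obtain Rb where Rb: "ends (hd B) B (last Q) Rb" using ends_ex[OF ipB lastQ] by blast
  obtain Rq where Rq: "ends (last B) B (last Q) Rq"
    using ends_ex[OF ipath_rev[OF ipB], of "last Q"] lastQ ne by (auto simp: hd_rev ends_def)
  have glue: "even (first_event E u (rev (L @ Q)) + first_event E v (Q @ rev R) + length Q + 1 + of_bool (E u v))"
    if L: "ends s A (hd Q) L" and R: "ends t B (last Q) R"
      and u: "u \<in> V" "E x u" "E u s" "\<And>y. y \<in> set B \<Longrightarrow> \<not> E u y"
      and v: "v \<in> V" "E x v" "E v t" "\<And>y. y \<in> set A \<Longrightarrow> \<not> E v y" and "u \<noteq> v"
    for u v s t L R
  proof (rule glued_path_parity[where x = x])
    note L' = L[unfolded ends_def] and R' = R[unfolded ends_def]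
    show "ipath E L" "L \<noteq> []" "ipath E (rev R)" "rev R \<noteq> []" using L' R' ipath_rev by auto
    show "set L \<union> set Q \<union> set (rev R) \<subseteq> {w \<in> V. w \<noteq> x \<and> \<not> E x w}"
      using L' R' Q W unfolding W_def[symmetric] by auto
    show "set L \<inter> set Q = {}" "set L \<inter> set (rev R) = {}" "set Q \<inter> set (rev R) = {}"
      using L' R' Q AB by auto
    show "E y z \<longleftrightarrow> y = last L \<and> z = hd Q" if "y \<in> set L" "z \<in> set Q" for y z
      using L' that QA[of z] by (auto simp: commute)
    show "E z y \<longleftrightarrow> z = last Q \<and> y = hd (rev R)" if "z \<in> set Q" "y \<in> set (rev R)" for y z
      using R' that QB[of z] by (auto simp: hd_rev)
    show "\<not> E y z" if "y \<in> set L" "z \<in> set (rev R)" for y z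
      using L' R' that nAB by auto
    show "E u (hd L)" "E v (last (rev R))" using L' R' u v by (auto simp: last_rev)
    show "\<not> E u y" if "y \<in> set (rev R)" for y using R' that u by auto
    show "\<not> E v y" if "y \<in> set L" for y using L' that v by auto
  qed (use Q assms(1) u v \<open>u \<noteq> v\<close> in auto)
  have V: "p \<in> V" "a \<in> V" "b \<in> V" "q \<in> V" using sub by auto
  have dd: "p \<noteq> b" "p \<noteq> q" "a \<noteq> b" "a \<noteq> q" using d by auto
  have hds: "E p (hd A)" "E a (last A)" "E b (hd B)" "E q (last B)"
    using pA aA bB qB ne by simp_all
  \<comment> \<open>Each of the four \<open>first_event\<close> values occurs in exactly two of the
    four sums. Adding everything leaves only the surplus 1 contributed by the edge
    \<open>a b\<close>, which is odd.\<close>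
  have "even (first_event E p (rev (Lp @ Q)) + first_event E b (Q @ rev Rb) + length Q + 1)"
    using glue[OF Lp Rb V(1) x(1) hds(1) pB V(3) x(3) hds(3) bA dd(1)] nE by simp
  moreover have "even (first_event E p (rev (Lp @ Q)) + first_event E q (Q @ rev Rq) + length Q + 1)"
    using glue[OF Lp Rq V(1) x(1) hds(1) pB V(4) x(4) hds(4) qA dd(2)] nE by simp
  moreover have "even (first_event E a (rev (La @ Q)) + first_event E b (Q @ rev Rb) + length Q + 1 + 1)"
    using glue[OF La Rb V(2) x(2) hds(2) aB V(3) x(3) hds(3) bA dd(3)] nE by simp
  moreover have "even (first_event E a (rev (La @ Q)) + first_event E q (Q @ rev Rq) + length Q + 1)"
    using glue[OF La Rq V(2) x(2) hds(2) aB V(4) x(4) hds(4) qA dd(4)] nE by simp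
  ultimately show False by presburger
qed

end

section \<open>Diamond-free graphs without odd holes\<close>

definition colorable :: "('a \<Rightarrow> 'a \<Rightarrow> bool) \<Rightarrow> 'a set \<Rightarrow> nat \<Rightarrow> bool" where
  "colorable E V k \<longleftrightarrow> (\<exists>c. (\<forall>v\<in>V. c v < k) \<and> (\<forall>u\<in>V. \<forall>v\<in>V. E u v \<longrightarrow> c u \<noteq> (c v :: nat)))"

definition clique :: "('a \<Rightarrow> 'a \<Rightarrow> bool) \<Rightarrow> 'a set \<Rightarrow> bool" where
  "clique E K \<longleftrightarrow> (\<forall>u\<in>K. \<forall>v\<in>K. u \<noteq> v \<longrightarrow> E u v)"

text \<open>A bound instead of the exact clique number passes to subsets and to graphs with fewer
  edges without any recomputation.\<close>

definition clique_bound :: "('a \<Rightarrow> 'a \<Rightarrow> bool) \<Rightarrow> 'a set \<Rightarrow> nat \<Rightarrow> bool" where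
  "clique_bound E V k \<longleftrightarrow> (\<forall>K\<subseteq>V. clique E K \<longrightarrow> card K \<le> k)"

lemma clique_bound_mono: "clique_bound E V k \<Longrightarrow> U \<subseteq> V \<Longrightarrow> clique_bound E U k"
  unfolding clique_bound_def by blast

lemma clique_bound_reduce:
  assumes c: "\<forall>v\<in>U. c v < (k::nat)" "\<forall>u\<in>U. \<forall>v\<in>U. E u v \<longrightarrow> c u \<noteq> c v"
    and K: "K \<subseteq> U" "clique E K" and avoid: "a < k" "\<And>v. v \<in> K \<Longrightarrow> c v \<noteq> a"
  shows "card K \<le> k - 1"
proof -
  have "inj_on c K" using c(2) K unfolding clique_def inj_on_def by blast
  then have "card K = card (c ` K)" by (simp add: card_image)
  also have "\<dots> \<le> card ({..<k} - {a})" using c(1) K avoid by (intro card_mono) auto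
  also have "\<dots> = k - 1" using avoid by simp
  finally show ?thesis .
qed

section \<open>Star cutsets and rotation of holes\<close>

context adjacency
begin

text \<open>Chvatal's star cutset argument. The colour classes \<open>S1\<close> and
  \<open>S2\<close> of the centre meet \<open>C\<close> only in \<open>e\<close>, so their union is
  stable. A clique lies on one side, where deleting the class frees one of the \<open>k\<close>
  colours; hence the rest has clique bound \<open>k - 1\<close>, and the union receives the last
  colour.\<close>

lemma star_cutset_colorable:
  assumes "clique_bound E V k"
    and IH: "\<And>U j. U \<subset> V \<Longrightarrow> clique_bound E U j \<Longrightarrow> colorable E U j"
    and V: "V = C \<union> W1 \<union> W2" "W1 \<noteq> {}" "W2 \<noteq> {}" "C \<inter> W1 = {}" "C \<inter> W2 = {}" "W1 \<inter> W2 = {}"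
    and e: "e \<in> C" "\<And>y. y \<in> C \<Longrightarrow> y \<noteq> e \<Longrightarrow> E e y"
    and anti: "\<And>u v. u \<in> W1 \<Longrightarrow> v \<in> W2 \<Longrightarrow> \<not> E u v"
  shows "colorable E V k"
proof -
  have "colorable E (C \<union> W1) k" using V
    by (intro IH clique_bound_mono[OF assms(1)]) auto
  then obtain c1 where c1: "\<forall>v\<in>C \<union> W1. c1 v < k" "\<forall>u\<in>C \<union> W1. \<forall>v\<in>C \<union> W1. E u v \<longrightarrow> c1 u \<noteq> c1 v"
    unfolding colorable_def by blast
  have "colorable E (C \<union> W2) k" using V
    by (intro IH clique_bound_mono[OF assms(1)]) auto
  then obtain c2 where c2: "\<forall>v\<in>C \<union> W2. c2 v < k" "\<forall>u\<in>C \<union> W2. \<forall>v\<in>C \<union> W2. E u v \<longrightarrow> c2 u \<noteq> c2 v"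
    unfolding colorable_def by blast
  define S1 where "S1 = {v \<in> C \<union> W1. c1 v = c1 e}"
  define S2 where "S2 = {v \<in> C \<union> W2. c2 v = c2 e}"
  have S1: "v = e \<or> v \<in> W1" if "v \<in> S1" for v using that c1(2) e unfolding S1_def by fastforce
  have S2: "v = e \<or> v \<in> W2" if "v \<in> S2" for v using that c2(2) e unfolding S2_def by fastforce
  have eS: "e \<in> S1" "e \<in> S2" using e by (auto simp: S1_def S2_def)
  have stable: "\<not> E u v" if uv: "u \<in> S1 \<union> S2" "v \<in> S1 \<union> S2" for u v
  proof
    assume E: "E u v"
    have 1: "\<not> (u \<in> S1 \<and> v \<in> S1)" using c1(2) E unfolding S1_def by fastforce
    have 2: "\<not> (u \<in> S2 \<and> v \<in> S2)" using c2(2) E unfolding S2_def by fastforce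
    have "u \<noteq> e" "v \<noteq> e" using 1 2 uv eS by blast+
    moreover have "u \<in> S1 \<and> v \<in> S2 \<or> v \<in> S1 \<and> u \<in> S2" using 1 2 uv by blast
    ultimately have "u \<in> W1 \<and> v \<in> W2 \<or> v \<in> W1 \<and> u \<in> W2" using S1 S2 by metis
    then show False using anti E sym[OF E] by blast
  qed
  have k: "0 < k" using c1(1) e by fastforce
  have "clique_bound E (V - (S1 \<union> S2)) (k - 1)"
    unfolding clique_bound_def
  proof (intro allI impI)
    fix K assume K: "K \<subseteq> V - (S1 \<union> S2)" "clique E K"
    have "K \<inter> W1 = {} \<or> K \<inter> W2 = {}"
    proof (rule ccontr)
      assume "\<not> ?thesis"
      then obtain u v where uv: "u \<in> K" "u \<in> W1" "v \<in> K" "v \<in> W2" by blast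
      then have "u \<noteq> v" using V(6) by auto
      then have "E u v" using K(2) uv unfolding clique_def by simp
      then show False using anti uv by blast
    qed
    then have "K \<subseteq> C \<union> W1 \<or> K \<subseteq> C \<union> W2" using K(1) V(1) by auto
    then show "card K \<le> k - 1"
    proof
      assume "K \<subseteq> C \<union> W1"
      then show ?thesis using K c1(1) e
        by (intro clique_bound_reduce[OF c1 _ K(2), of "c1 e"]) (auto simp: S1_def)
    next
      assume "K \<subseteq> C \<union> W2"
      then show ?thesis using K c2(1) e
        by (intro clique_bound_reduce[OF c2 _ K(2), of "c2 e"]) (auto simp: S2_def)
    qed
  qed
  moreover have "V - (S1 \<union> S2) \<subset> V" using eS e V by auto
  ultimately have "colorable E (V - (S1 \<union> S2)) (k - 1)" by (intro IH)
  then obtain c where c: "\<forall>v\<in>V - (S1 \<union> S2). c v < k - 1"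
      "\<forall>u\<in>V - (S1 \<union> S2). \<forall>v\<in>V - (S1 \<union> S2). E u v \<longrightarrow> c u \<noteq> c v"
    unfolding colorable_def by blast
  let ?c = "\<lambda>v. if v \<in> S1 \<union> S2 then k - 1 else c v"
  have "?c v < k" if "v \<in> V" for v
  proof (cases "v \<in> S1 \<union> S2")
    case False
    then have "c v < k - 1" using c(1) that by blast
    then show ?thesis using False by simp
  qed (use k in simp)
  moreover have "?c u \<noteq> ?c v" if "u \<in> V" "v \<in> V" "E u v" for u v
  proof (cases "u \<in> S1 \<union> S2"; cases "v \<in> S1 \<union> S2")
    assume "u \<in> S1 \<union> S2" "v \<in> S1 \<union> S2"
    then show ?thesis using stable that by blast
  next
    assume *: "u \<in> S1 \<union> S2" "v \<notin> S1 \<union> S2"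
    then have "c v < k - 1" using c(1) that by blast
    then show ?thesis using * by simp
  next
    assume *: "u \<notin> S1 \<union> S2" "v \<in> S1 \<union> S2"
    then have "c u < k - 1" using c(1) that by blast
    then show ?thesis using * by simp
  next
    assume *: "u \<notin> S1 \<union> S2" "v \<notin> S1 \<union> S2"
    then have "c u \<noteq> c v" using c(2) that by blast
    then show ?thesis using * by simp
  qed
  ultimately show ?thesis unfolding colorable_def by (intro exI[of _ ?c] conjI ballI impI)
qed

lemma hole_step:
  assumes "hole E w (y # ys)"
  shows "hole E y (ys @ [w])"
proof -
  have h: "w \<notin> set (y # ys)" "ipath E ([y] @ ys)" "2 \<le> length ys"
    "\<And>i. i < Suc (length ys) \<Longrightarrow> E w ((y # ys) ! i) \<longleftrightarrow> i = 0 \<or> i = length ys"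
    using assms by (auto simp: hole_def)
  have ne: "ys \<noteq> []" using h by auto
  note ap = ipath_appendD[OF h(2)]
  have d: "distinct ys" using ipath_distinct[OF ap(2)] .
  have wys: "E w (ys ! i) \<longleftrightarrow> Suc i = length ys" if "i < length ys" for i
    using h(4)[of "Suc i"] that by auto
  show ?thesis
    unfolding hole_def
  proof (intro conjI allI impI)
    show "y \<notin> set (ys @ [w])" using ap(3) h(1) by auto
    show "ipath E (ys @ [w])"
    proof (rule ipath_append[OF ap(2) ne ipath_single])
      fix z x assume "z \<in> set ys" "x \<in> set [w]"
      then obtain i where "i < length ys" "z = ys ! i" "x = w" by (auto simp: in_set_conv_nth)
      moreover have "ys ! i = last ys \<longleftrightarrow> Suc i = length ys" if "i < length ys" for i
        using that d ne by (auto simp: last_conv_nth nth_eq_iff_index_eq)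
      ultimately show "E z x \<longleftrightarrow> z = last ys \<and> x = hd [w]" using wys by (auto simp: commute)
    qed (use h(1) in auto)
    fix i assume i: "i < length (ys @ [w])"
    show "E y ((ys @ [w]) ! i) \<longleftrightarrow> i = 0 \<or> Suc i = length (ys @ [w])"
    proof (cases "i < length ys")
      case True
      then have "ys ! i = hd ys \<longleftrightarrow> i = 0"
        using d ne by (simp add: hd_conv_nth nth_eq_iff_index_eq)
      then show ?thesis using ap(4)[of y "ys ! i"] True by (simp add: nth_append)
    next
      case False
      then show ?thesis using i h(4)[of 0] by (simp add: nth_append commute)
    qed
  qed (use h in auto)
qed

text \<open>Any vertex of a hole can be made the closing one, so a hole through the detached vertex
  may be assumed to be closed by it.\<close>

lemma hole_rotate: "hole E w (\<alpha> @ x # \<beta>) \<Longrightarrow> hole E x (\<beta> @ w # \<alpha>)"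
proof (induction \<alpha> arbitrary: w \<beta>)
  case Nil
  then show ?case using hole_step by simp
next
  case (Cons y \<alpha>)
  have "hole E y (\<alpha> @ x # (\<beta> @ [w]))" using hole_step Cons.prems by fastforce
  from Cons.IH[OF this] show ?case by simp
qed

end

section \<open>Detaching a vertex from a maximal clique\<close>

definition detach :: "('a \<Rightarrow> 'a \<Rightarrow> bool) \<Rightarrow> 'a \<Rightarrow> 'a set \<Rightarrow> 'a \<Rightarrow> 'a \<Rightarrow> bool" where
  "detach E x K a b \<longleftrightarrow> E a b \<and> \<not> (a = x \<and> b \<in> K) \<and> \<not> (b = x \<and> a \<in> K)"

locale maximal_clique_graph = odd_hole_free_graph +
  fixes K :: "'a set" and x :: 'a
  assumes K: "K \<subseteq> V" "clique E K" "x \<in> K"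
    and maximal: "\<And>y. y \<in> V \<Longrightarrow> (\<And>z. z \<in> K \<Longrightarrow> z \<noteq> y \<Longrightarrow> E y z) \<Longrightarrow> y \<in> K"
begin

abbreviation E' :: "'a \<Rightarrow> 'a \<Rightarrow> bool" where "E' \<equiv> detach E x K"

lemma adjacency_detach: "adjacency E'"
  by unfold_locales (auto simp: detach_def irrefl dest: sym)

text \<open>A vertex of \<open>K\<close> not adjacent to \<open>y\<close> would be the other tip of
  a diamond over the edge \<open>a b\<close>; so \<open>y\<close> is complete to \<open>K\<close>,
  and maximality applies.\<close>

lemma two_neighbours_in_clique:
  assumes "y \<in> V" "a \<in> K" "b \<in> K" "a \<noteq> b" "E y a" "E y b"
  shows "y \<in> K"
proof (rule maximal[OF assms(1)])
  fix z assume z: "z \<in> K" "z \<noteq> y"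
  show "E y z"
  proof (cases "z = a \<or> z = b")
    case False
    then have "E a b" "E z a" "E z b" using z assms K(2) unfolding clique_def by auto
    then show ?thesis
      using assms z K(1) by (intro diamond_freeD[OF dfree, of y z a b]) auto
  qed (use assms in auto)
qed

text \<open>A new diamond could only have \<open>x\<close> and a vertex of \<open>K\<close> as its
  tips. A common neighbour of these two belongs to \<open>K\<close>, and so has lost its edge to
  \<open>x\<close>.\<close>

lemma diamond_free_detach: "diamond_free E' V"
  unfolding diamond_free_def
proof (intro ballI impI)
  fix a c b d assume V: "a \<in> V" "c \<in> V" "b \<in> V" "d \<in> V"
    and E: "E' b d" "E' a b" "E' a d" "E' c b" "E' c d" "a \<noteq> c"
  then have "E b d" "E a b" "E a d" "E c b" "E c d" by (auto simp: detach_def)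
  then have "E a c" using V E(6) by (intro diamond_freeD[OF dfree, of a c b d]) auto
  moreover have "\<not> (a = x \<and> c \<in> K)"
  proof
    assume ac: "a = x \<and> c \<in> K"
    then have "b \<in> K" using V E K(3) \<open>E a b\<close> \<open>E c b\<close>
      by (intro two_neighbours_in_clique[of b a c]) (auto simp: commute)
    then show False using E(2) ac by (auto simp: detach_def)
  qed
  moreover have "\<not> (c = x \<and> a \<in> K)"
  proof
    assume ac: "c = x \<and> a \<in> K"
    then have "b \<in> K" using V E K(3) \<open>E a b\<close> \<open>E c b\<close>
      by (intro two_neighbours_in_clique[of b a c]) (auto simp: commute)
    then show False using E(4) ac by (auto simp: detach_def)
  qed
  ultimately show "E' a c" by (simp add: detach_def)
qed

text \<open>Restoring the deleted edges gives \<open>x\<close> additional neighbours at the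
  positions \<open>I\<close>. They lie in a clique, so there are at most two of them, and two are
  successive. With none or one, all gaps between neighbours of \<open>x\<close> would be even
  although they add up to the odd number \<open>n - 1\<close>; with two, \<open>x\<close> lies on a
  triangle flanked by two even holes.\<close>

lemma no_detached_odd_hole_at:
  assumes conn: "connected_on E {w \<in> V. w \<noteq> x \<and> \<not> E x w}"
    and h: "hole E' x xs" and sub: "set xs \<subseteq> V"
  shows "odd (length xs)"
proof (rule ccontr)
  assume ev: "\<not> odd (length xs)"
  define n where "n = length xs"
  have xV: "x \<in> V" using K by auto
  have xs: "x \<notin> set xs" "ipath E' xs" "3 \<le> n" and ends: "\<And>i. i < n \<Longrightarrow> E' x (xs ! i) \<longleftrightarrow> i = 0 \<or> Suc i = n"
    using h by (auto simp: hole_def n_def)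
  have n4: "4 \<le> n" using xs(3) ev n_def by presburger
  have nx: "xs ! i \<noteq> x" if "i < n" for i using xs(1) that n_def by (metis nth_mem)
  have ip: "ipath E xs"
    using xs(2) nx unfolding ipath_def n_def[symmetric] by (auto simp: detach_def)
  define I where "I = {i. i < n \<and> xs ! i \<in> K}"
  have ev_x: "i \<in> events E x xs \<longleftrightarrow> i = 0 \<or> Suc i = n \<or> i \<in> I" if "i < n" for i
    using ends[OF that] that nx[OF that] K(2,3)
    by (auto simp: events_def I_def n_def detach_def clique_def)
  have endI: "0 \<notin> I" "n - 1 \<notin> I"
    using ends[of 0] ends[of "n - 1"] n4 by (auto simp: I_def detach_def)
  have gaps: "j = Suc i \<or> even (i + j)"
    if "i < j" "j < n" "i \<in> events E x xs" "j \<in> events E x xs" "\<And>k. i < k \<Longrightarrow> k < j \<Longrightarrow> k \<notin> I" for i j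
    using even_gapsD[OF even_gaps_events[OF ip sub xV xs(1)] that(3,4,1)] that ev_x by fastforce
  have evn: "even n" using ev n_def by simp
  have KI: "E (xs ! i) (xs ! j)" if "i \<in> I" "j \<in> I" "i \<noteq> j" for i j
    using that K(2) ipath_distinct[OF ip] unfolding I_def n_def clique_def
    by (auto simp: nth_eq_iff_index_eq)
  have Iadj: "i = Suc j \<or> j = Suc i" if "i \<in> I" "j \<in> I" "i \<noteq> j" for i j
    using KI[OF that] ipath_nth[OF ip, of i j] that by (auto simp: I_def n_def)
  have inV: "xs ! i \<in> V" if "i < n" for i using sub that n_def nth_mem by blast
  \<comment> \<open>Otherwise the end of the path would see both \<open>x\<close> and a vertex of
    \<open>K\<close>, and thus lie in \<open>K\<close>, from which \<open>x\<close> is detached. So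
    every gap next to an end has length at least two.\<close>
  have not1: "1 \<notin> I"
  proof
    assume "1 \<in> I"
    then have "xs ! 1 \<in> K" by (simp add: I_def)
    moreover have "E (xs ! 0) (xs ! 1)" using ipath_nth[OF ip, of 0 1] n4 xs(3) unfolding n_def by (cases "xs = []") simp_all
    moreover have "E (xs ! 0) x" using ends[of 0] n4 unfolding detach_def by (auto dest: sym)
    ultimately have "xs ! 0 \<in> K"
      using inV[of 0] n4 K(3) nx[of 1] by (intro two_neighbours_in_clique[of "xs ! 0" "xs ! 1" x]) simp_all
    then show False using endI n4 by (simp add: I_def)
  qed
  have not2: "n - 2 \<notin> I"
  proof
    assume "n - 2 \<in> I"
    then have "xs ! (n - 2) \<in> K" by (simp add: I_def)
    moreover have "E (xs ! (n - 1)) (xs ! (n - 2))"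
    proof -
      have "n - 1 < length xs" "n - 2 < length xs" "n - 1 = Suc (n - 2)" using n4 n_def by arith+
      then show ?thesis using ipath_nth[OF ip, of "n - 1" "n - 2"] by blast
    qed
    moreover have "E (xs ! (n - 1)) x" using ends[of "n - 1"] n4 unfolding detach_def by (auto dest: sym)
    ultimately have "xs ! (n - 1) \<in> K"
      using inV[of "n - 1"] n4 K(3) nx[of "n - 2"] by (intro two_neighbours_in_clique[of "xs ! (n - 1)" "xs ! (n - 2)" x]) simp_all
    then show False using endI n4 by (simp add: I_def)
  qed
  have "I \<noteq> {}"
  proof
    assume "I = {}"
    then show False using gaps[of 0 "n - 1"] ev_x n4 evn by auto
  qed
  then obtain i0 where i0: "i0 \<in> I" by blast
  have pos: "2 \<le> i" "i + 3 \<le> n" if "i \<in> I" for i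
  proof -
    have "i \<noteq> 0" "i \<noteq> 1" "i \<noteq> n - 1" "i \<noteq> n - 2"
      using that endI not1 not2 by metis+
    moreover have "i < n" using that by (simp add: I_def)
    ultimately show "2 \<le> i" "i + 3 \<le> n" by linarith+
  qed
  have "\<exists>j\<in>I. j \<noteq> i0"
  proof (rule ccontr)
    assume "\<not> ?thesis"
    then have I: "I = {i0}" using i0 by blast
    have "i0 = Suc 0 \<or> even (0 + i0)" using gaps[of 0 i0] ev_x I pos[OF i0] by auto
    moreover have "n - 1 = Suc i0 \<or> even (i0 + (n - 1))" using gaps[of i0 "n - 1"] ev_x I pos[OF i0] by auto
    ultimately show False using pos[OF i0] evn by presburger
  qed
  then obtain i where i: "i \<in> I" "Suc i \<in> I" using Iadj i0 by metis
  have I: "I = {i, Suc i}"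
  proof -
    have "l = i \<or> l = Suc i" if "l \<in> I" for l using Iadj[OF that i(1)] Iadj[OF that i(2)] by auto
    then show ?thesis using i by blast
  qed
  note p = pos[OF i(1)] pos[OF i(2)]
  define A where "A = tl (take i xs)"
  define B where "B = butlast (drop (i + 2) xs)"
  have xs_eq: "xs = xs ! 0 # A @ [xs ! i, xs ! Suc i] @ B @ [xs ! (n - 1)]"
  proof -
    have "xs = take i xs @ xs ! i # xs ! Suc i # drop (i + 2) xs"
      using p n_def by (simp add: Cons_nth_drop_Suc)
    moreover have "take i xs = xs ! 0 # A"
      using p n_def by (cases xs) (auto simp: A_def take_Cons split: nat.splits)
    moreover have "drop (i + 2) xs = B @ [xs ! (n - 1)]"
    proof -
      have "drop (i + 2) xs \<noteq> []" using p n_def by simp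
      moreover have "last (drop (i + 2) xs) = xs ! (n - 1)"
      proof -
        have "xs \<noteq> []" using p n_def by auto
        then have "last xs = xs ! (n - 1)" unfolding n_def by (rule last_conv_nth)
        then show ?thesis using p n_def by (simp add: last_drop)
      qed
      ultimately show ?thesis unfolding B_def by (metis append_butlast_last_id)
    qed
    ultimately show ?thesis by simp
  qed
  have inA: "\<exists>k. 0 < k \<and> k < i \<and> y = xs ! k" if y: "y \<in> set A" for y
  proof -
    obtain k where "k < length A" "y = A ! k" using y unfolding in_set_conv_nth by blast
    then show ?thesis using p n_def by (intro exI[of _ "Suc k"]) (auto simp: A_def nth_tl)
  qed
  have inB: "\<exists>k. Suc i < k \<and> k < n - 1 \<and> y = xs ! k" if y: "y \<in> set B" for y
  proof -
    obtain k where "k < length B" "y = B ! k" using y unfolding in_set_conv_nth by blast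
    then show ?thesis using p n_def by (intro exI[of _ "i + 2 + k"]) (auto simp: B_def nth_butlast)
  qed
  show False
  proof (rule no_two_even_holes_on_triangle[where p = "xs ! 0" and A = A and a = "xs ! i" and b = "xs ! Suc i"
        and B = B and q = "xs ! (n - 1)", OF xV])
    show "ipath E (xs ! 0 # A @ [xs ! i, xs ! Suc i] @ B @ [xs ! (n - 1)])" using ip xs_eq by simp
    show "set (xs ! 0 # A @ [xs ! i, xs ! Suc i] @ B @ [xs ! (n - 1)]) \<subseteq> V" using sub xs_eq by simp
    show "A \<noteq> []" "B \<noteq> []" using p n_def by (auto simp: A_def B_def simp flip: length_0_conv)
    show "E x (xs ! 0)" "E x (xs ! i)" "E x (xs ! Suc i)" "E x (xs ! (n - 1))"
      using ev_x[of 0] ev_x[of i] ev_x[of "Suc i"] ev_x[of "n - 1"] i p by (auto simp: events_def)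
    show "y \<noteq> x \<and> \<not> E x y" if y: "y \<in> set A \<union> set B" for y
    proof -
      have "\<exists>k. k < n \<and> k \<noteq> 0 \<and> Suc k \<noteq> n \<and> k \<notin> I \<and> y = xs ! k"
      proof (cases "y \<in> set A")
        case True
        then obtain k where "0 < k" "k < i" "y = xs ! k" using inA by blast
        then show ?thesis using p I by (intro exI[of _ k]) auto
      next
        case False
        then obtain k where "Suc i < k" "k < n - 1" "y = xs ! k" using inB y by blast
        then show ?thesis using p I by (intro exI[of _ k]) auto
      qed
      then obtain k where k: "k < n" "k \<noteq> 0" "Suc k \<noteq> n" "k \<notin> I" "y = xs ! k" by blast
      then show ?thesis using ev_x[of k] nx[of k] by (auto simp: events_def n_def)
    qed
  qed (rule conn)
qed

lemma odd_hole_free_detach: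
  assumes conn: "connected_on E {w \<in> V. w \<noteq> x \<and> \<not> E x w}"
  shows "odd_hole_free E' V"
  unfolding odd_hole_free_def
proof (intro ballI allI impI)
  fix w xs assume w: "w \<in> V" "set xs \<subseteq> V" "hole E' w xs"
  interpret D: adjacency E' by (rule adjacency_detach)
  consider "w = x" | "x \<in> set xs" | "w \<noteq> x" "x \<notin> set xs" by blast
  then show "odd (length xs)"
  proof cases
    case 1
    then show ?thesis using no_detached_odd_hole_at[OF conn] w by blast
  next
    case 2
    then obtain \<alpha> \<beta> where xs: "xs = \<alpha> @ x # \<beta>" by (meson split_list)
    then have "hole E' x (\<beta> @ w # \<alpha>)" using D.hole_rotate w(3) by blast
    then have "odd (length (\<beta> @ w # \<alpha>))" using w xs by (intro no_detached_odd_hole_at[OF conn]) auto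
    then show ?thesis by (simp add: xs add.commute)
  next
    case 3
    then have "E' a b \<longleftrightarrow> E a b" if "a \<in> insert w (set xs)" "b \<in> insert w (set xs)" for a b
      using that by (auto simp: detach_def)
    then have "hole E w xs" using w(3) unfolding hole_def ipath_def by auto
    then show ?thesis using ohf w unfolding odd_hole_free_def by blast
  qed
qed

text \<open>Exchange the colours \<open>c x\<close> and \<open>d\<close> on the component of \<open>x\<close>, where \<open>d\<close> is missing on \<open>K - {x}\<close>. The
  component avoids \<open>y\<close>, since otherwise a shortest path to \<open>y\<close> closes to an odd hole.\<close>

lemma colorable_of_detach:
  assumes col: "colorable E' V k" and bound: "clique_bound E V k" and fin: "finite V"
  shows "colorable E V k"
proof -
  interpret D: adjacency E' by (rule adjacency_detach)
  obtain c where c: "\<forall>v\<in>V. c v < k" "\<forall>u\<in>V. \<forall>v\<in>V. E' u v \<longrightarrow> c u \<noteq> c v"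
    using col unfolding colorable_def by blast
  have xV: "x \<in> V" using K by auto
  have finK: "finite K" using K fin finite_subset by auto
  have clq: "c a \<noteq> c b" if "a \<in> K" "b \<in> K" "a \<noteq> b" "a \<noteq> x" "b \<noteq> x" for a b
  proof -
    have "E' a b" using that K(2) unfolding clique_def by (simp add: detach_def)
    then show ?thesis using c(2) K(1) that by blast
  qed
  show ?thesis
  proof (cases "\<exists>y\<in>K. y \<noteq> x \<and> c y = c x")
    case False
    have "c u \<noteq> c v" if "u \<in> V" "v \<in> V" "E u v" for u v
    proof (cases "E' u v")
      case True
      then show ?thesis using c(2) that by blast
    next
      case F: False
      then have "u = x \<and> v \<in> K \<or> v = x \<and> u \<in> K" "u \<noteq> v" using that irrefl by (auto simp: detach_def)
      then show ?thesis using False by metis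
    qed
    then show ?thesis using c(1) unfolding colorable_def by blast
  next
    case True
    then obtain y where y: "y \<in> K" "y \<noteq> x" "c y = c x" by blast
    have yV: "y \<in> V" using y K by auto
    \<comment> \<open>\<open>K - {x}\<close> has fewer than \<open>k\<close> vertices, hence some
      colour \<open>d\<close> is missing on it.\<close>
    have "card (c ` (K - {x})) \<le> card (K - {x})" by (rule card_image_le) (use finK in auto)
    also have "\<dots> < card K" using K(3) finK by (meson card_Diff1_less)
    also have "\<dots> \<le> k" using bound K unfolding clique_bound_def by blast
    finally have "\<not> {..<k} \<subseteq> c ` (K - {x})"
      using finK by (metis card_lessThan card_mono finite_Diff finite_imageI not_le)
    then obtain d where d: "d < k" "d \<notin> c ` (K - {x})" by blast
    have dx: "d \<noteq> c x" using d(2) y by (metis DiffI imageI singletonD)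
    define S where "S = {v \<in> V. c v = c x \<or> c v = d}"
    define X where "X = {v \<in> S. \<exists>zs. link E' S {x} {v} zs}"
    have xX: "x \<in> X"
    proof -
      have "link E' S {x} {x} [x]" using xV by (simp add: link_def S_def)
      then show ?thesis using xV by (auto simp: X_def S_def)
    qed
    have closed: "v \<in> X" if "u \<in> X" "v \<in> S" "E' u v" for u v
    proof -
      obtain zs where "link E' S {x} {u} zs" using \<open>u \<in> X\<close> by (auto simp: X_def)
      then have "link E' S {x} {v} (zs @ [v])" using that by (auto simp: link_def successively_append_iff)
      then show ?thesis using that by (auto simp: X_def)
    qed
    have "y \<notin> X"
    proof
      assume "y \<in> X"
      then obtain zs where "link E' S {x} {y} zs" by (auto simp: X_def)
      then obtain ys where sl: "shortest_link E' S {x} {y} ys" using shortest_link_exists by blast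
      have ys: "ys \<noteq> []" "set ys \<subseteq> S" "hd ys = x" "last ys = y"
        using shortest_linkD[OF sl] by (auto simp: link_def)
      have ip: "ipath E' ys" by (rule D.shortest_link_ipath[OF sl])
      define n where "n = length ys"
      have n: "n > 0" using ys n_def by simp
      have ends: "ys ! 0 = x" "ys ! (n - 1) = y" using ys n_def by (auto simp: hd_conv_nth last_conv_nth)
      have inV: "ys ! i \<in> V" "c (ys ! i) = c x \<or> c (ys ! i) = d" if "i < n" for i
        using ys(2) that n_def by (auto simp: S_def dest: nth_mem)
      \<comment> \<open>The two colours alternate, and both ends have the colour of
        \<open>x\<close>; therefore the path has an odd number of vertices.\<close>
      have alt: "c (ys ! i) = (if even i then c x else d)" if "i < n" for i
        using that
      proof (induction i)
        case 0
        then show ?case using ends by simp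
      next
        case (Suc i)
        have "E' (ys ! i) (ys ! Suc i)" using ipath_nth[OF ip, of i "Suc i"] Suc n_def by simp
        then have "c (ys ! i) \<noteq> c (ys ! Suc i)" using c(2) inV Suc by auto
        then show ?case using Suc inV(2)[of "Suc i"] by (auto split: if_splits)
      qed
      have "even (n - 1)" using alt[of "n - 1"] ends y dx n by (auto split: if_splits)
      moreover have "n \<noteq> 1" using ends y by auto
      ultimately have n3: "n \<ge> 3" "odd n" using n by presburger+
      have Kys: "ys ! i = x \<or> ys ! i = y" if "i < n" "ys ! i \<in> K" for i
      proof (rule ccontr)
        assume *: "\<not> ?thesis"
        then have "c (ys ! i) \<noteq> d" using d that by auto
        then have "c (ys ! i) = c y" using inV(2)[OF that(1)] y by auto
        then show False using clq[of "ys ! i" y] * that y by auto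
      qed
      have d_ys: "distinct ys" using ipath_distinct[OF ip] .
      have idx: "ys ! i = x \<longleftrightarrow> i = 0" "ys ! i = y \<longleftrightarrow> i = n - 1" if "i < n" for i
        using that ends d_ys n n_def nth_eq_iff_index_eq[OF d_ys, of i 0] nth_eq_iff_index_eq[OF d_ys, of i "n - 1"]
        by auto
      define zs where "zs = tl ys"
      have zs: "length zs = n - 1" "\<And>i. i < n - 1 \<Longrightarrow> zs ! i = ys ! Suc i"
        using n_def by (auto simp: zs_def nth_tl)
      have ys_eq: "ys = x # zs" using ys by (cases ys) (auto simp: zs_def)
      have xzs: "x \<notin> set zs" using d_ys ys_eq by simp
      have ipz: "ipath E' zs" using ipath_drop[OF ip, of 1] ys_eq by simp
      have nth_x: "zs ! i \<noteq> x" if "i < n - 1" for i using xzs zs(1) that by (metis nth_mem)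
      have ipE: "ipath E zs" using ipz nth_x zs(1) unfolding ipath_def by (auto simp: detach_def)
      \<comment> \<open>In the original graph \<open>x\<close> regains just the edge to
        \<open>y\<close>, because the path meets \<open>K\<close> only in its ends; this edge closes
        the path.\<close>
      have xz: "E x (zs ! i) \<longleftrightarrow> i = 0 \<or> Suc i = n - 1" if i: "i < n - 1" for i
      proof -
        have "E' x (zs ! i) \<longleftrightarrow> i = 0" using ipath_nth[OF ip, of 0 "Suc i"] i ends zs(2)[OF i] n_def ys(1) by auto
        moreover have "zs ! i \<in> K \<longleftrightarrow> Suc i = n - 1"
          using Kys[of "Suc i"] idx[of "Suc i"] i zs(2)[OF i] y by auto
        moreover have "E x z" if "z \<in> K" "z \<noteq> x" for z using K that unfolding clique_def by auto
        ultimately show ?thesis using nth_x[OF i] by (auto simp: detach_def)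
      qed
      \<comment> \<open>For three vertices the cycle is a triangle rather than a hole. Its middle
        vertex would see \<open>x\<close> and \<open>y\<close> and so lie in \<open>K\<close>,
        although \<open>K\<close> meets the path only in the ends.\<close>
      have "n \<noteq> 3"
      proof
        assume n: "n = 3"
        have zz: "zs ! 0 \<in> V" "zs ! 1 = y"
          using inV(1)[of 1] ends zs(2)[of 0] zs(2)[of 1] n by (simp_all add: numeral_2_eq_2)
        have "E (zs ! 0) x" "E (zs ! 0) (zs ! 1)"
          using xz[of 0] n ipath_nth[OF ipE, of 0 1] zs by (auto simp: commute)
        then have "zs ! 0 \<in> K" using zz y K by (intro two_neighbours_in_clique[of "zs ! 0" x y]) auto
        then have "zs ! 0 = y" using Kys[of 1] zs n nth_x[of 0] by auto
        then show False using idx(2)[of 1] zs n by auto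
      qed
      then have "n \<ge> 5" using n3 by presburger
      have "odd (length zs)"
      proof (rule odd_hole_freeD[OF ohf xV _ xzs ipE])
        show "set zs \<subseteq> V" using ys(2) ys_eq by (auto simp: S_def)
        show "3 \<le> length zs" using \<open>n \<ge> 5\<close> zs by simp
      qed (use xz zs in auto)
      then show False using n3 zs by simp
    qed
    have XS: "X \<subseteq> S" by (auto simp: X_def)
    \<comment> \<open>Colours are distinct on \<open>K - {x}\<close> and omit \<open>d\<close>, so
      \<open>y\<close> is the only other candidate, and \<open>y\<close> is outside the component.
      After the exchange \<open>x\<close> is therefore the only vertex of \<open>K\<close> with
      colour \<open>d\<close>.\<close>
    have KX: "z = x" if "z \<in> K" "z \<in> X" for z
    proof (rule ccontr)
      assume "z \<noteq> x"
      then have "c z \<noteq> d" using d that by auto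
      then have "c z = c y" using XS that y by (auto simp: S_def)
      then show False using clq[of z y] that y \<open>z \<noteq> x\<close> \<open>y \<notin> X\<close> by auto
    qed
    let ?c = "\<lambda>v. if v \<in> X then (if c v = d then c x else d) else c v"
    have cX: "c v = c x \<or> c v = d" if "v \<in> X" for v using XS that by (auto simp: S_def)
    have range: "?c v < k" if "v \<in> V" for v using c(1) that d xV by auto
    have proper': "?c u \<noteq> ?c v" if uv: "u \<in> V" "v \<in> V" "E' u v" for u v
    proof -
      have ne: "c u \<noteq> c v" using c(2) uv by blast
      have cl: "u \<in> X \<longleftrightarrow> v \<in> X" if "u \<in> S" "v \<in> S"
        using closed[of u v] closed[of v u] uv that D.sym by blast
      show ?thesis
      proof (cases "u \<in> X"; cases "v \<in> X")
        assume *: "u \<in> X" "v \<notin> X"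
        then have "v \<notin> S" using cl XS by blast
        then show ?thesis using * uv by (auto simp: S_def)
      next
        assume *: "u \<notin> X" "v \<in> X"
        then have "u \<notin> S" using cl XS by blast
        then show ?thesis using * uv by (auto simp: S_def)
      qed (use ne cX[of u] cX[of v] dx in auto)
    qed
    have "?c u \<noteq> ?c v" if uv: "u \<in> V" "v \<in> V" "E u v" for u v
    proof (cases "E' u v")
      case True
      then show ?thesis using proper' uv by blast
    next
      case False
      have x': "?c x = d" using xX dx by simp
      have K': "?c z \<noteq> d" if "z \<in> K" "z \<noteq> x" for z
        using KX[of z] that d by auto
      have "u = x \<and> v \<in> K \<or> v = x \<and> u \<in> K" "u \<noteq> v" using False uv irrefl by (auto simp: detach_def)
      then show ?thesis using x' K' by metis
    qed
    then show ?thesis using range unfolding colorable_def by (intro exI[of _ ?c]) blast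
  qed
qed

end

text \<open>Otherwise the closed neighbourhood of \<open>x\<close> is a star cutset centred at
  \<open>x\<close>, separating \<open>X\<close> from the remaining non-neighbours.\<close>

lemma (in adjacency) star_cutset_connected_on:
  assumes nc: "\<not> colorable E V k" and bound: "clique_bound E V k"
    and IH: "\<And>U j. U \<subset> V \<Longrightarrow> clique_bound E U j \<Longrightarrow> colorable E U j" and "x \<in> V"
  shows "connected_on E {w \<in> V. w \<noteq> x \<and> \<not> E x w}"
  unfolding connected_on_def
proof (intro allI impI)
  let ?W = "{w \<in> V. w \<noteq> x \<and> \<not> E x w}"
  fix X assume X: "X \<subseteq> ?W" "X \<noteq> {}" "\<forall>y\<in>X. \<forall>z\<in>?W. E y z \<longrightarrow> z \<in> X"
  show "X = ?W"
  proof (rule ccontr)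
    assume "X \<noteq> ?W"
    then have ne: "?W - X \<noteq> {}" using X by auto
    have "colorable E V k"
    proof (rule star_cutset_colorable[OF bound IH, of "{w \<in> V. w = x \<or> E x w}" X "?W - X" x])
      show "V = {w \<in> V. w = x \<or> E x w} \<union> X \<union> (?W - X)" using X(1) by auto
      show "\<not> E u v" if "u \<in> X" "v \<in> ?W - X" for u v using X(3) that by blast
    qed (use X ne \<open>x \<in> V\<close> in auto)
    then show False using nc by blast
  qed
qed

lemma diamond_free_subset: "diamond_free E V \<Longrightarrow> U \<subseteq> V \<Longrightarrow> diamond_free E U"
  unfolding diamond_free_def by blast

lemma odd_hole_free_subset: "odd_hole_free E V \<Longrightarrow> U \<subseteq> V \<Longrightarrow> odd_hole_free E U"
  unfolding odd_hole_free_def by (meson subset_trans subsetD)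

text \<open>Detaching keeps the vertex set, so the measure also counts adjacent pairs, and the
  induction varies the relation. The clique is chosen to contain an edge at \<open>x\<close>, which
  makes the measure drop.\<close>

theorem diamond_free_odd_hole_free_colorable:
  assumes "adjacency E" "finite V" "diamond_free E V" "odd_hole_free E V" "clique_bound E V k"
  shows "colorable E V k"
  using assms
proof (induction "card V + card {(a, b). a \<in> V \<and> b \<in> V \<and> E a b}" arbitrary: E V k rule: less_induct)
  case less
  note adj = less.prems(1) and fin = less.prems(2) and df = less.prems(3) and oh = less.prems(4)
    and bound = less.prems(5)
  interpret odd_hole_free_graph E V
    using adj df oh by (simp add: odd_hole_free_graph_def odd_hole_free_graph_axioms_def)
  let ?edges = "\<lambda>E V. {(a, b). a \<in> V \<and> b \<in> V \<and> E a b}"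
  have finE: "finite (?edges F U)" if "finite U" for F :: "'a \<Rightarrow> 'a \<Rightarrow> bool" and U
    using that by (rule_tac finite_subset[of _ "U \<times> U"]) auto
  have sub: "colorable E U j" if "U \<subset> V" "clique_bound E U j" for U j
  proof (rule less.hyps)
    have "card U < card V" using that fin psubset_card_mono by blast
    moreover have "card (?edges E U) \<le> card (?edges E V)"
      using that finE[OF fin] by (intro card_mono) auto
    ultimately show "card U + card (?edges E U) < card V + card (?edges E V)" by simp
    show "finite U" using that fin finite_subset by blast
    show "diamond_free E U" "odd_hole_free E U"
      using that df oh diamond_free_subset odd_hole_free_subset by blast+
  qed (use adj that in auto)
  show ?case
  proof (rule ccontr)
    assume nc: "\<not> colorable E V k"
    have "\<exists>x\<in>V. \<exists>y\<in>V. E x y"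
    proof (rule ccontr)
      assume none: "\<not> ?thesis"
      have "0 < k" if "v \<in> V" for v
      proof -
        have "clique E {v}" by (auto simp: clique_def)
        then have "card {v} \<le> k" using bound that unfolding clique_bound_def by blast
        then show ?thesis by simp
      qed
      then have "colorable E V k" using none unfolding colorable_def by (intro exI[of _ "\<lambda>_. 0"]) auto
      then show False using nc by blast
    qed
    then obtain x y where xy: "x \<in> V" "y \<in> V" "E x y" by blast
    define Ks where "Ks = {K. K \<subseteq> V \<and> clique E K \<and> {x, y} \<subseteq> K}"
    have "{x, y} \<in> Ks" using xy by (auto simp: Ks_def clique_def commute)
    moreover have "finite Ks" using fin by (auto simp: Ks_def)
    ultimately obtain K where Kmax: "K \<in> Ks" "\<forall>L\<in>Ks. K \<subseteq> L \<longrightarrow> K = L"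
      using finite_has_maximal[of Ks] by blast
    interpret maximal_clique_graph E V K x
    proof unfold_locales
      show "K \<subseteq> V" "clique E K" "x \<in> K" using Kmax by (auto simp: Ks_def)
      fix z assume z: "z \<in> V" "\<And>w. w \<in> K \<Longrightarrow> w \<noteq> z \<Longrightarrow> E z w"
      have "insert z K \<in> Ks" using Kmax z by (auto simp: Ks_def clique_def commute)
      then have "K = insert z K" using Kmax(2) by (metis subset_insertI)
      then show "z \<in> K" by blast
    qed
    have conn: "connected_on E {w \<in> V. w \<noteq> x \<and> \<not> E x w}"
      using star_cutset_connected_on[OF nc bound sub xy(1)] .
    have "colorable (detach E x K) V k"
    proof (rule less.hyps)
      have yK: "y \<in> K" using Kmax by (auto simp: Ks_def)
      have "?edges (detach E x K) V \<subset> ?edges E V"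
      proof
        show "?edges (detach E x K) V \<subseteq> ?edges E V" by (auto simp: detach_def)
        have "(x, y) \<in> ?edges E V" "(x, y) \<notin> ?edges (detach E x K) V" using xy yK by (auto simp: detach_def)
        then show "?edges (detach E x K) V \<noteq> ?edges E V" by blast
      qed
      then show "card V + card (?edges (detach E x K) V) < card V + card (?edges E V)"
        using psubset_card_mono[OF finE[OF fin]] by simp
      show "clique_bound (detach E x K) V k"
        using bound unfolding clique_bound_def clique_def detach_def by blast
    qed (use adjacency_detach fin diamond_free_detach odd_hole_free_detach[OF conn] in auto)
    then show False using colorable_of_detach bound fin nc by blast
  qed
qed

section \<open>Reduction to diamond-free graphs\<close>

text \<open>\<open>b d\<close> is the central edge and \<open>a\<close>, \<open>c\<close> are the
  tips of the diamond. This is the only form in which the kite and the paraglider enter the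
  proof.\<close>

definition diamond_tips_dominated :: "('a \<Rightarrow> 'a \<Rightarrow> bool) \<Rightarrow> 'a set \<Rightarrow> bool" where
  "diamond_tips_dominated E V \<longleftrightarrow> (\<forall>a\<in>V. \<forall>c\<in>V. \<forall>b\<in>V. \<forall>d\<in>V. \<forall>y\<in>V.
     E b d \<longrightarrow> E a b \<longrightarrow> E a d \<longrightarrow> E c b \<longrightarrow> E c d \<longrightarrow> a \<noteq> c \<longrightarrow> \<not> E a c \<longrightarrow> E y a \<longrightarrow> E y b \<or> E y d)"

lemma diamond_tips_dominatedD:
  assumes "diamond_tips_dominated E V" "{a, c, b, d, y} \<subseteq> V"
    "E b d" "E a b" "E a d" "E c b" "E c d" "a \<noteq> c" "\<not> E a c" "E y a"
  shows "E y b \<or> E y d"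
  using assms unfolding diamond_tips_dominated_def by blast

lemma diamond_tips_dominated_subset:
  "diamond_tips_dominated E V \<Longrightarrow> U \<subseteq> V \<Longrightarrow> diamond_tips_dominated E U"
  unfolding diamond_tips_dominated_def by (meson subsetD)

context adjacency
begin

text \<open>The vertex \<open>u\<close> takes the colour of \<open>v\<close>; they are not adjacent,
  since \<open>dom\<close> at \<open>y = v\<close> would produce a loop.\<close>

lemma dominated_nonadjacent_colorable:
  assumes col: "colorable E (V - {u}) k" and uv: "u \<in> V" "v \<in> V" "u \<noteq> v"
    and dom: "\<And>y. y \<in> V \<Longrightarrow> E u y \<Longrightarrow> E v y"
  shows "colorable E V k"
proof -
  obtain c where c: "\<forall>w\<in>V - {u}. c w < k" "\<forall>w\<in>V - {u}. \<forall>z\<in>V - {u}. E w z \<longrightarrow> c w \<noteq> c z"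
    using col unfolding colorable_def by blast
  let ?c = "c(u := c v)"
  have "?c w < k" if "w \<in> V" for w using c(1) that uv by auto
  moreover have "?c w \<noteq> ?c z" if "w \<in> V" "z \<in> V" "E w z" for w z
    using c(2) dom[of z] dom[of w] that uv irrefl sym[of w z] sym[of v w] by (auto split: if_splits)
  ultimately show ?thesis unfolding colorable_def by (intro exI[of _ ?c]) blast
qed

lemma universal_vertex_colorable:
  assumes bound: "clique_bound E V k" and fin: "finite V"
    and IH: "\<And>U j. U \<subset> V \<Longrightarrow> clique_bound E U j \<Longrightarrow> colorable E U j"
    and v: "v \<in> V" "\<And>y. y \<in> V \<Longrightarrow> y \<noteq> v \<Longrightarrow> E v y"
  shows "colorable E V k"
proof -
  have "clique E {v}" by (simp add: clique_def)
  then have "card {v} \<le> k" using bound v unfolding clique_bound_def by blast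
  then have k: "0 < k" by simp
  have "clique_bound E (V - {v}) (k - 1)"
    unfolding clique_bound_def
  proof (intro allI impI)
    fix K assume K: "K \<subseteq> V - {v}" "clique E K"
    have "clique E (insert v K)"
      unfolding clique_def
    proof (intro ballI impI)
      fix a b assume "a \<in> insert v K" "b \<in> insert v K" "a \<noteq> b"
      then show "E a b" using K v(2) unfolding clique_def by (metis DiffD1 DiffD2 insert_iff subsetD sym)
    qed
    then have "card (insert v K) \<le> k" using bound K v unfolding clique_bound_def by blast
    moreover have "finite K" "v \<notin> K" using K fin finite_subset by auto
    ultimately show "card K \<le> k - 1" by simp
  qed
  then have "colorable E (V - {v}) (k - 1)" using v by (intro IH) auto
  then obtain c where c: "\<forall>w\<in>V - {v}. c w < k - 1" "\<forall>w\<in>V - {v}. \<forall>z\<in>V - {v}. E w z \<longrightarrow> c w \<noteq> c z"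
    unfolding colorable_def by blast
  let ?c = "c(v := k - 1)"
  have "?c w < k" if "w \<in> V" for w using bspec[OF c(1), of w] that k by (cases "w = v") simp_all
  moreover have "?c w \<noteq> ?c z" if "w \<in> V" "z \<in> V" "E w z" for w z
    using c(2) bspec[OF c(1), of w] bspec[OF c(1), of z] that irrefl
    by (cases "w = v"; cases "z = v") auto
  ultimately show ?thesis unfolding colorable_def by (intro exI[of _ ?c]) blast
qed

text \<open>For adjacent vertices of the neighbourhood \<open>N\<close> of \<open>e\<close>, the
  absence of dominated vertices makes the parts of their neighbourhoods inside and outside
  \<open>N\<close> compete: where the inner parts \<open>n\<close> differ, the outer parts
  \<open>w\<close> agree. So \<open>w\<close> is constant on the component of \<open>N\<close>
  containing the diamond, and an edge inside this constant set breaks the rule for diamonds.\<close>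

lemma diamond_colorable:
  assumes kp: "diamond_tips_dominated E V" and fin: "finite V" and bound: "clique_bound E V k"
    and IH: "\<And>U j. U \<subset> V \<Longrightarrow> clique_bound E U j \<Longrightarrow> colorable E U j"
    and V: "{a, c, b, e} \<subseteq> V" and dia: "E b e" "E a b" "E a e" "E c b" "E c e" "a \<noteq> c" "\<not> E a c"
  shows "colorable E V k"
proof (rule ccontr)
  assume nc: "\<not> colorable E V k"
  have no_dom: "\<exists>y\<in>V. E u y \<and> \<not> E v y" if "u \<in> V" "v \<in> V" "u \<noteq> v" for u v
  proof (rule ccontr)
    assume "\<not> ?thesis"
    moreover have "colorable E (V - {u}) k"
      using that by (intro IH clique_bound_mono[OF bound]) auto
    ultimately show False using nc dominated_nonadjacent_colorable[of V u k v] that by blast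
  qed
  \<comment> \<open>If \<open>v\<close> dominated \<open>u\<close>, then \<open>v\<close> with its
    neighbours other than \<open>u\<close> would be a star cutset cutting \<open>u\<close> off from
    the non-neighbours of \<open>v\<close>; these exist because \<open>v\<close> is not
    universal.\<close>
  have no_dom_adj: "\<exists>y\<in>V. E u y \<and> y \<noteq> v \<and> \<not> E v y" if uv: "u \<in> V" "v \<in> V" "E u v" for u v
  proof (rule ccontr)
    assume no: "\<not> ?thesis"
    let ?W = "{w \<in> V. w \<noteq> v \<and> \<not> E v w}"
    have "?W \<noteq> {}"
      using nc universal_vertex_colorable[OF bound fin IH uv(2)] by blast
    have "colorable E V k"
    proof (rule star_cutset_colorable[OF bound IH, of "{w \<in> V. w \<noteq> u \<and> (w = v \<or> E v w)}" "{u}" ?W v])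
      show "V = {w \<in> V. w \<noteq> u \<and> (w = v \<or> E v w)} \<union> {u} \<union> ?W" using uv by auto
      show "\<not> E p q" if "p \<in> {u}" "q \<in> ?W" for p q using no that by blast
      show "{u} \<inter> ?W = {}" using uv(3) sym by blast
      show "v \<in> {w \<in> V. w \<noteq> u \<and> (w = v \<or> E v w)}" using uv irrefl by auto
    qed (use \<open>?W \<noteq> {}\<close> in auto)
    then show False using nc by blast
  qed
  have dom: "E y p \<or> E y q"
    if "E p q" "E r p" "E r q" "E s p" "E s q" "r \<noteq> s" "\<not> E r s" "E y r" "{r, s, p, q, y} \<subseteq> V" for p q r s y
    using diamond_tips_dominatedD[OF kp that(9) that(1-8)] .
  define N where "N = {z \<in> V. E e z}"
  define n where "n u = {z \<in> N. z = u \<or> E u z}" for u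
  define w where "w u = {z \<in> V. z \<noteq> e \<and> \<not> E e z \<and> E u z}" for u
  have eV: "e \<in> V" using V by simp
  \<comment> \<open>A vertex \<open>z\<close> of \<open>n u\<close> outside \<open>n v\<close> gives
    a diamond with central edge \<open>u e\<close> and tips \<open>v\<close>, \<open>z\<close>; an
    outer neighbour of \<open>v\<close> must then see \<open>u\<close>.\<close>
  have H1: "w v \<subseteq> w u" if uv: "u \<in> N" "v \<in> N" "E u v" "\<not> n u \<subseteq> n v" for u v
  proof
    fix y assume y: "y \<in> w v"
    obtain z where z: "z \<in> N" "E u z" "\<not> E v z" "z \<noteq> v"
      using uv sym by (auto simp: n_def)
    have "E y u \<or> E y e"
      by (rule dom[of u e v z y]) (use uv z y eV in \<open>auto simp: N_def w_def intro: sym\<close>)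
    then show "y \<in> w u" using y by (auto simp: w_def intro: sym)
  qed
  have H2: "\<not> (n u \<subseteq> n v \<and> w u \<subseteq> w v)" if uv: "u \<in> N" "v \<in> N" "E u v" for u v
  proof
    assume sub: "n u \<subseteq> n v \<and> w u \<subseteq> w v"
    obtain y where y: "y \<in> V" "E u y" "y \<noteq> v" "\<not> E v y"
      using no_dom_adj[of u v] uv by (auto simp: N_def)
    have "y \<noteq> e" using y uv sym by (auto simp: N_def)
    then have "y \<in> n u \<or> y \<in> w u" using y by (auto simp: n_def w_def N_def)
    then show False using sub y by (auto simp: n_def w_def)
  qed
  have H3: "w u = w v" if "u \<in> N" "v \<in> N" "E u v" "n u \<noteq> n v" for u v
    using H1[of u v] H1[of v u] H2[of u v] H2[of v u] that sym[of u v] by blast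
  \<comment> \<open>If \<open>n t\<close> differed, \<open>H3\<close> would make both
    \<open>w u\<close> and \<open>w v\<close> equal to \<open>w t\<close>, so that \<open>v\<close>
    dominates \<open>u\<close>, against \<open>H2\<close>.\<close>
  have twins: "n t = n u" if uv: "u \<in> N" "v \<in> N" "E u v" "n u = n v" and t: "t \<in> N" "E u t" for u v t
  proof (rule ccontr)
    assume ne: "n t \<noteq> n u"
    have "t \<in> n v" using uv t by (auto simp: n_def)
    then have "E v t" using ne uv by (auto simp: n_def)
    then have "w u = w v" using H3[of u t] H3[of v t] uv t ne by auto
    then show False using H2[OF uv(1-3)] uv by blast
  qed
  define R where "R = {(p, q). p \<in> N \<and> q \<in> N \<and> E p q}"
  have "sym_on UNIV R" unfolding R_def sym_on_def using sym by blast
  then have symR: "(q, p) \<in> R\<^sup>*" if "(p, q) \<in> R\<^sup>*" for p q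
    using that by (metis sym_rtrancl symD)
  have nbr: "a \<in> N" "c \<in> N" "b \<in> N" using V dia sym by (auto simp: N_def)
  have nab: "n a \<noteq> n b"
  proof
    assume "n a = n b"
    moreover have "c \<in> n b" using nbr dia sym by (auto simp: n_def)
    ultimately show False using dia by (auto simp: n_def)
  qed
  \<comment> \<open>Twins would force \<open>n\<close> to be constant on the whole component, but
    \<open>n a\<close> and \<open>n b\<close> are different because only the latter contains
    \<open>c\<close>.\<close>
  have no_twins: "n u \<noteq> n v" if bu: "(b, u) \<in> R\<^sup>*" and uv: "u \<in> N" "v \<in> N" "E u v" for u v
  proof
    assume eq: "n u = n v"
    have "n z = n u" if "(u, z) \<in> R\<^sup>*" for z
      using that
    proof (induction rule: rtrancl_induct)
      case (step y z)
      then have yz: "y \<in> N" "z \<in> N" "E y z" by (auto simp: R_def)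
      show ?case
      proof (cases "y = u")
        case True
        then show ?thesis using twins[OF uv eq, of z] yz by simp
      next
        case False
        have "y \<in> n u" using step.IH yz by (auto simp: n_def)
        then have "E y u" using False by (auto simp: n_def intro: sym)
        then show ?thesis using twins[of y u z] step.IH yz uv by auto
      qed
    qed simp
    moreover have "(u, b) \<in> R\<^sup>*" using symR[OF bu] .
    moreover from this have "(u, a) \<in> R\<^sup>*"
      by (rule rtrancl_into_rtrancl) (use nbr sym[OF dia(2)] in \<open>simp add: R_def\<close>)
    ultimately have "n b = n u" "n a = n u" by blast+
    then show False using nab by simp
  qed
  have w_const: "w z = w b" if "(b, z) \<in> R\<^sup>*" for z
    using that
  proof (induction rule: rtrancl_induct)
    case (step y z)
    then have "y \<in> N" "z \<in> N" "E y z" by (auto simp: R_def)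
    then show ?case using H3[of y z] no_twins[of y z] step by auto
  qed simp
  have wac: "w a = w b" "w c = w b"
    using w_const[of a] w_const[of c] nbr dia sym by (auto simp: R_def intro!: r_into_rtrancl)
  \<comment> \<open>Non-domination of \<open>b\<close> by \<open>e\<close> and of \<open>y\<close>
    by \<open>e\<close> gives an edge \<open>y t\<close> away from \<open>e\<close>. The diamond
    over \<open>a b\<close> with tips \<open>y\<close> and \<open>e\<close> puts \<open>t\<close>
    into the common outer neighbourhood as well.\<close>
  obtain y where y: "y \<in> V" "E b y" "y \<noteq> e" "\<not> E e y"
    using no_dom_adj[of b e] V dia by blast
  then have yw: "y \<in> w b" by (simp add: w_def)
  obtain t where t: "t \<in> V" "E y t" "\<not> E e t"
    using no_dom[of y e] y eV by blast
  have "E t a \<or> E t b"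
    by (rule dom[of a b y e t]) (use yw wac y t V dia in \<open>auto simp: w_def intro: sym\<close>)
  moreover have "t \<noteq> e" using t y sym by blast
  ultimately have "t \<in> w a \<or> t \<in> w b" using t by (auto simp: w_def intro: sym)
  then have tw: "t \<in> w b" using wac by simp
  \<comment> \<open>The edge \<open>y t\<close> is now central in a diamond with tips
    \<open>a\<close> and \<open>c\<close>, while \<open>e\<close> sees \<open>a\<close> but neither
    \<open>y\<close> nor \<open>t\<close>.\<close>
  have "E e y \<or> E e t"
    by (rule dom[of y t a c e]) (use yw tw wac[symmetric] t y V dia in \<open>auto simp: w_def set_eq_iff intro: sym\<close>)
  then show False using t y by blast
qed

end

theorem diamond_tips_dominated_odd_hole_free_colorable:
  assumes "adjacency E" "finite V" "diamond_tips_dominated E V" "odd_hole_free E V" "clique_bound E V k"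
  shows "colorable E V k"
  using assms(2-5)
proof (induction V arbitrary: k rule: finite_psubset_induct)
  case (psubset V)
  interpret adjacency E by (rule assms(1))
  have IH: "colorable E U j" if "U \<subset> V" "clique_bound E U j" for U j
    using psubset that diamond_tips_dominated_subset odd_hole_free_subset by (meson psubset_imp_subset)
  show ?case
  proof (cases "diamond_free E V")
    case True
    then show ?thesis using diamond_free_odd_hole_free_colorable assms(1) psubset by blast
  next
    case False
    then obtain a c b e where "{a, c, b, e} \<subseteq> V" "E b e" "E a b" "E a e" "E c b" "E c e" "a \<noteq> c" "\<not> E a c"
      unfolding diamond_free_def by blast
    then show ?thesis using diamond_colorable[OF psubset.prems(1) psubset.hyps(1) psubset.prems(3) IH] by blast
  qed
qed

section \<open>Imperfect graphs of the class contain a seven-cycle\<close>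

context simple_graph
begin

lemma adjacency_adj: "adjacency (adj G)"
proof
  show "adj G b a" if "adj G a b" for a b using that by (simp add: adj_def insert_commute)
  show "\<not> adj G a a" for a using edges_subset by (fastforce simp: adj_def doubleton_eq_iff)
qed

lemma adj_vertices: "adj G u v \<Longrightarrow> u \<in> vertices G \<and> v \<in> vertices G"
  using edges_subset by (fastforce simp: adj_def doubleton_eq_iff)

lemma adj_induced_subgraph: "u \<in> S \<Longrightarrow> v \<in> S \<Longrightarrow> adj (induced_subgraph G S) u v \<longleftrightarrow> adj G u v"
  by (simp add: adj_def induced_subgraph_def)

text \<open>The isomorphism sends each vertex to its position in \<open>xs\<close>, so a forbidden
  graph on an initial segment of the naturals is exhibited by listing its vertices in order.\<close>

lemma graph_free_pattern:
  fixes H :: "nat ugraph"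
  assumes free: "graph_free G \<H>" "H \<in> \<H>" and H: "vertices H = {..<length xs}"
    and xs: "distinct xs" "set xs \<subseteq> vertices G"
    and match: "\<And>i j. i < length xs \<Longrightarrow> j < length xs \<Longrightarrow> adj G (xs ! i) (xs ! j) \<longleftrightarrow> adj H i j"
  shows False
proof -
  have bij: "bij_betw ((!) xs) {..<length xs} (set xs)"
    using xs(1) by (simp add: bij_betw_nth)
  define f where "f = the_inv_into {..<length xs} ((!) xs)"
  have "bij_betw f (set xs) {..<length xs}"
    unfolding f_def using bij by (rule bij_betw_the_inv_into)
  moreover have "adj (induced_subgraph G (set xs)) u v \<longleftrightarrow> adj H (f u) (f v)" if uv: "u \<in> set xs" "v \<in> set xs" for u v
  proof -
    obtain i j where ij: "i < length xs" "u = xs ! i" "j < length xs" "v = xs ! j"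
      using uv by (auto simp: in_set_conv_nth)
    then have "f u = i" "f v = j"
      unfolding f_def using bij by (auto simp: bij_betw_def intro!: the_inv_into_f_f)
    then show ?thesis using adj_induced_subgraph[OF uv] match ij by simp
  qed
  moreover have "vertices (induced_subgraph G (set xs)) = set xs"
    using xs by (auto simp: induced_subgraph_def)
  ultimately have "graph_iso (induced_subgraph G (set xs)) H"
    unfolding graph_iso_def H by (intro exI[of _ f]) auto
  then show False using free xs unfolding graph_free_def by blast
qed

end

lemma vertices_patterns:
  "vertices (path_graph t) = {..<t}" "vertices (cycle_graph t) = {..<t}"
  "vertices kite = {..<5}" "vertices paraglider = {..<5}"
  by (auto simp: path_graph_def cycle_graph_def kite_def paraglider_def add_vertex_def)

lemma adj_path_graph: "adj (path_graph t) i j \<longleftrightarrow> i < t \<and> j < t \<and> (i = Suc j \<or> j = Suc i)"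
  by (auto simp: adj_def path_graph_def doubleton_eq_iff)

lemma edges_cycle_graph_5: "edges (cycle_graph 5) = {{0, 1}, {1, 2}, {2, 3}, {3, 4}, {4, 0}}"
proof -
  have "edges (cycle_graph 5) = (\<lambda>i. {i, Suc i mod 5}) ` {i. i < 5}"
    unfolding cycle_graph_def by auto
  also have "{i. i < 5} = {0, 1, 2, 3, 4::nat}" by auto
  finally show ?thesis by (simp, simp add: numeral_2_eq_2)
qed

lemma edges_kite: "edges kite = {{0, 1}, {1, 2}, {2, 3}, {4, 0}, {4, 1}, {4, 2}}"
proof -
  have "edges (path_graph 4) = (\<lambda>i. {i, Suc i}) ` {i. Suc i < 4}"
    unfolding path_graph_def by auto
  also have "{i. Suc i < 4} = {0, 1, 2}" by auto
  finally have "edges (path_graph 4) = {{0, 1}, {1, 2}, {2, 3}}" by (simp, simp add: numeral_2_eq_2)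
  moreover have "{{4, y} |y. y \<in> {0, 1, 2}} = {{4, 0}, {4, 1}, {4, 2 :: nat}}" by auto
  ultimately show ?thesis unfolding kite_def add_vertex_def by (simp only: ugraph.select_convs Un_insert_left Un_empty_left)
qed

lemma edges_paraglider: "edges paraglider = {{0, 1}, {1, 2}, {2, 3}, {3, 0}, {4, 0}, {4, 1}, {4, 2}}"
proof -
  have "edges (cycle_graph 4) = (\<lambda>i. {i, Suc i mod 4}) ` {i. i < 4}"
    unfolding cycle_graph_def by auto
  also have "{i. i < 4} = {0, 1, 2, 3::nat}" by auto
  finally have "edges (cycle_graph 4) = {{0, 1}, {1, 2}, {2, 3}, {3, 0}}" by (simp, simp add: numeral_2_eq_2)
  moreover have "{{4, y} |y. y \<in> {0, 1, 2}} = {{4, 0}, {4, 1}, {4, 2 :: nat}}" by auto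
  ultimately show ?thesis unfolding paraglider_def add_vertex_def by (simp only: ugraph.select_convs Un_insert_left Un_empty_left)
qed

locale forbidden_free_graph = simple_graph +
  assumes free: "graph_free G {path_graph 7, cycle_graph 5, kite, paraglider}"
begin

sublocale adjacency "adj G"
  by (rule adjacency_adj)

lemma no_P7:
  assumes "ipath (adj G) xs" "set xs \<subseteq> vertices G"
  shows "length xs \<le> 6"
proof (rule ccontr)
  assume "\<not> ?thesis"
  then have len: "length (take 7 xs) = 7" by simp
  show False
  proof (rule graph_free_pattern[OF free, of "path_graph 7" "take 7 xs"])
    show "distinct (take 7 xs)" using ipath_distinct[OF assms(1)] by simp
    show "set (take 7 xs) \<subseteq> vertices G" using assms(2) set_take_subset by fast
    show "adj G (take 7 xs ! i) (take 7 xs ! j) \<longleftrightarrow> adj (path_graph 7) i j"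
      if "i < length (take 7 xs)" "j < length (take 7 xs)" for i j
      using ipath_nth[OF ipath_take[OF assms(1)] that] that len by (simp add: adj_path_graph)
  qed (simp_all only: len vertices_patterns, simp)
qed

lemma no_C5:
  assumes "hole (adj G) x xs" "insert x (set xs) \<subseteq> vertices G"
  shows "length xs \<noteq> 4"
proof
  assume "length xs = 4"
  then obtain a b c d where xs: "xs = [a, b, c, d]"
    by (auto simp: numeral_eq_Suc length_Suc_conv)
  have h: "x \<notin> set xs" "ipath (adj G) xs"
    "\<And>i. i < 4 \<Longrightarrow> adj G x (xs ! i) \<longleftrightarrow> i = 0 \<or> i = 3"
    using assms(1) xs by (auto simp: hole_def)
  have n: "\<And>i j. i < 4 \<Longrightarrow> j < 4 \<Longrightarrow> adj G (xs ! i) (xs ! j) \<longleftrightarrow> i = Suc j \<or> j = Suc i"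
    using ipath_nth[OF h(2)] xs by simp
  have e: "adj G x a" "\<not> adj G x b" "\<not> adj G x c" "adj G x d" "adj G a b" "\<not> adj G a c" "\<not> adj G a d"
      "adj G b c" "\<not> adj G b d" "adj G c d"
    using h(3)[of 0] h(3)[of 1] h(3)[of 2] h(3)[of 3] n[of 0 1] n[of 0 2] n[of 0 3] n[of 1 2] n[of 1 3] n[of 2 3]
    by (simp_all add: xs)
  then have e': "adj G a x" "\<not> adj G b x" "\<not> adj G c x" "adj G d x" "adj G b a" "\<not> adj G c a" "\<not> adj G d a"
      "adj G c b" "\<not> adj G d b" "adj G d c"
    by (simp_all add: commute)
  show False
  proof (rule graph_free_pattern[OF free, of "cycle_graph 5" "[x, a, b, c, d]"])
    show "distinct [x, a, b, c, d]" using ipath_distinct[OF h(2)] h(1) xs by simp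
    show "set [x, a, b, c, d] \<subseteq> vertices G" using assms xs by simp
    fix i j assume "i < length [x, a, b, c, d]" "j < length [x, a, b, c, d]"
    then have "i \<in> {0, 1, 2, 3, 4}" "j \<in> {0, 1, 2, 3, 4}" by auto
    then show "adj G ([x, a, b, c, d] ! i) ([x, a, b, c, d] ! j) \<longleftrightarrow> adj (cycle_graph 5) i j"
      unfolding adj_def[of "cycle_graph 5"] edges_cycle_graph_5
      using e e' irrefl by (elim insertE emptyE) (simp_all add: doubleton_eq_iff)
  qed (simp_all add: vertices_patterns)
qed

text \<open>Suppose \<open>y\<close> misses both ends of the central edge. If it sees the other tip
  \<open>c\<close>, the four-cycle \<open>a b c y\<close> with \<open>d\<close> is a paraglider;
  otherwise the path \<open>c b a y\<close> with \<open>d\<close> is a kite.\<close>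

lemma diamond_tips_dominated: "diamond_tips_dominated (adj G) (vertices G)"
  unfolding diamond_tips_dominated_def
proof (intro ballI impI, rule ccontr)
  fix a c b d y
  assume V: "a \<in> vertices G" "c \<in> vertices G" "b \<in> vertices G" "d \<in> vertices G" "y \<in> vertices G"
    and e: "adj G b d" "adj G a b" "adj G a d" "adj G c b" "adj G c d" "a \<noteq> c" "\<not> adj G a c" "adj G y a"
    and "\<not> (adj G y b \<or> adj G y d)"
  then have n: "\<not> adj G y b" "\<not> adj G y d" by auto
  have e': "adj G d b" "adj G b a" "adj G d a" "adj G b c" "adj G d c" "\<not> adj G c a" "adj G a y"
    "\<not> adj G b y" "\<not> adj G d y"
    using e n by (simp_all add: commute)
  have dist: "a \<noteq> b" "a \<noteq> d" "c \<noteq> b" "c \<noteq> d" "b \<noteq> d" "y \<noteq> a" "y \<noteq> b" "y \<noteq> d" "y \<noteq> c"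
    using e e' n irrefl by auto
  show False
  proof (cases "adj G y c")
    case True
    note T = True sym[OF True]
    show False
    proof (rule graph_free_pattern[OF free, of paraglider "[a, b, c, y, d]"])
      fix i j assume "i < length [a, b, c, y, d]" "j < length [a, b, c, y, d]"
      then have "i \<in> {0, 1, 2, 3, 4}" "j \<in> {0, 1, 2, 3, 4}" by auto
      then show "adj G ([a, b, c, y, d] ! i) ([a, b, c, y, d] ! j) \<longleftrightarrow> adj paraglider i j"
        unfolding adj_def[of paraglider] edges_paraglider
        using e e' n T irrefl by (elim insertE emptyE) (simp_all add: doubleton_eq_iff)
    qed (use V dist e in \<open>simp_all add: vertices_patterns\<close>)
  next
    case False
    then have F: "\<not> adj G y c" "\<not> adj G c y" by (simp_all add: commute)
    show False
    proof (rule graph_free_pattern[OF free, of kite "[c, b, a, y, d]"])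
      fix i j assume "i < length [c, b, a, y, d]" "j < length [c, b, a, y, d]"
      then have "i \<in> {0, 1, 2, 3, 4}" "j \<in> {0, 1, 2, 3, 4}" by auto
      then show "adj G ([c, b, a, y, d] ! i) ([c, b, a, y, d] ! j) \<longleftrightarrow> adj kite i j"
        unfolding adj_def[of kite] edges_kite
        using e e' n F irrefl by (elim insertE emptyE) (simp_all add: doubleton_eq_iff)
    qed (use V dist e in \<open>auto simp: vertices_patterns\<close>)
  qed
qed

text \<open>In a subgraph violating perfection the colouring theorem yields an odd hole, that is,
  \<open>xs\<close> of even length. As an induced path \<open>xs\<close> has at most six vertices,
  and length four is a five-cycle, so only six remains.\<close>

lemma imperfect_7_hole:
  assumes "imperfect_graph G"
  obtains x xs where "hole (adj G) x xs" "length xs = 6" "insert x (set xs) \<subseteq> vertices G"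
proof -
  obtain S where S: "S \<subseteq> vertices G"
    and neq: "chromatic_number (induced_subgraph G S) \<noteq> clique_number (induced_subgraph G S)"
    using assms unfolding perfect_graph_def by blast
  let ?H = "induced_subgraph G S"
  have VH: "vertices ?H = S" using S by (auto simp: induced_subgraph_def)
  have finS: "finite S" using S finite_vertices finite_subset by blast
  define k where "k = clique_number ?H"
  define Ks where "Ks = {K. is_clique ?H K}"
  have Ks: "finite Ks" "{} \<in> Ks"
    using finS by (auto simp: Ks_def is_clique_def VH intro: finite_subset[of _ "Pow S"])
  have clq: "is_clique ?H K \<longleftrightarrow> K \<subseteq> S \<and> clique (adj G) K" for K
    using adj_induced_subgraph unfolding is_clique_def clique_def VH by blast
  have k_max: "card K \<le> k" if "K \<in> Ks" for K
    using Ks that unfolding k_def clique_number_def Ks_def[symmetric] by (intro Max_ge) auto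
  have "k \<in> card ` Ks"
    using Ks unfolding k_def clique_number_def Ks_def[symmetric] by (intro Max_in) auto
  then obtain K where K: "K \<in> Ks" "card K = k" by blast
  have bound: "clique_bound (adj G) S k"
    using k_max unfolding clique_bound_def Ks_def by (auto simp: clq)
  have proper: "proper_coloring ?H j c \<longleftrightarrow> (\<forall>v\<in>S. c v < j) \<and> (\<forall>u\<in>S. \<forall>v\<in>S. adj G u v \<longrightarrow> c u \<noteq> c v)" for j c
    using adj_induced_subgraph unfolding proper_coloring_def VH by auto
  have "\<not> colorable (adj G) S k"
  proof
    assume "colorable (adj G) S k"
    then have ex: "\<exists>c. proper_coloring ?H k c" unfolding colorable_def proper by blast
    have "k \<le> j" if col: "\<exists>c. proper_coloring ?H j c" for j
    proof -
      obtain c where c: "proper_coloring ?H j c" using col by blast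
      have KS: "K \<subseteq> S" "clique (adj G) K" using K by (auto simp: Ks_def clq)
      then have "inj_on c K" using c unfolding proper clique_def inj_on_def by blast
      then have "card K = card (c ` K)" by (simp add: card_image)
      also have "\<dots> \<le> card {..<j}" using c KS unfolding proper by (intro card_mono) auto
      finally show ?thesis using K by simp
    qed
    then have "chromatic_number ?H = k" unfolding chromatic_number_def using ex by (intro Least_equality) auto
    then show False using neq k_def by simp
  qed
  then have "\<not> odd_hole_free (adj G) S"
    using diamond_tips_dominated_odd_hole_free_colorable[OF adjacency_adj finS _ _ bound]
      diamond_tips_dominated_subset[OF diamond_tips_dominated S] by blast
  then obtain x xs where h: "x \<in> S" "set xs \<subseteq> S" "hole (adj G) x xs" "even (length xs)"
    unfolding odd_hole_free_def by blast
  then have sub: "insert x (set xs) \<subseteq> vertices G" using S by auto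
  have "3 \<le> length xs" "ipath (adj G) xs" using h by (auto simp: hole_def)
  then have "length xs \<le> 6" "length xs \<noteq> 4" "3 \<le> length xs" using no_P7 no_C5[OF h(3) sub] sub by auto
  then have "length xs = 6" using h(4) by presburger
  then show thesis using that h sub by blast
qed

end

section \<open>Neighbourhoods on a seven-cycle\<close>

context forbidden_free_graph
begin

abbreviation E :: "'a \<Rightarrow> 'a \<Rightarrow> bool" where "E \<equiv> adj G"

text \<open>The adjacency vector of \<open>x\<close>. An equation with a literal 0/1 list simplifies
  to one literal \<open>E x v\<close> or its negation per entry.\<close>

abbreviation row :: "'a \<Rightarrow> 'a list \<Rightarrow> int list" where
  "row x vs \<equiv> map (\<lambda>v. of_bool (E x v)) vs"

text \<open>Instances for explicit lists serve as oriented rewrite rules: each unordered pair is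
  reduced to a single atom before the propositional search.\<close>

lemma commute_list: "list_all (\<lambda>v. E v x = E x v) vs"
  by (induction vs) (auto simp: commute)

lemma no_self: "E x x = False"
  using irrefl by simp

text \<open>In instances \<open>dia[of b d a c y]\<close> the first two vertices are the central
  edge, the next two the tips, and \<open>y\<close> is attached to the tip \<open>a\<close>.\<close>

lemma dia:
  assumes "E b d" "E a b" "E a d" "E c b" "E c d" "a \<noteq> c" "\<not> E a c" "E y a"
  shows "E y b \<or> E y d"
  using diamond_tips_dominatedD[OF diamond_tips_dominated _ assms] adj_vertices assms by blast

text \<open>Distinctness of the five vertices follows from the adjacency pattern, so each instance
  is a clause in adjacencies alone. The same holds for the seven-vertex path below.\<close>

lemma c5:
  assumes e: "E a b" "E b c" "E c d" "E d e" "E e a"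
    and n: "\<not> E a c" "\<not> E a d" "\<not> E b d" "\<not> E b e" "\<not> E c e"
  shows False
proof -
  have d: "distinct [a, b, c, d, e]" using e n irrefl commute by auto
  have e': "E b a" "E c b" "E d c" "E e d" "E a e" "\<not> E c a" "\<not> E d a" "\<not> E d b" "\<not> E e b" "\<not> E e c"
    using e n by (simp_all add: commute)
  have "ipath E [b, c, d, e]"
    unfolding ipath_def
  proof (intro conjI allI impI)
    fix i j assume "i < length [b, c, d, e]" "j < length [b, c, d, e]"
    then have "i \<in> {0, 1, 2, 3}" "j \<in> {0, 1, 2, 3}" by auto
    then show "E ([b, c, d, e] ! i) ([b, c, d, e] ! j) \<longleftrightarrow> i = Suc j \<or> j = Suc i"
      using e e' n irrefl by (elim insertE emptyE) simp_all
  qed (use d in simp)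
  moreover have "E a ([b, c, d, e] ! i) \<longleftrightarrow> i = 0 \<or> Suc i = 4" if "i < 4" for i
  proof -
    have "i \<in> {0, 1, 2, 3}" using that by auto
    then show ?thesis using e' e n by (elim insertE emptyE) simp_all
  qed
  ultimately have "hole E a [b, c, d, e]" using d by (auto simp: hole_def eval_nat_numeral)
  then show False using no_C5[of a "[b, c, d, e]"] e adj_vertices by auto
qed

lemma p7:
  assumes e: "E a b" "E b c" "E c d" "E d e" "E e f" "E f g"
    and n: "\<not> E a c" "\<not> E a d" "\<not> E a e" "\<not> E a f" "\<not> E a g" "\<not> E b d" "\<not> E b e" "\<not> E b f" "\<not> E b g"
      "\<not> E c e" "\<not> E c f" "\<not> E c g" "\<not> E d f" "\<not> E d g" "\<not> E e g"
  shows False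
proof -
  have d: "distinct [a, b, c, d, e, f, g]" using e n irrefl commute by auto
  have s: "E b a" "E c b" "E d c" "E e d" "E f e" "E g f"
    "\<not> E c a" "\<not> E d a" "\<not> E e a" "\<not> E f a" "\<not> E g a" "\<not> E d b" "\<not> E e b" "\<not> E f b" "\<not> E g b"
    "\<not> E e c" "\<not> E f c" "\<not> E g c" "\<not> E f d" "\<not> E g d" "\<not> E g e"
    using e n by (simp_all add: commute)
  have "ipath E [a, b, c, d, e, f, g]"
    unfolding ipath_def
  proof (intro conjI allI impI)
    fix i j assume "i < length [a, b, c, d, e, f, g]" "j < length [a, b, c, d, e, f, g]"
    then have "i \<in> {0, 1, 2, 3, 4, 5, 6}" "j \<in> {0, 1, 2, 3, 4, 5, 6}" by auto
    then show "E ([a, b, c, d, e, f, g] ! i) ([a, b, c, d, e, f, g] ! j) \<longleftrightarrow> i = Suc j \<or> j = Suc i"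
      using e s n irrefl by (elim insertE emptyE) simp_all
  qed (use d in simp)
  then show False using no_P7[of "[a, b, c, d, e, f, g]"] e adj_vertices by auto
qed

section \<open>Induced seven-cycles and their relabellings\<close>

definition seven_cycle :: "'a list \<Rightarrow> bool" where
  "seven_cycle vs \<longleftrightarrow> length vs = 7 \<and> distinct vs \<and>
     (\<forall>i<7. \<forall>j<7. E (vs ! i) (vs ! j) \<longleftrightarrow> j = Suc i mod 7 \<or> i = Suc j mod 7)"

lemma seven_cycle_rotate1:
  assumes "seven_cycle vs"
  shows "seven_cycle (rotate1 vs)"
  unfolding seven_cycle_def
proof (intro conjI allI impI)
  show "length (rotate1 vs) = 7" "distinct (rotate1 vs)" using assms by (simp_all add: seven_cycle_def)
  fix i j :: nat assume ij: "i < 7" "j < 7"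
  have "E (rotate1 vs ! i) (rotate1 vs ! j) \<longleftrightarrow> Suc j mod 7 = Suc (Suc i mod 7) mod 7 \<or> Suc i mod 7 = Suc (Suc j mod 7) mod 7"
    using assms ij nth_rotate1[of i vs] nth_rotate1[of j vs] by (simp add: seven_cycle_def)
  also have "\<dots> \<longleftrightarrow> j = Suc i mod 7 \<or> i = Suc j mod 7"
  proof -
    have "i \<in> {0, 1, 2, 3, 4, 5, 6}" "j \<in> {0, 1, 2, 3, 4, 5, 6}" using ij by auto
    then show ?thesis by (elim insertE emptyE) simp_all
  qed
  finally show "E (rotate1 vs ! i) (rotate1 vs ! j) \<longleftrightarrow> j = Suc i mod 7 \<or> i = Suc j mod 7" .
qed

lemma seven_cycle_rev:
  assumes "seven_cycle vs"
  shows "seven_cycle (rev vs)"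
  unfolding seven_cycle_def
proof (intro conjI allI impI)
  show "length (rev vs) = 7" "distinct (rev vs)" using assms by (simp_all add: seven_cycle_def)
  fix i j :: nat assume ij: "i < 7" "j < 7"
  have "E (rev vs ! i) (rev vs ! j) \<longleftrightarrow> 6 - j = Suc (6 - i) mod 7 \<or> 6 - i = Suc (6 - j) mod 7"
    using assms ij by (simp add: seven_cycle_def rev_nth)
  also have "\<dots> \<longleftrightarrow> j = Suc i mod 7 \<or> i = Suc j mod 7"
  proof -
    have "i \<in> {0, 1, 2, 3, 4, 5, 6}" "j \<in> {0, 1, 2, 3, 4, 5, 6}" using ij by auto
    then show ?thesis by (elim insertE emptyE) simp_all
  qed
  finally show "E (rev vs ! i) (rev vs ! j) \<longleftrightarrow> j = Suc i mod 7 \<or> i = Suc j mod 7" .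
qed

lemma seven_cycle_edges:
  assumes "seven_cycle [v1, v2, v3, v4, v5, v6, v7]"
  shows "E v1 v2" "E v2 v3" "E v3 v4" "E v4 v5" "E v5 v6" "E v6 v7" "E v7 v1"
    "E v2 v1" "E v3 v2" "E v4 v3" "E v5 v4" "E v6 v5" "E v7 v6" "E v1 v7"
    "\<not> E v1 v3" "\<not> E v1 v4" "\<not> E v1 v5" "\<not> E v1 v6" "\<not> E v2 v4" "\<not> E v2 v5" "\<not> E v2 v6" "\<not> E v2 v7"
    "\<not> E v3 v5" "\<not> E v3 v6" "\<not> E v3 v7" "\<not> E v4 v6" "\<not> E v4 v7" "\<not> E v5 v7"
    "\<not> E v3 v1" "\<not> E v4 v1" "\<not> E v5 v1" "\<not> E v6 v1" "\<not> E v4 v2" "\<not> E v5 v2" "\<not> E v6 v2" "\<not> E v7 v2"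
    "\<not> E v5 v3" "\<not> E v6 v3" "\<not> E v7 v3" "\<not> E v6 v4" "\<not> E v7 v4" "\<not> E v7 v5"
proof -
  let ?vs = "[v1, v2, v3, v4, v5, v6, v7]"
  have *: "E (?vs ! i) (?vs ! j) \<longleftrightarrow> j = Suc i mod 7 \<or> i = Suc j mod 7" if "i < 7" "j < 7" for i j
    using assms that unfolding seven_cycle_def by blast
  show "E v1 v2" "E v2 v3" "E v3 v4" "E v4 v5" "E v5 v6" "E v6 v7" "E v7 v1"
    using *[of 0 1] *[of 1 2] *[of 2 3] *[of 3 4] *[of 4 5] *[of 5 6] *[of 6 0] by simp_all
  then show "E v2 v1" "E v3 v2" "E v4 v3" "E v5 v4" "E v6 v5" "E v7 v6" "E v1 v7" by (simp_all add: commute)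
  show "\<not> E v1 v3" "\<not> E v1 v4" "\<not> E v1 v5" "\<not> E v1 v6" "\<not> E v2 v4" "\<not> E v2 v5" "\<not> E v2 v6" "\<not> E v2 v7"
    "\<not> E v3 v5" "\<not> E v3 v6" "\<not> E v3 v7" "\<not> E v4 v6" "\<not> E v4 v7" "\<not> E v5 v7"
    using *[of 0 2] *[of 0 3] *[of 0 4] *[of 0 5] *[of 1 3] *[of 1 4] *[of 1 5] *[of 1 6] *[of 2 4] *[of 2 5]
      *[of 2 6] *[of 3 5] *[of 3 6] *[of 4 6] by simp_all
  then show "\<not> E v3 v1" "\<not> E v4 v1" "\<not> E v5 v1" "\<not> E v6 v1" "\<not> E v4 v2" "\<not> E v5 v2" "\<not> E v6 v2" "\<not> E v7 v2"
    "\<not> E v5 v3" "\<not> E v6 v3" "\<not> E v7 v3" "\<not> E v6 v4" "\<not> E v7 v4" "\<not> E v7 v5" by (simp_all add: commute)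
qed

lemma seven_cycle_of_hole:
  assumes "hole E x xs" "length xs = 6"
  shows "seven_cycle (x # xs)"
  unfolding seven_cycle_def
proof (intro conjI allI impI)
  have h: "x \<notin> set xs" "ipath E xs" "\<And>i. i < 6 \<Longrightarrow> E x (xs ! i) \<longleftrightarrow> i = 0 \<or> i = 5"
    using assms by (auto simp: hole_def)
  show "length (x # xs) = 7" "distinct (x # xs)" using assms(2) h ipath_distinct[OF h(2)] by simp_all
  fix i j :: nat assume ij: "i < 7" "j < 7"
  show "E ((x # xs) ! i) ((x # xs) ! j) \<longleftrightarrow> j = Suc i mod 7 \<or> i = Suc j mod 7"
  proof (cases i; cases j)
    assume "i = 0" "j = 0"
    then show ?thesis using irrefl by simp
  next
    fix l assume "i = 0" "j = Suc l"
    then show ?thesis using h(3)[of l] ij by (auto simp: mod_Suc)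
  next
    fix k assume "i = Suc k" "j = 0"
    then show ?thesis using h(3)[of k] ij by (auto simp: commute mod_Suc)
  next
    fix k l assume kl: "i = Suc k" "j = Suc l"
    then have "E ((x # xs) ! i) ((x # xs) ! j) \<longleftrightarrow> k = Suc l \<or> l = Suc k"
      using ipath_nth[OF h(2), of k l] ij assms(2) by simp
    also have "\<dots> \<longleftrightarrow> j = Suc i mod 7 \<or> i = Suc j mod 7" using kl ij by (auto simp: mod_Suc)
    finally show ?thesis .
  qed
qed

lemma seven_cycle_turn:
  "seven_cycle [v1, v2, v3, v4, v5, v6, v7] \<Longrightarrow> seven_cycle [v2, v3, v4, v5, v6, v7, v1]"
  using seven_cycle_rotate1[of "[v1, v2, v3, v4, v5, v6, v7]"] by simp

lemma seven_cycle_flip: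
  "seven_cycle [v1, v2, v3, v4, v5, v6, v7] \<Longrightarrow> seven_cycle [v7, v6, v5, v4, v3, v2, v1]"
  using seven_cycle_rev[of "[v1, v2, v3, v4, v5, v6, v7]"] by simp

text \<open>The fourteen symmetries of the heptagon are written out, so that a statement about all
  labellings becomes a finite set of clauses.\<close>

lemma seven_cycle_relabellings:
  assumes cyc: "seven_cycle [v1, v2, v3, v4, v5, v6, v7]"
    and Q: "\<And>ws. seven_cycle ws \<Longrightarrow> set ws = {v1, v2, v3, v4, v5, v6, v7} \<Longrightarrow> Q ws"
  shows "list_all Q [[v1, v2, v3, v4, v5, v6, v7], [v7, v6, v5, v4, v3, v2, v1], [v2, v3, v4, v5, v6, v7, v1],
    [v6, v5, v4, v3, v2, v1, v7], [v3, v4, v5, v6, v7, v1, v2], [v5, v4, v3, v2, v1, v7, v6],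
    [v4, v5, v6, v7, v1, v2, v3], [v4, v3, v2, v1, v7, v6, v5], [v5, v6, v7, v1, v2, v3, v4],
    [v3, v2, v1, v7, v6, v5, v4], [v6, v7, v1, v2, v3, v4, v5], [v2, v1, v7, v6, v5, v4, v3],
    [v7, v1, v2, v3, v4, v5, v6], [v1, v7, v6, v5, v4, v3, v2]]"
proof -
  note c2 = seven_cycle_turn[OF cyc]
  note c3 = seven_cycle_turn[OF c2] note c4 = seven_cycle_turn[OF c3] note c5 = seven_cycle_turn[OF c4]
  note c6 = seven_cycle_turn[OF c5] note c7 = seven_cycle_turn[OF c6]
  note flip = seven_cycle_flip[OF cyc] seven_cycle_flip[OF c2] seven_cycle_flip[OF c3] seven_cycle_flip[OF c4]
    seven_cycle_flip[OF c5] seven_cycle_flip[OF c6] seven_cycle_flip[OF c7]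
  note cycles = cyc c2 c3 c4 c5 c6 c7 flip
  show ?thesis
    unfolding list.pred_inject by (intro conjI TrueI Q cycles) auto
qed

lemma seven_cycle_list:
  assumes "seven_cycle vs"
  obtains v1 v2 v3 v4 v5 v6 v7 where "vs = [v1, v2, v3, v4, v5, v6, v7]"
proof -
  have "length vs = 7" using assms by (simp add: seven_cycle_def)
  then show thesis using that by (auto simp: numeral_eq_Suc length_Suc_conv)
qed

text \<open>In the last three types the gaps between consecutive neighbours around the cycle are 2,
  5, then 2, 1, 4, then 2, 1, 2, 2. A vertex of the first of these has the same neighbours on the
  cycle as \<open>v2\<close>; the triple is not mirror-symmetric, the quadruple is.\<close>

definition cycle_types :: "int list set" where
  "cycle_types = {[0, 0, 0, 0, 0, 0, 0], [1, 1, 1, 1, 1, 1, 1],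
      [1, 0, 1, 0, 0, 0, 0], [0, 0, 1, 0, 1, 1, 0],
      [1, 0, 1, 1, 0, 1, 0]}"

text \<open>The facts collected as \<open>forbidden\<close>, here and below, are clauses in the unknown adjacencies that are
  jointly unsatisfiable with the other facts passed to \<open>argo\<close>.\<close>

lemma neighbours_on_seven_cycle:
  assumes vs: "seven_cycle vs" and x: "x \<notin> set vs"
  shows "\<exists>ws. seven_cycle ws \<and> set ws = set vs \<and> row x ws \<in> cycle_types"
proof (rule ccontr)
  assume none: "\<not> ?thesis"
  have no: "row x ws \<notin> cycle_types" if "seven_cycle ws" "set ws = set vs" for ws
    using none that by blast
  obtain v1 v2 v3 v4 v5 v6 v7 where vs_eq: "vs = [v1, v2, v3, v4, v5, v6, v7]"
    using seven_cycle_list[OF vs] .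
  note cyc = vs[unfolded vs_eq]
  have d: "distinct [v1, v2, v3, v4, v5, v6, v7]" using cyc by (simp add: seven_cycle_def)
  have dist: "distinct [v1, v2, v3, v4, v5, v6, v7, x]" using d x vs_eq by auto
  note cm = commute_list[of x "[v1, v2, v3, v4, v5, v6, v7]", simplified]
  note ne = dist[simplified] iffD2[OF distinct_rev dist, simplified]
  note edges = seven_cycle_edges[OF cyc]
  note forbidden =
    dia[of v6 x v5 v7 v4] c5[of v4 v5 v6 v7 x] dia[of v5 x v4 v6 v3] c5[of v3 v4 v5 v6 x] dia[of v4 x v3 v5 v2]
      dia[of v3 x v2 v4 v1] c5[of v1 v7 v6 v5 x] dia[of v7 x v6 v1 v5] dia[of v1 x v7 v2 v6]
      dia[of v2 x v1 v3 v7] c5[of v1 v2 x v6 v7] c5[of v1 v2 v3 x v7] c5[of v2 v3 v4 v5 x] c5[of v1 v2 v3 v4 x]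
      p7[of v2 v3 v4 v5 v6 v7 x] p7[of v1 v2 v3 v4 v5 v6 x] p7[of v3 v2 v1 v7 v6 v5 x]
      p7[of v2 v1 v7 v6 v5 v4 x] p7[of v1 v7 v6 v5 v4 v3 x] p7[of v7 v6 v5 v4 v3 v2 x]
      p7[of v4 v3 v2 v1 v7 v6 x] p7[of v3 v4 v5 v6 v7 v1 x]
  have no': "row x ws \<notin> cycle_types" if "seven_cycle ws" "set ws = {v1, v2, v3, v4, v5, v6, v7}" for ws
    using no that vs_eq by simp
  note types = seven_cycle_relabellings[OF cyc, of "\<lambda>ws. row x ws \<notin> cycle_types", OF no', simplified]
  show False
    using forbidden[simplified edges cm ne no_self simp_thms] types[unfolded cycle_types_def, simplified] by argo
qed

text \<open>Here and in the next three lemmas \<open>r\<close> is an outer vertex, one that sees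
  nothing on the cycle. Together they serve to show that the attachments of a component of outer
  vertices form a clique.\<close>

lemma quadruple_no_common_outer_neighbour:
  assumes cyc: "seven_cycle [v1, v2, v3, v4, v5, v6, v7]"
    and s: "row s [v1, v2, v3, v4, v5, v6, v7] = [1, 0, 1, 1, 0, 1, 0]"
    and r: "row r [v1, v2, v3, v4, v5, v6, v7] = [0, 0, 0, 0, 0, 0, 0]"
    and t: "row t [v1, v2, v3, v4, v5, v6, v7] \<noteq> [0, 0, 0, 0, 0, 0, 0]"
    and rst: "E r s" "E r t" "\<not> E t s"
    and dist: "distinct [v1, v2, v3, v4, v5, v6, v7, s, t, r]"
  shows False
proof -
  note edges = seven_cycle_edges[OF cyc]
  note pats = s[simplified] r[simplified] rst
  note cm =
    commute_list[of s "[v1, v2, v3, v4, v5, v6, v7]", simplified]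
    commute_list[of t "[v1, v2, v3, v4, v5, v6, v7, s]", simplified]
    commute_list[of r "[v1, v2, v3, v4, v5, v6, v7, s, t]", simplified]
  note ne = dist[simplified] iffD2[OF distinct_rev dist, simplified]
  note forbidden =
    c5[of v1 v7 t r s] c5[of v4 v5 t r s] dia[of v3 v4 s t v1] c5[of v2 v3 s r t] c5[of v1 v2 v3 v4 t]
      c5[of v3 v4 v5 v6 t] p7[of v7 v1 v2 v3 v4 t r] p7[of v7 v6 v5 v4 v3 t r] p7[of v5 v4 v3 v2 v1 t r]
      c5[of v6 v7 t r s] p7[of v1 v2 v3 v4 v5 v6 t]
  show False
    using forbidden[simplified edges pats cm ne no_self simp_thms] t[simplified] by argo
qed

lemma triple_common_outer_neighbour:
  assumes cyc: "seven_cycle [v1, v2, v3, v4, v5, v6, v7]"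
    and s: "row s [v1, v2, v3, v4, v5, v6, v7] = [0, 0, 1, 0, 1, 1, 0]"
    and r: "row r [v1, v2, v3, v4, v5, v6, v7] = [0, 0, 0, 0, 0, 0, 0]"
    and t: "row t [v1, v2, v3, v4, v5, v6, v7] \<noteq> [0, 0, 0, 0, 0, 0, 0]"
    and rst: "E r s" "E r t" "\<not> E t s"
    and dist: "distinct [v1, v2, v3, v4, v5, v6, v7, s, t, r]"
  shows "row t [v1, v2, v3, v4, v5, v6, v7] = [0, 1, 1, 0, 1, 0, 0]"
proof (rule ccontr)
  assume no: "\<not> ?thesis"
  note edges = seven_cycle_edges[OF cyc]
  note pats = s[simplified] r[simplified] rst
  note cm =
    commute_list[of s "[v1, v2, v3, v4, v5, v6, v7]", simplified]
    commute_list[of t "[v1, v2, v3, v4, v5, v6, v7, s]", simplified]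
    commute_list[of r "[v1, v2, v3, v4, v5, v6, v7, s, t]", simplified]
  note ne = dist[simplified] iffD2[OF distinct_rev dist, simplified]
  note forbidden =
    c5[of v6 v7 t r s] dia[of v5 v6 s t v3] c5[of v4 v5 s r t] c5[of v2 v3 s r t] c5[of v3 v4 v5 v6 t]
      c5[of v1 v7 v6 v5 t] p7[of v2 v1 v7 v6 s r t] p7[of v2 v3 v4 v5 v6 t r] p7[of v7 v6 v5 v4 v3 t r]
      dia[of v4 t v3 v5 s] p7[of v2 v1 t r s v5 v4]
  show False
    using forbidden[simplified edges pats cm ne no_self simp_thms] t[simplified] no[simplified] by argo
qed

text \<open>On the cycle, \<open>s\<close> and \<open>t\<close> are exchanged by the reflection
  fixing \<open>v4\<close>. This configuration survives the forbidden subgraphs on its own; the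
  further neighbour \<open>u\<close> of \<open>r\<close>, supplied by the degree bound, destroys
  it.\<close>

lemma common_outer_neighbour_third_neighbour:
  assumes cyc: "seven_cycle [v1, v2, v3, v4, v5, v6, v7]"
    and s: "row s [v1, v2, v3, v4, v5, v6, v7] = [0, 0, 1, 0, 1, 1, 0]"
    and r: "row r [v1, v2, v3, v4, v5, v6, v7] = [0, 0, 0, 0, 0, 0, 0]"
    and t: "row t [v1, v2, v3, v4, v5, v6, v7] = [0, 1, 1, 0, 1, 0, 0]"
    and u: "row u [v1, v2, v3, v4, v5, v6, v7] \<noteq> [1, 1, 1, 1, 1, 1, 1]"
    and rst: "E r s" "E r t" "\<not> E t s" "E u r"
    and dist: "distinct [v1, v2, v3, v4, v5, v6, v7, s, t, r, u]"
  shows False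
proof -
  note edges = seven_cycle_edges[OF cyc]
  note pats = s[simplified] t[simplified] r[simplified] rst
  note cm =
    commute_list[of s "[v1, v2, v3, v4, v5, v6, v7]", simplified]
    commute_list[of t "[v1, v2, v3, v4, v5, v6, v7, s]", simplified]
    commute_list[of r "[v1, v2, v3, v4, v5, v6, v7, s, t]", simplified]
    commute_list[of u "[v1, v2, v3, v4, v5, v6, v7, s, t, r]", simplified]
  note ne = dist[simplified] iffD2[OF distinct_rev dist, simplified]
  note forbidden =
    dia[of r u s t v3] c5[of v6 v7 u r s] c5[of v5 v6 u r t] dia[of s u v5 r t] dia[of v5 v6 s u v3]
      dia[of v3 t v2 u v1] dia[of t u v2 r v1] c5[of v4 v5 t r u] dia[of v2 u v1 t v7] c5[of v3 v4 u r s]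
      dia[of s u v3 r v4] c5[of v1 v2 t r u] p7[of v2 v1 v7 v6 s r u] dia[of v2 v3 t u v5]
      p7[of v6 v5 v4 v3 v2 u r] c5[of v3 s v6 u t] dia[of v2 u t v1 v5] p7[of v4 v3 s v6 v7 v1 u]
      dia[of r u s t v6] c5[of v2 v3 s r u] p7[of v1 v7 v6 v5 t r u] p7[of v1 v7 u r t v3 v4]
  show False
    using forbidden[simplified edges pats cm ne no_self simp_thms] u[simplified] by argo
qed

text \<open>Meant for two attachments without a common neighbour in the outer component: the
  vertices \<open>r\<close> and \<open>q\<close> form an induced path leaving
  \<open>t\<close>.\<close>

lemma quadruple_no_outer_path:
  assumes cyc: "seven_cycle [v1, v2, v3, v4, v5, v6, v7]"
    and s: "row s [v1, v2, v3, v4, v5, v6, v7] = [1, 0, 1, 1, 0, 1, 0]"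
    and r: "row r [v1, v2, v3, v4, v5, v6, v7] = [0, 0, 0, 0, 0, 0, 0]"
    and q: "row q [v1, v2, v3, v4, v5, v6, v7] = [0, 0, 0, 0, 0, 0, 0]"
    and t: "row t [v1, v2, v3, v4, v5, v6, v7] \<noteq> [0, 0, 0, 0, 0, 0, 0]"
    and rst: "\<not> E t s" "E r t" "E q r" "\<not> E q t"
    and dist: "distinct [v1, v2, v3, v4, v5, v6, v7, s, t, r, q]"
  shows False
proof -
  note edges = seven_cycle_edges[OF cyc]
  note pats = s[simplified] r[simplified] q[simplified] rst
  note cm =
    commute_list[of s "[v1, v2, v3, v4, v5, v6, v7]", simplified]
    commute_list[of t "[v1, v2, v3, v4, v5, v6, v7, s]", simplified]
    commute_list[of r "[v1, v2, v3, v4, v5, v6, v7, s, t]", simplified]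
    commute_list[of q "[v1, v2, v3, v4, v5, v6, v7, s, t, r]", simplified]
  note ne = dist[simplified] iffD2[OF distinct_rev dist, simplified]
  note forbidden =
    dia[of v3 v4 s t v1] c5[of v4 v5 t r s] c5[of v2 v3 s v6 t] c5[of v1 s q r t] c5[of v6 v7 t r s]
      c5[of v3 v4 v5 v6 t] p7[of v1 v2 v3 v4 t r q] c5[of v1 v2 v3 v4 t] p7[of v6 v5 v4 v3 t r q]
      p7[of v2 v1 s v4 v5 t r] p7[of v6 v7 v1 v2 t r q] c5[of v1 s v4 v5 t] p7[of v2 v3 v4 v5 v6 t r]
      p7[of v6 s v3 v2 t r q] p7[of v5 v6 v7 v1 t r q] c5[of v1 v7 t v3 s] p7[of v3 v4 v5 v6 v7 t r]
      c5[of v5 v6 s r t] c5[of v4 s q r t] c5[of v1 v2 t v6 v7] c5[of v2 v3 v4 v5 t]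
  show False
    using forbidden[simplified edges pats cm ne no_self simp_thms] t[simplified] by argo
qed

end

section \<open>Clique cutsets and the degree bound\<close>

context simple_graph
begin

lemma clique_cutsetI:
  assumes conn: "connected_graph G" and K: "is_clique G K"
    and V: "vertices G - K = X \<union> Y" "X \<inter> Y = {}" "X \<noteq> {}" "Y \<noteq> {}"
    and anti: "\<And>x y. x \<in> X \<Longrightarrow> y \<in> Y \<Longrightarrow> \<not> adj G x y"
  shows "clique_cutset G K"
proof -
  let ?D = "delete_vertices G K"
  have VD: "vertices ?D = X \<union> Y" using V(1) by (auto simp: delete_vertices_def induced_subgraph_def)
  have adjD: "adj ?D u v \<Longrightarrow> adj G u v \<and> u \<in> X \<union> Y \<and> v \<in> X \<union> Y" for u v
    using V(1) by (auto simp: delete_vertices_def induced_subgraph_def adj_def)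
  have stay: "v \<in> X" if "(u, v) \<in> {(x, y). adj ?D x y}\<^sup>*" "u \<in> X" for u v
    using that
  proof (induction rule: rtrancl_induct)
    case (step y z)
    then show ?case using adjD[of y z] anti[of y z] by auto
  qed
  obtain x y where xy: "x \<in> X" "y \<in> Y" using V by blast
  have refl: "(z, z) \<in> connection_rel ?D" if "z \<in> X \<union> Y" for z
    using that by (simp add: connection_rel_def VD)
  have "connection_rel ?D `` {x} \<noteq> connection_rel ?D `` {y}"
  proof
    assume "connection_rel ?D `` {x} = connection_rel ?D `` {y}"
    then have "y \<in> connection_rel ?D `` {x}" using refl[of y] xy by auto
    then have "y \<in> X" using stay xy by (auto simp: connection_rel_def)
    then show False using xy V(2) by blast
  qed
  then have "card {connection_rel ?D `` {x}, connection_rel ?D `` {y}} = 2" by simp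
  moreover have "{connection_rel ?D `` {x}, connection_rel ?D `` {y}} \<subseteq> graph_components ?D"
    using xy by (auto simp: graph_components_def VD intro: quotientI)
  moreover have "finite (graph_components ?D)"
    unfolding graph_components_def
  proof (rule finite_quotient)
    have "X \<union> Y \<subseteq> vertices G" using V(1) by auto
    then show "finite (vertices ?D)" unfolding VD using finite_vertices by (rule finite_subset)
    show "connection_rel ?D \<subseteq> vertices ?D \<times> vertices ?D" by (auto simp: connection_rel_def)
  qed
  ultimately have "2 \<le> card (graph_components ?D)" by (metis card_mono)
  moreover have "graph_components G \<subseteq> {vertices G}"
  proof
    fix C assume "C \<in> graph_components G"
    then obtain u where "u \<in> vertices G" "C = connection_rel G `` {u}"
      unfolding graph_components_def by (rule quotientE)
    then have "C = vertices G" using conn by (auto simp: connected_graph_def connection_rel_def)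
    then show "C \<in> {vertices G}" by simp
  qed
  then have "card (graph_components G) \<le> 1" using card_mono[of "{vertices G}"] by simp
  ultimately show ?thesis using K unfolding clique_cutset_def by simp
qed

text \<open>The clique \<open>K\<close> merely certifies a lower bound on the clique number and can
  be chosen independently of \<open>v\<close>: every degree exceeds the size of every
  clique.\<close>

lemma degree_neighbour:
  assumes deg: "clique_number G + 1 \<le> min_degree G" and v: "v \<in> vertices G"
    and K: "is_clique G K" and T: "finite T" "card T \<le> card K"
  obtains x where "adj G v x" "x \<notin> T"
proof -
  define Ks where "Ks = {K. is_clique G K}"
  have "finite Ks" unfolding Ks_def is_clique_def
    using finite_vertices by (auto intro: finite_subset[of _ "Pow (vertices G)"])
  then have "card K \<le> clique_number G"
    unfolding clique_number_def Ks_def[symmetric] using K by (intro Max_ge) (auto simp: Ks_def)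
  moreover have "min_degree G \<le> degree G v"
    unfolding min_degree_def using v finite_vertices by (intro Min_le) auto
  ultimately have "card T < card (neighborhood G v)" using deg T by (simp add: degree_def)
  then have "\<not> neighborhood G v \<subseteq> T" using T(1) card_mono by (metis not_le)
  then show thesis using that by (auto simp: neighborhood_def adj_def insert_commute)
qed

end

section \<open>Vertices off a seven-cycle when the conclusion fails\<close>

locale extremal_graph = forbidden_free_graph +
  assumes conn: "connected_graph G"
    and no_cutset: "\<not> clique_cutset G K"
    and no_comparable: "\<not> comparable_pair G u v"
    and no_universal: "\<not> universal_clique G K"
    and deg: "clique_number G + 1 \<le> min_degree G"
begin

abbreviation V :: "'a set" where "V \<equiv> vertices G"

lemma private_neighbour:
  assumes "u \<in> V" "v \<in> V" "u \<noteq> v" "\<not> E u v"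
  obtains y where "E u y" "\<not> E v y"
proof -
  have "\<not> neighborhood G u \<subseteq> neighborhood G v"
    using no_comparable[of u v] assms by (auto simp: comparable_pair_def)
  then show thesis using that by (auto simp: neighborhood_def commute)
qed

lemma seven_cycle_vertices:
  assumes "seven_cycle vs"
  shows "set vs \<subseteq> V"
proof -
  obtain v1 v2 v3 v4 v5 v6 v7 where vs: "vs = [v1, v2, v3, v4, v5, v6, v7]"
    using seven_cycle_list[OF assms] .
  show ?thesis using seven_cycle_edges[OF assms[unfolded vs]] adj_vertices vs by auto
qed

text \<open>Going around the cycle, somewhere adjacency to \<open>y\<close> stops. The nonadjacent
  pair \<open>a\<close>, \<open>c\<close> then forms with \<open>b\<close> and any vertex complete
  to the cycle a diamond to which \<open>y\<close> is attached.\<close>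

lemma seven_cycle_transition:
  assumes "seven_cycle vs" "p \<in> set vs" "E y p" "q \<in> set vs" "\<not> E y q"
  obtains a b c where "{a, b, c} \<subseteq> set vs" "E y a" "\<not> E y b" "E a b" "E b c" "\<not> E a c" "a \<noteq> c"
proof -
  obtain v1 v2 v3 v4 v5 v6 v7 where vs: "vs = [v1, v2, v3, v4, v5, v6, v7]"
    using seven_cycle_list[OF assms(1)] .
  have d: "distinct [v1, v2, v3, v4, v5, v6, v7]" using assms(1) vs by (simp add: seven_cycle_def)
  note e = seven_cycle_edges[OF assms(1)[unfolded vs]]
  consider "E y v1" "\<not> E y v2" | "E y v2" "\<not> E y v3" | "E y v3" "\<not> E y v4" | "E y v4" "\<not> E y v5"
    | "E y v5" "\<not> E y v6" | "E y v6" "\<not> E y v7" | "E y v7" "\<not> E y v1"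
    using assms(2-5) vs by auto
  then show thesis
  proof cases
    case 1 then show ?thesis using that[of v1 v2 v3] vs e d by auto
  next
    case 2 then show ?thesis using that[of v2 v3 v4] vs e d by auto
  next
    case 3 then show ?thesis using that[of v3 v4 v5] vs e d by auto
  next
    case 4 then show ?thesis using that[of v4 v5 v6] vs e d by auto
  next
    case 5 then show ?thesis using that[of v5 v6 v7] vs e d by auto
  next
    case 6 then show ?thesis using that[of v6 v7 v1] vs e d by auto
  next
    case 7 then show ?thesis using that[of v7 v1 v2] vs e d by auto
  qed
qed

text \<open>If nonadjacent, the two vertices are tips over \<open>v1 v2\<close>, and
  \<open>v4\<close> sees a tip but neither end of this edge.\<close>

lemma complete_to_seven_cycle_adjacent:
  assumes cyc: "seven_cycle vs" and z: "z \<in> V" "\<And>v. v \<in> set vs \<Longrightarrow> E z v"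
    and z': "z' \<in> V" "\<And>v. v \<in> set vs \<Longrightarrow> E z' v" and "z \<noteq> z'"
  shows "E z z'"
proof (rule ccontr)
  assume "\<not> E z z'"
  obtain v1 v2 v3 v4 v5 v6 v7 where vs: "vs = [v1, v2, v3, v4, v5, v6, v7]"
    using seven_cycle_list[OF cyc] .
  note e = seven_cycle_edges[OF cyc[unfolded vs]]
  have "E v4 v1 \<or> E v4 v2"
    using dia[of v1 v2 z z' v4] z z' vs e \<open>z \<noteq> z'\<close> \<open>\<not> E z z'\<close> commute[of v4 z] by auto
  then show False using e by simp
qed

text \<open>Completeness to the cycle propagates along shortest paths, so such vertices would form a universal
  clique or a clique cutset.\<close>

lemma not_complete_to_seven_cycle:
  assumes cyc: "seven_cycle vs" and "z0 \<in> V"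
  shows "\<exists>v\<in>set vs. \<not> E z0 v"
proof (rule ccontr)
  assume full: "\<not> ?thesis"
  let ?C = "set vs"
  define Z where "Z = {z \<in> V. \<forall>v\<in>?C. E z v}"
  define W where "W = V - Z"
  have CV: "?C \<subseteq> V" by (rule seven_cycle_vertices[OF cyc])
  have Cne: "?C \<noteq> {}" using cyc by (auto simp: seven_cycle_def)
  have CW: "?C \<subseteq> W" using CV irrefl by (auto simp: W_def Z_def)
  have z0: "z0 \<in> Z" using full assms(2) by (auto simp: Z_def)
  have Zclique: "is_clique G Z"
    unfolding is_clique_def using complete_to_seven_cycle_adjacent[OF cyc] by (auto simp: Z_def)
  define X where "X = {r \<in> W. \<exists>zs. link E W ?C {r} zs}"
  have closed: "s \<in> X" if "r \<in> X" "s \<in> W" "E r s" for r s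
  proof -
    obtain zs where "link E W ?C {r} zs" using \<open>r \<in> X\<close> by (auto simp: X_def)
    then have "link E W ?C {s} (zs @ [s])" using that by (auto simp: link_def successively_append_iff)
    then show ?thesis using that by (auto simp: X_def)
  qed
  have CX: "?C \<subseteq> X"
  proof
    fix v assume v: "v \<in> ?C"
    then have "link E W ?C {v} [v]" using CW by (auto simp: link_def)
    then show "v \<in> X" using v CW by (auto simp: X_def)
  qed
  \<comment> \<open>The diamond has central edge \<open>b z\<close> and tips \<open>a\<close>,
    \<open>c\<close>; since \<open>y\<close> sees \<open>a\<close> but not \<open>b\<close>, it sees
    \<open>z\<close>.\<close>
  have attach: "E y z" if z: "z \<in> Z" and y: "y \<in> W" "v \<in> ?C" "E y v" for y v z
  proof -
    obtain u where "u \<in> ?C" "\<not> E y u" using y by (auto simp: W_def Z_def)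
    then obtain a b c where abc: "{a, b, c} \<subseteq> ?C" "E y a" "\<not> E y b" "E a b" "E b c" "\<not> E a c" "a \<noteq> c"
      using seven_cycle_transition[OF cyc y(2,3)] by metis
    have "E z a" "E z b" "E z c" using z abc by (auto simp: Z_def)
    then have "E y b \<or> E y z"
      using abc by (intro dia[of b z a c y]) (auto intro: sym)
    then show ?thesis using abc by blast
  qed
  \<comment> \<open>Along an induced shortest path, three consecutive vertices adjacent to
    \<open>z\<close> form a diamond with it, which forces the next vertex to see \<open>z\<close>.
    Near the cycle there are too few path vertices, and the diamond uses cycle vertices
    instead.\<close>
  have complete: "E r z" if r: "r \<in> X" and z: "z \<in> Z" for r z
  proof -
    obtain ys where "link E W ?C {r} ys" using r by (auto simp: X_def)
    then obtain zs where sl: "shortest_link E W ?C {r} zs" using shortest_link_exists by blast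
    have zs: "zs \<noteq> []" "set zs \<subseteq> W" "hd zs \<in> ?C" "last zs = r"
      using shortest_linkD[OF sl] by (auto simp: link_def)
    have ip: "ipath E zs" by (rule shortest_link_ipath[OF sl])
    have nth: "E (zs ! i) (zs ! j) \<longleftrightarrow> i = Suc j \<or> j = Suc i" if "i < length zs" "j < length zs" for i j
      using ipath_nth[OF ip that] .
    have "E (zs ! i) z" if "i < length zs" for i
      using that
    proof (induction i rule: less_induct)
      case (less i)
      have iW: "zs ! i \<in> W" using less.prems zs by auto
      have z0C: "zs ! 0 \<in> ?C" using zs by (simp add: hd_conv_nth)
      consider "i = 0" | "i = 1" | "i = 2" | "3 \<le> i" by linarith
      then show ?case
      proof cases
        case 1
        then show ?thesis using z0C z sym by (auto simp: Z_def)
      next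
        case 2
        have "E (zs ! i) (zs ! 0)" using nth[of i 0] less.prems 2 zs(1) by auto
        then show ?thesis using attach[OF z iW z0C] by blast
      next
        case 3
        have y1: "zs ! 1 \<in> W" "E (zs ! 1) (zs ! 0)"
          using less.prems 3 zs nth[of 1 0] by (auto intro: nth_mem)
        obtain u where "u \<in> ?C" "\<not> E (zs ! 1) u" using y1 by (auto simp: W_def Z_def)
        then obtain a b c where abc: "{a, b, c} \<subseteq> ?C" "E (zs ! 1) a" "\<not> E (zs ! 1) b" "E a b"
          using seven_cycle_transition[OF cyc z0C y1(2)] by metis
        have Za: "E z a" "E z b" using z abc by (auto simp: Z_def)
        have IH: "E (zs ! 1) z" using less.IH[of 1] less.prems 3 by auto
        have "zs ! 1 \<notin> ?C" using shortest_link_in_start[OF sl, of 1] less.prems 3 by auto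
        then have "zs ! 1 \<noteq> b" using abc by auto
        moreover have "E (zs ! i) (zs ! 1)" using nth[of i 1] less.prems 3 by auto
        ultimately have "E (zs ! i) a \<or> E (zs ! i) z"
          using abc Za IH by (intro dia[of a z "zs ! 1" b "zs ! i"]) (auto intro: sym)
        moreover have "\<not> E (zs ! i) a"
        proof
          assume "E (zs ! i) a"
          then have "i \<le> 1"
            using shortest_link_start[OF sl less.prems, of a] abc CW sym by auto
          then show False using 3 by simp
        qed
        ultimately show ?thesis by blast
      next
        case 4
        have "E (zs ! i) (zs ! (i - 2)) \<or> E (zs ! i) z"
        proof (rule dia[of "zs ! (i - 2)" z "zs ! (i - 1)" "zs ! (i - 3)" "zs ! i"])
          show "E (zs ! (i - 2)) z" "E (zs ! (i - 1)) z" "E (zs ! (i - 3)) z"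
            using less.IH[of "i - 2"] less.IH[of "i - 1"] less.IH[of "i - 3"] less.prems 4 by auto
          show "E (zs ! (i - 1)) (zs ! (i - 2))" "E (zs ! (i - 3)) (zs ! (i - 2))"
            "\<not> E (zs ! (i - 1)) (zs ! (i - 3))" "E (zs ! i) (zs ! (i - 1))"
            using nth[of "i - 1" "i - 2"] nth[of "i - 3" "i - 2"] nth[of "i - 1" "i - 3"] nth[of i "i - 1"]
              less.prems 4 by auto
          show "zs ! (i - 1) \<noteq> zs ! (i - 3)"
            using nth_eq_iff_index_eq[OF ipath_distinct[OF ip], of "i - 1" "i - 3"] less.prems 4 by auto
        qed
        moreover have "\<not> E (zs ! i) (zs ! (i - 2))" using nth[of i "i - 2"] less.prems 4 by auto
        ultimately show ?thesis by blast
      qed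
    qed
    from this[of "length zs - 1"] show ?thesis using zs by (simp add: last_conv_nth)
  qed
  show False
  proof (cases "X = W")
    case True
    have "universal_clique G Z"
      unfolding universal_clique_def
      using z0 Zclique complete True sym by (auto simp: W_def)
    then show False using no_universal by blast
  next
    case False
    have XW: "X \<subseteq> W" by (auto simp: X_def)
    have "clique_cutset G Z"
    proof (rule clique_cutsetI[OF conn Zclique, of X "W - X"])
      show "vertices G - Z = X \<union> (W - X)" using XW by (auto simp: W_def)
      show "X \<noteq> {}" using CX Cne by auto
      show "W - X \<noteq> {}" using XW False by auto
      show "\<not> E p q" if "p \<in> X" "q \<in> W - X" for p q using closed[of p q] that by blast
    qed auto
    then show False using no_cutset by blast
  qed
qed

lemma attached_vertex_type:
  assumes cyc: "seven_cycle vs" and s: "s \<in> V" "s \<notin> set vs" "v \<in> set vs" "E s v"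
  obtains v1 v2 v3 v4 v5 v6 v7 where "seven_cycle [v1, v2, v3, v4, v5, v6, v7]" "{v1, v2, v3, v4, v5, v6, v7} = set vs"
    "row s [v1, v2, v3, v4, v5, v6, v7] \<in> {[1, 0, 1, 0, 0, 0, 0],
      [0, 0, 1, 0, 1, 1, 0], [1, 0, 1, 1, 0, 1, 0]}"
proof -
  obtain ws where ws: "seven_cycle ws" "set ws = set vs" "row s ws \<in> cycle_types"
    using neighbours_on_seven_cycle[OF cyc s(2)] by blast
  obtain v1 v2 v3 v4 v5 v6 v7 where eq: "ws = [v1, v2, v3, v4, v5, v6, v7]"
    using seven_cycle_list[OF ws(1)] .
  have "\<exists>u\<in>set ws. E s u" "\<exists>u\<in>set ws. \<not> E s u"
    using s ws(2) not_complete_to_seven_cycle[OF ws(1) s(1)] by auto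
  then have "row s ws \<noteq> [0, 0, 0, 0, 0, 0, 0]"
    "row s ws \<noteq> [1, 1, 1, 1, 1, 1, 1]"
    unfolding eq by auto
  then show thesis using that[of v1 v2 v3 v4 v5 v6 v7] ws unfolding eq cycle_types_def by auto
qed

text \<open>A vertex \<open>s\<close> seeing only \<open>v1\<close> and \<open>v3\<close> would give
  the induced path \<open>r s v3 v4 v5 v6 v7\<close>.\<close>

lemma outer_neighbour_type:
  assumes cyc: "seven_cycle vs" and s: "s \<in> V" "s \<notin> set vs" "v \<in> set vs" "E s v"
    and r: "\<And>v. v \<in> set vs \<Longrightarrow> \<not> E r v" "E r s"
  obtains v1 v2 v3 v4 v5 v6 v7 where "seven_cycle [v1, v2, v3, v4, v5, v6, v7]" "{v1, v2, v3, v4, v5, v6, v7} = set vs"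
    "row s [v1, v2, v3, v4, v5, v6, v7] \<in> {[0, 0, 1, 0, 1, 1, 0],
      [1, 0, 1, 1, 0, 1, 0]}"
proof -
  obtain v1 v2 v3 v4 v5 v6 v7 where ws: "seven_cycle [v1, v2, v3, v4, v5, v6, v7]"
    "{v1, v2, v3, v4, v5, v6, v7} = set vs"
    "row s [v1, v2, v3, v4, v5, v6, v7] \<in> {[1, 0, 1, 0, 0, 0, 0],
      [0, 0, 1, 0, 1, 1, 0], [1, 0, 1, 1, 0, 1, 0]}"
    using attached_vertex_type[OF cyc s] by blast
  have "\<not> E r v1 \<and> \<not> E r v2 \<and> \<not> E r v3 \<and> \<not> E r v4 \<and> \<not> E r v5 \<and> \<not> E r v6 \<and> \<not> E r v7"
    using r ws(2) by blast
  then have "row s [v1, v2, v3, v4, v5, v6, v7] \<noteq> [1, 0, 1, 0, 0, 0, 0]"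
    using p7[of r s v3 v4 v5 v6 v7] seven_cycle_edges[OF ws(1)] r(2) by auto
  then show thesis using that[of v1 v2 v3 v4 v5 v6 v7] ws by blast
qed

text \<open>For the triple type, \<open>q r s v3 v2 v1 v7\<close> would be an induced path.\<close>

lemma outer_path_type:
  assumes cyc: "seven_cycle vs" and s: "s \<in> V" "s \<notin> set vs" "v \<in> set vs" "E s v"
    and r: "\<And>v. v \<in> set vs \<Longrightarrow> \<not> E r v" "E r s" and q: "\<And>v. v \<in> set vs \<Longrightarrow> \<not> E q v" "E q r" "\<not> E q s"
  obtains v1 v2 v3 v4 v5 v6 v7 where "seven_cycle [v1, v2, v3, v4, v5, v6, v7]" "{v1, v2, v3, v4, v5, v6, v7} = set vs"
    "row s [v1, v2, v3, v4, v5, v6, v7] = [1, 0, 1, 1, 0, 1, 0]"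
proof -
  obtain v1 v2 v3 v4 v5 v6 v7 where ws: "seven_cycle [v1, v2, v3, v4, v5, v6, v7]"
    "{v1, v2, v3, v4, v5, v6, v7} = set vs"
    "row s [v1, v2, v3, v4, v5, v6, v7] \<in> {[0, 0, 1, 0, 1, 1, 0],
      [1, 0, 1, 1, 0, 1, 0]}"
    using outer_neighbour_type[OF cyc s r] by blast
  have "\<not> E r v1 \<and> \<not> E r v2 \<and> \<not> E r v3 \<and> \<not> E r v4 \<and> \<not> E r v5 \<and> \<not> E r v6 \<and> \<not> E r v7"
    "\<not> E q v1 \<and> \<not> E q v2 \<and> \<not> E q v3 \<and> \<not> E q v4 \<and> \<not> E q v5 \<and> \<not> E q v6 \<and> \<not> E q v7"
    using r q ws(2) by blast+
  then have "row s [v1, v2, v3, v4, v5, v6, v7] \<noteq> [0, 0, 1, 0, 1, 1, 0]"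
    using p7[of q r s v3 v2 v1 v7] seven_cycle_edges[OF ws(1)] r(2) q(2,3) by auto
  then show thesis using that[of v1 v2 v3 v4 v5 v6 v7] ws by blast
qed

lemma common_outer_neighbour_adjacent:
  assumes cyc: "seven_cycle vs" and s: "s \<in> V" "s \<notin> set vs" "v \<in> set vs" "E s v"
    and t: "t \<in> V" "t \<notin> set vs" "w \<in> set vs" "E t w" and "s \<noteq> t"
    and r: "r \<notin> set vs" "\<And>v. v \<in> set vs \<Longrightarrow> \<not> E r v" "E r s" "E r t"
  shows "E t s"
proof (rule ccontr)
  assume nst: "\<not> E t s"
  obtain v1 v2 v3 v4 v5 v6 v7 where ws: "seven_cycle [v1, v2, v3, v4, v5, v6, v7]"
    "{v1, v2, v3, v4, v5, v6, v7} = set vs"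
    "row s [v1, v2, v3, v4, v5, v6, v7] \<in> {[0, 0, 1, 0, 1, 1, 0],
      [1, 0, 1, 1, 0, 1, 0]}"
    using outer_neighbour_type[OF cyc s r(2,3)] by blast
  note e = seven_cycle_edges[OF ws(1)]
  have d7: "distinct [v1, v2, v3, v4, v5, v6, v7]" using ws(1) by (simp add: seven_cycle_def)
  have srt: "s \<noteq> r" "t \<noteq> r" using r irrefl by auto
  have dist: "distinct [v1, v2, v3, v4, v5, v6, v7, s, t, r]"
    using d7 s t r srt \<open>s \<noteq> t\<close> ws(2) by auto
  have rF: "row r [v1, v2, v3, v4, v5, v6, v7] = [0, 0, 0, 0, 0, 0, 0]"
    using r(2) ws(2) by auto
  have tF: "row t [v1, v2, v3, v4, v5, v6, v7] \<noteq> [0, 0, 0, 0, 0, 0, 0]"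
    using t(3,4) ws(2) by auto
  have sB: "row s [v1, v2, v3, v4, v5, v6, v7] = [0, 0, 1, 0, 1, 1, 0]"
    using ws(3) quadruple_no_common_outer_neighbour[OF ws(1) _ rF tF r(3,4) nst dist] by (metis insertE singletonD)
  have tB: "row t [v1, v2, v3, v4, v5, v6, v7] = [0, 1, 1, 0, 1, 0, 0]"
    by (rule triple_common_outer_neighbour[OF ws(1) sB rF tF r(3,4) nst dist])
  \<comment> \<open>The edge \<open>v1 v2\<close> shows that all degrees are at least three, so
    \<open>r\<close> has a neighbour besides \<open>s\<close> and \<open>t\<close>.\<close>
  have "r \<in> V" "{v1, v2} \<subseteq> V" using r(3) e(1) adj_vertices by auto
  then obtain u where u: "E r u" "u \<notin> {s, t}"
    using degree_neighbour[OF deg, of r "{v1, v2}" "{s, t}"] d7 \<open>s \<noteq> t\<close> e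
    by (auto simp: is_clique_def)
  have "u \<in> V" using u adj_vertices by blast
  have uC: "u \<notin> {v1, v2, v3, v4, v5, v6, v7}" using u r(2) ws(2) by auto
  have "row u [v1, v2, v3, v4, v5, v6, v7] \<noteq> [1, 1, 1, 1, 1, 1, 1]"
    using not_complete_to_seven_cycle[OF ws(1) \<open>u \<in> V\<close>] by auto
  moreover have "distinct [v1, v2, v3, v4, v5, v6, v7, s, t, r, u]"
    using dist u uC irrefl by auto
  ultimately show False
    using common_outer_neighbour_third_neighbour[OF ws(1) sB rF tB _ r(3,4) nst sym[OF u(1)]] by blast
qed

text \<open>Otherwise take a component \<open>X\<close> of the outer vertices. Its attachments
  \<open>K\<close> all see the cycle, and if they form a clique, \<open>K\<close> separates
  \<open>X\<close> from the cycle.\<close>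

lemma seven_cycle_dominating:
  assumes cyc: "seven_cycle vs" and x: "x \<in> V" "x \<notin> set vs"
  shows "\<exists>v\<in>set vs. E x v"
proof (rule ccontr)
  assume none: "\<not> ?thesis"
  let ?C = "set vs"
  define R where "R = {r \<in> V. r \<notin> ?C \<and> (\<forall>v\<in>?C. \<not> E r v)}"
  define \<rho> where "\<rho> = {(p, q). p \<in> R \<and> q \<in> R \<and> E p q}"
  define X where "X = {r. (x, r) \<in> \<rho>\<^sup>*}"
  define K where "K = {s \<in> V - X. \<exists>r\<in>X. E s r}"
  have CV: "?C \<subseteq> V" by (rule seven_cycle_vertices[OF cyc])
  have Cne: "?C \<noteq> {}" using cyc by (auto simp: seven_cycle_def)
  have xR: "x \<in> R" using none x by (auto simp: R_def)
  have XR: "X \<subseteq> R"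
  proof
    fix r assume "r \<in> X"
    then have "(x, r) \<in> \<rho>\<^sup>*" by (simp add: X_def)
    then show "r \<in> R" by (induction rule: rtrancl_induct) (use xR in \<open>auto simp: \<rho>_def\<close>)
  qed
  have closed: "s \<in> X" if "r \<in> X" "s \<in> R" "E r s" for r s
    using that XR rtrancl_into_rtrancl[of x r \<rho> s] by (auto simp: X_def \<rho>_def)
  have conn_X: "E u q" if u: "r \<in> X" "E u r" "\<And>p q. p \<in> X \<Longrightarrow> q \<in> X \<Longrightarrow> E u p \<Longrightarrow> E p q \<Longrightarrow> E u q" and q: "q \<in> X"
    for u r q
  proof -
    have "sym \<rho>" using sym by (auto simp: \<rho>_def Relation.sym_def)
    then have "(r, x) \<in> \<rho>\<^sup>*" using u(1) sym_rtrancl symD unfolding X_def by fast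
    then have "(r, q) \<in> \<rho>\<^sup>*" using q by (simp add: X_def)
    then have "q \<in> X \<and> E u q"
    proof (induction rule: rtrancl_induct)
      case (step y z)
      then have "E y z" "z \<in> R" by (auto simp: \<rho>_def)
      then show ?case using step.IH closed[of y z] u(3)[of y z] by blast
    qed (use u in blast)
    then show ?thesis by blast
  qed
  have K: "s \<in> V \<and> s \<notin> ?C \<and> (\<exists>v\<in>?C. E s v)" if sK: "s \<in> K" for s
  proof -
    obtain r where r: "s \<in> V" "s \<notin> X" "r \<in> X" "E s r" using sK by (auto simp: K_def)
    then have "s \<notin> R" using closed[of r s] sym by blast
    moreover have "s \<notin> ?C" using r XR sym[OF r(4)] by (auto simp: R_def)
    ultimately show ?thesis using r by (auto simp: R_def)
  qed
  have "is_clique G K"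
    unfolding is_clique_def
  proof (intro conjI ballI impI)
    show "K \<subseteq> V" by (auto simp: K_def)
    fix s t assume st: "s \<in> K" "t \<in> K" "s \<noteq> t"
    obtain v w where s: "s \<in> V" "s \<notin> ?C" "v \<in> ?C" "E s v" and t: "t \<in> V" "t \<notin> ?C" "w \<in> ?C" "E t w"
      using K st by blast
    obtain rs rt where rs: "rs \<in> X" "E s rs" and rt: "rt \<in> X" "E t rt" using st by (auto simp: K_def)
    show "E s t"
    proof (cases "\<exists>r\<in>X. E s r \<and> E t r")
      case True
      then obtain r where "r \<in> X" "E r s" "E r t" using sym by blast
      then have "E t s" using XR by (intro common_outer_neighbour_adjacent[OF cyc s t \<open>s \<noteq> t\<close>, of r]) (auto simp: R_def)
      then show ?thesis by (rule sym)
    next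
      \<comment> \<open>Without a common neighbour in \<open>X\<close>, each of \<open>s\<close> and
        \<open>t\<close> misses a vertex of \<open>X\<close>. As \<open>X\<close> is connected, each
        starts an induced path with two further vertices in \<open>X\<close>: the one for
        \<open>s\<close> forces the quadruple type, and the one for \<open>t\<close> contradicts
        it.\<close>
      case False
      obtain p q where pq: "p \<in> X" "q \<in> X" "E s p" "E p q" "\<not> E s q"
      proof -
        have "\<not> (\<forall>p q. p \<in> X \<longrightarrow> q \<in> X \<longrightarrow> E s p \<longrightarrow> E p q \<longrightarrow> E s q)"
          using conn_X[OF rs _ rt(1)] False rt by meson
        then show thesis using that by blast
      qed
      obtain p' q' where pq': "p' \<in> X" "q' \<in> X" "E t p'" "E p' q'" "\<not> E t q'"
      proof -
        have "\<not> (\<forall>p q. p \<in> X \<longrightarrow> q \<in> X \<longrightarrow> E t p \<longrightarrow> E p q \<longrightarrow> E t q)"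
          using conn_X[OF rt _ rs(1)] False rs by meson
        then show thesis using that by blast
      qed
      obtain v1 v2 v3 v4 v5 v6 v7 where ws: "seven_cycle [v1, v2, v3, v4, v5, v6, v7]"
          "{v1, v2, v3, v4, v5, v6, v7} = set vs"
          "row s [v1, v2, v3, v4, v5, v6, v7] = [1, 0, 1, 1, 0, 1, 0]"
        by (rule outer_path_type[OF cyc s, of p q])
          (use pq XR commute[of p s] commute[of p q] commute[of q s] in \<open>auto simp: R_def\<close>)
      have F: "row p' [v1, v2, v3, v4, v5, v6, v7] = [0, 0, 0, 0, 0, 0, 0]"
        "row q' [v1, v2, v3, v4, v5, v6, v7] = [0, 0, 0, 0, 0, 0, 0]"
        using pq' XR ws(2) by (auto simp: R_def)
      have tF: "row t [v1, v2, v3, v4, v5, v6, v7] \<noteq> [0, 0, 0, 0, 0, 0, 0]"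
        using t(3,4) ws(2) by auto
      have d7: "distinct [v1, v2, v3, v4, v5, v6, v7]" using ws(1) by (simp add: seven_cycle_def)
      have "p' \<notin> ?C" "q' \<notin> ?C" "p' \<notin> K" "q' \<notin> K" "p' \<noteq> q'"
        using pq' XR irrefl by (auto simp: R_def K_def)
      then have "distinct [v1, v2, v3, v4, v5, v6, v7, s, t, p', q']"
        using d7 s(2) t(2) st ws(2) by auto
      then show ?thesis
        using quadruple_no_outer_path[OF ws(1) ws(3) F tF _ sym[OF pq'(3)] sym[OF pq'(4)]] pq'(5) commute by blast
    qed
  qed
  moreover have "clique_cutset G K" if "is_clique G K"
  proof (rule clique_cutsetI[OF conn that, of X "V - K - X"])
    have "X \<subseteq> V" using XR by (auto simp: R_def)
    then show "V - K = X \<union> (V - K - X)" by (auto simp: K_def)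
    show "X \<noteq> {}" by (auto simp: X_def)
    obtain v where v: "v \<in> ?C" using Cne by (metis ex_in_conv)
    then have "v \<in> V" "v \<notin> K" "v \<notin> X" using CV K[of v] XR by (auto simp: R_def)
    then show "V - K - X \<noteq> {}" by blast
    show "\<not> E p q" if "p \<in> X" "q \<in> V - K - X" for p q
      using that sym by (auto simp: K_def)
  qed auto
  ultimately show False using no_cutset by blast
qed

end

section \<open>Forcing the graph F\<close>

context forbidden_free_graph
begin

text \<open>The types with two consecutive neighbours on the cycle. They create a triangle and
  thereby raise the lower bound on degrees from three to four.\<close>

definition triangle_types :: "int list set" where
  "triangle_types = {[0, 0, 1, 0, 1, 1, 0], [1, 0, 1, 1, 0, 1, 0]}"

text \<open>\<open>a\<close> and \<open>v2\<close> have the same neighbours on the cycle. Since they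
  are not comparable, \<open>v2\<close> has a neighbour missed by \<open>a\<close>; this is
  \<open>x\<close>.\<close>

lemma private_neighbour_of_twin_type:
  assumes cyc: "seven_cycle [v1, v2, v3, v4, v5, v6, v7]"
    and p1: "row a [v1, v2, v3, v4, v5, v6, v7] = [1, 0, 1, 0, 0, 0, 0]"
    and new: "E x v2" "\<not> E x a"
    and not_all: "row x [v1, v2, v3, v4, v5, v6, v7] \<noteq> [1, 1, 1, 1, 1, 1, 1]"
    and dist: "distinct [v1, v2, v3, v4, v5, v6, v7, a, x]"
  shows "\<exists>ws. seven_cycle ws \<and> set ws = {v1, v2, v3, v4, v5, v6, v7} \<and> row x ws \<in> triangle_types"
proof (rule ccontr)
  assume no: "\<not> ?thesis"
  have no': "row x ws \<notin> triangle_types"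
    if "seven_cycle ws" "set ws = {v1, v2, v3, v4, v5, v6, v7}" for ws
    using no that by blast
  note types = seven_cycle_relabellings[OF cyc, of "\<lambda>ws. row x ws \<notin> triangle_types", OF no', simplified]
  note edges = seven_cycle_edges[OF cyc]
  note pats = p1[simplified] new
  note cm =
    commute_list[of a "[v1, v2, v3, v4, v5, v6, v7]", simplified]
    commute_list[of x "[v1, v2, v3, v4, v5, v6, v7, a]", simplified]
  note ne = dist[simplified] iffD2[OF distinct_rev dist, simplified]
  note forbidden =
    dia[of v2 x v1 v3 a] c5[of v1 v2 x v6 v7] dia[of v1 x v2 v7 v3] c5[of v1 v7 x v3 a] c5[of v2 v3 v4 v5 x]
      p7[of v6 v5 v4 x v2 v1 a] dia[of v5 x v4 v6 v3] p7[of v4 v5 v6 v7 v1 v2 x] dia[of v3 x v2 v4 v1]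
      c5[of v1 v7 v6 v5 x] p7[of v7 v6 v5 v4 v3 v2 x] p7[of v5 v4 v3 a v1 v7 x]
  show False
    using forbidden[simplified edges pats cm ne no_self simp_thms] not_all[simplified] types[unfolded triangle_types_def, simplified] new by argo
qed

text \<open>The vertex \<open>x\<close> is the fourth neighbour of \<open>v6\<close>. The first
  outcome copies \<open>v7\<close> on the cycle, the second is a mirrored triple, and only the
  third, a quadruple, will survive.\<close>

lemma triple_forces:
  assumes cyc: "seven_cycle [v1, v2, v3, v4, v5, v6, v7]"
    and p1: "row b [v1, v2, v3, v4, v5, v6, v7] = [0, 0, 1, 0, 1, 1, 0]"
    and new: "E x v6"
    and not_all: "row x [v1, v2, v3, v4, v5, v6, v7] \<noteq> [1, 1, 1, 1, 1, 1, 1]"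
    and dist: "distinct [v1, v2, v3, v4, v5, v6, v7, b, x]"
  shows "row x [v1, v2, v3, v4, v5, v6, v7, b] \<in> {[1, 0, 0, 0, 0, 1, 0, 0],
      [0, 0, 1, 1, 0, 1, 0, 0],
      [1, 0, 1, 1, 0, 1, 0, 0]}"
proof (rule ccontr)
  assume no: "\<not> ?thesis"
  note edges = seven_cycle_edges[OF cyc]
  note pats = p1[simplified] new
  note cm =
    commute_list[of b "[v1, v2, v3, v4, v5, v6, v7]", simplified]
    commute_list[of x "[v1, v2, v3, v4, v5, v6, v7, b]", simplified]
  note ne = dist[simplified] iffD2[OF distinct_rev dist, simplified]
  note forbidden =
    dia[of v6 b v5 x v4] dia[of v5 v6 b x v3] dia[of v6 x v7 b v1] c5[of v3 v4 x v6 b] dia[of v5 x v6 v4 v7]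
      c5[of v3 v4 v5 v6 x] dia[of b x v3 v6 v4] dia[of v7 x v1 v6 v2] c5[of v2 v3 b v6 x]
      dia[of v3 x v4 v2 v5] c5[of v2 v3 v4 v5 x] p7[of v1 v2 v3 v4 v5 v6 x] dia[of v6 x b v7 v3]
      c5[of v1 v2 v3 x v7] c5[of v1 v2 v3 b x] p7[of v4 v3 v2 v1 v7 v6 x]
  show False
    using forbidden[simplified edges pats cm ne no_self simp_thms] not_all[simplified] new no[simplified] by argo
qed

lemma triple_with_twin_impossible:
  assumes cyc: "seven_cycle [v1, v2, v3, v4, v5, v6, v7]"
    and p1: "row b [v1, v2, v3, v4, v5, v6, v7] = [0, 0, 1, 0, 1, 1, 0]"
    and p2: "row a [v1, v2, v3, v4, v5, v6, v7, b] = [1, 0, 0, 0, 0, 1, 0, 0]"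
    and new: "E x v7" "\<not> E x a"
    and not_all: "row x [v1, v2, v3, v4, v5, v6, v7] \<noteq> [1, 1, 1, 1, 1, 1, 1]"
    and dist: "distinct [v1, v2, v3, v4, v5, v6, v7, b, a, x]"
  shows False
proof -
  note edges = seven_cycle_edges[OF cyc]
  note pats = p1[simplified] p2[simplified] new
  note cm =
    commute_list[of b "[v1, v2, v3, v4, v5, v6, v7]", simplified]
    commute_list[of a "[v1, v2, v3, v4, v5, v6, v7, b]", simplified]
    commute_list[of x "[v1, v2, v3, v4, v5, v6, v7, b, a]", simplified]
  note ne = dist[simplified] iffD2[OF distinct_rev dist, simplified]
  note forbidden =
    dia[of v7 x v1 v6 a] dia[of v6 x v7 b v1] dia[of v5 b v6 x v7] c5[of v4 v5 v6 v7 x] c5[of v3 b v6 v7 x]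
      dia[of v5 v6 b x v3] p7[of v4 v3 v2 x v7 v6 a] c5[of v1 v2 x v6 a] p7[of v2 v3 v4 v5 v6 v7 x]
      c5[of v1 v2 v3 x v7] c5[of v1 a v6 v5 x] p7[of v3 b v5 x v7 v1 a] dia[of v3 x b v2 v5]
      p7[of v5 b v3 v2 v1 v7 x] c5[of v1 a v6 b x]
  show False
    using forbidden[simplified edges pats cm ne no_self simp_thms] not_all[simplified] new by argo
qed

text \<open>The contradiction needs a fourth neighbour \<open>x\<close> of \<open>b\<close>, which
  the degree bound provides.\<close>

lemma two_triples_impossible:
  assumes cyc: "seven_cycle [v1, v2, v3, v4, v5, v6, v7]"
    and p1: "row b [v1, v2, v3, v4, v5, v6, v7] = [0, 0, 1, 0, 1, 1, 0]"
    and p2: "row a [v1, v2, v3, v4, v5, v6, v7, b] = [0, 0, 1, 1, 0, 1, 0, 0]"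
    and new: "E x b"
    and not_all: "row x [v1, v2, v3, v4, v5, v6, v7] \<noteq> [1, 1, 1, 1, 1, 1, 1]"
    and not_none: "row x [v1, v2, v3, v4, v5, v6, v7] \<noteq> [0, 0, 0, 0, 0, 0, 0]"
    and dist: "distinct [v1, v2, v3, v4, v5, v6, v7, b, a, x]"
  shows False
proof -
  note edges = seven_cycle_edges[OF cyc]
  note pats = p1[simplified] p2[simplified] new
  note cm =
    commute_list[of b "[v1, v2, v3, v4, v5, v6, v7]", simplified]
    commute_list[of a "[v1, v2, v3, v4, v5, v6, v7, b]", simplified]
    commute_list[of x "[v1, v2, v3, v4, v5, v6, v7, b, a]", simplified]
  note ne = dist[simplified] iffD2[OF distinct_rev dist, simplified]
  note forbidden =
    dia[of v6 b v5 x v4] dia[of v5 b v6 x v7] dia[of v6 x b a v3] c5[of v4 a v6 b x] dia[of v3 a v4 x v5]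
      dia[of v5 x v4 b a] c5[of v1 v7 v6 b x] dia[of v6 x v5 v7 v4] c5[of v4 v5 v6 v7 x]
      dia[of b x v6 v3 v7] c5[of v4 v5 b x a] c5[of v3 a v6 v7 x] dia[of v3 x v2 b v1] dia[of v4 a v3 x v2]
      dia[of b x v3 v6 v2] c5[of v2 v3 a v6 x] c5[of v1 v2 v3 b x] p7[of v1 v7 x b v5 v4 a]
      p7[of v5 v6 v7 v1 v2 v3 x] dia[of v1 x v2 v7 v3] p7[of v4 v3 v2 v1 v7 v6 x] p7[of v1 v2 x b v5 v4 a]
  show False
    using forbidden[simplified edges pats cm ne no_self simp_thms] not_all[simplified] new not_none[simplified] by argo
qed

text \<open>The vertex \<open>x\<close> is the fourth neighbour of \<open>v3\<close>. It either
  copies \<open>v2\<close> on the cycle, which non-comparability excludes later, or is the vertex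
  \<open>b3\<close> of \<open>F\<close>.\<close>

lemma quadruple_forces:
  assumes cyc: "seven_cycle [v1, v2, v3, v4, v5, v6, v7]"
    and p1: "row d1 [v1, v2, v3, v4, v5, v6, v7] = [1, 0, 1, 1, 0, 1, 0]"
    and new: "E x v3"
    and not_all: "row x [v1, v2, v3, v4, v5, v6, v7] \<noteq> [1, 1, 1, 1, 1, 1, 1]"
    and dist: "distinct [v1, v2, v3, v4, v5, v6, v7, d1, x]"
  shows "row x [v1, v2, v3, v4, v5, v6, v7, d1] \<in> {[1, 0, 1, 0, 0, 0, 0, 0],
      [0, 0, 1, 0, 1, 1, 0, 0]}"
proof (rule ccontr)
  assume no: "\<not> ?thesis"
  note edges = seven_cycle_edges[OF cyc]
  note pats = p1[simplified] new
  note cm =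
    commute_list[of d1 "[v1, v2, v3, v4, v5, v6, v7]", simplified]
    commute_list[of x "[v1, v2, v3, v4, v5, v6, v7, d1]", simplified]
  note ne = dist[simplified] iffD2[OF distinct_rev dist, simplified]
  note forbidden =
    dia[of v3 d1 v4 x v5] dia[of v3 v4 d1 x v1] c5[of v1 v2 v3 x v7] dia[of d1 x v6 v3 v7]
      dia[of v3 x d1 v2 v6] c5[of v1 d1 v4 v5 x] c5[of v3 v4 v5 v6 x] dia[of d1 x v1 v3 v2]
      c5[of v3 d1 v6 v7 x] dia[of d1 x v6 v3 v5] c5[of v3 d1 v6 v5 x] dia[of v6 x v7 v5 v1]
      p7[of v1 v7 v6 v5 v4 v3 x] dia[of v4 x v3 v5 v2] c5[of v1 v2 x v6 v7] dia[of v2 x v1 v3 v7]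
      p7[of v5 v6 v7 v1 v2 v3 x]
  show False
    using forbidden[simplified edges pats cm ne no_self simp_thms] not_all[simplified] new no[simplified] by argo
qed

lemma quadruple_with_twin_impossible:
  assumes cyc: "seven_cycle [v1, v2, v3, v4, v5, v6, v7]"
    and p1: "row d1 [v1, v2, v3, v4, v5, v6, v7] = [1, 0, 1, 1, 0, 1, 0]"
    and p2: "row a [v1, v2, v3, v4, v5, v6, v7, d1] = [1, 0, 1, 0, 0, 0, 0, 0]"
    and new: "E x v2" "\<not> E x a"
    and not_all: "row x [v1, v2, v3, v4, v5, v6, v7] \<noteq> [1, 1, 1, 1, 1, 1, 1]"
    and dist: "distinct [v1, v2, v3, v4, v5, v6, v7, d1, a, x]"
  shows False
proof -
  note edges = seven_cycle_edges[OF cyc]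
  note pats = p1[simplified] p2[simplified] new
  note cm =
    commute_list[of d1 "[v1, v2, v3, v4, v5, v6, v7]", simplified]
    commute_list[of a "[v1, v2, v3, v4, v5, v6, v7, d1]", simplified]
    commute_list[of x "[v1, v2, v3, v4, v5, v6, v7, d1, a]", simplified]
  note ne = dist[simplified] iffD2[OF distinct_rev dist, simplified]
  note forbidden =
    dia[of v2 x v1 v3 a] c5[of v1 v2 x v6 v7] c5[of v1 v7 x v3 a] dia[of v1 x v2 d1 v3] c5[of v2 v3 d1 v6 x]
      c5[of v2 v3 v4 v5 x] c5[of v1 v2 x v4 d1] dia[of v4 d1 v3 x v2] dia[of v3 x v2 d1 v1]
      c5[of v1 a v3 v4 x] p7[of v4 v5 v6 v7 v1 v2 x] p7[of v5 v4 v3 a v1 v7 x] p7[of v6 v5 v4 v3 a v1 x]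
      c5[of v3 d1 v6 v5 x]
  show False
    using forbidden[simplified edges pats cm ne no_self simp_thms] not_all[simplified] new by argo
qed

text \<open>The reflection exchanging \<open>v3\<close> and \<open>v4\<close> preserves the
  neighbours of \<open>d1\<close> and carries those of \<open>b3\<close> on the cycle to those of
  \<open>b1\<close>. A mirrored search for a neighbour of \<open>v4\<close> thus has a unique
  outcome once \<open>b3\<close> is present.\<close>

lemma b3_forces_b1:
  assumes cyc: "seven_cycle [v1, v2, v3, v4, v5, v6, v7]"
    and p1: "row d1 [v1, v2, v3, v4, v5, v6, v7] = [1, 0, 1, 1, 0, 1, 0]"
    and p2: "row b3 [v1, v2, v3, v4, v5, v6, v7, d1] = [0, 0, 1, 0, 1, 1, 0, 0]"
    and new: "E x v4"
    and not_all: "row x [v1, v2, v3, v4, v5, v6, v7] \<noteq> [1, 1, 1, 1, 1, 1, 1]"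
    and dist: "distinct [v1, v2, v3, v4, v5, v6, v7, d1, b3, x]"
  shows "row x [v1, v2, v3, v4, v5, v6, v7, d1, b3] \<in> {[1, 1, 0, 1, 0, 0, 0, 0, 0]}"
proof (rule ccontr)
  assume no: "\<not> ?thesis"
  note edges = seven_cycle_edges[OF cyc]
  note pats = p1[simplified] p2[simplified] new
  note cm =
    commute_list[of d1 "[v1, v2, v3, v4, v5, v6, v7]", simplified]
    commute_list[of b3 "[v1, v2, v3, v4, v5, v6, v7, d1]", simplified]
    commute_list[of x "[v1, v2, v3, v4, v5, v6, v7, d1, b3]", simplified]
  note ne = dist[simplified] iffD2[OF distinct_rev dist, simplified]
  note forbidden =
    dia[of v4 d1 v3 x v2] dia[of v3 v4 d1 x v1] c5[of v4 d1 v6 b3 x] c5[of v3 v4 x v6 b3]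
      dia[of v6 b3 v5 x v4] dia[of v4 x v5 d1 v6] dia[of d1 x v6 v4 b3] c5[of v4 v5 v6 v7 x]
      dia[of v5 x v4 b3 v3] dia[of v3 x d1 b3 v1] dia[of d1 x v1 v4 v7] c5[of v4 d1 v6 v7 x]
      p7[of v1 v7 v6 b3 v3 v4 x] c5[of v1 v2 v3 v4 x] dia[of b3 x v3 v6 v2] c5[of v2 v3 b3 v5 x]
      dia[of v3 x v2 v4 v1] p7[of v2 v1 v7 v6 v5 v4 x]
  show False
    using forbidden[simplified edges pats cm ne no_self simp_thms] not_all[simplified] new no[simplified] by argo
qed

lemma b1_forces_a7:
  assumes cyc: "seven_cycle [v1, v2, v3, v4, v5, v6, v7]"
    and p1: "row d1 [v1, v2, v3, v4, v5, v6, v7] = [1, 0, 1, 1, 0, 1, 0]"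
    and p2: "row b3 [v1, v2, v3, v4, v5, v6, v7, d1] = [0, 0, 1, 0, 1, 1, 0, 0]"
    and p3: "row b1 [v1, v2, v3, v4, v5, v6, v7, d1, b3] = [1, 1, 0, 1, 0, 0, 0, 0, 0]"
    and new: "E x v2"
    and not_all: "row x [v1, v2, v3, v4, v5, v6, v7] \<noteq> [1, 1, 1, 1, 1, 1, 1]"
    and dist: "distinct [v1, v2, v3, v4, v5, v6, v7, d1, b3, b1, x]"
  shows "row x [v1, v2, v3, v4, v5, v6, v7, d1, b3, b1] \<in> {[0, 1, 0, 0, 0, 0, 1, 0, 1, 0]}"
proof (rule ccontr)
  assume no: "\<not> ?thesis"
  note edges = seven_cycle_edges[OF cyc]
  note pats = p1[simplified] p2[simplified] p3[simplified] new
  note cm =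
    commute_list[of d1 "[v1, v2, v3, v4, v5, v6, v7]", simplified]
    commute_list[of b3 "[v1, v2, v3, v4, v5, v6, v7, d1]", simplified]
    commute_list[of b1 "[v1, v2, v3, v4, v5, v6, v7, d1, b3]", simplified]
    commute_list[of x "[v1, v2, v3, v4, v5, v6, v7, d1, b3, b1]", simplified]
  note ne = dist[simplified] iffD2[OF distinct_rev dist, simplified]
  note forbidden =
    dia[of v2 b1 v1 x v7] dia[of v1 v2 b1 x v4] c5[of v2 b1 v4 d1 x] c5[of v1 v2 x v6 d1]
      dia[of b1 x v2 v4 v3] dia[of v2 x v3 b1 v4] dia[of v3 x v4 v2 v5] c5[of v2 v3 v4 v5 x]
      c5[of v1 v7 x v4 b1] dia[of v4 x v5 v3 v6] c5[of v3 v4 b1 x b3] dia[of v4 d1 v3 x v2]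
      dia[of v5 x v6 v4 v7] p7[of v7 v6 d1 v4 b1 v2 x] c5[of v2 v3 b3 v6 x] c5[of v1 v2 x v4 d1]
      c5[of v1 v7 x v3 d1] dia[of v1 x v2 d1 v3] dia[of v1 x v2 v7 v3] p7[of v7 v6 v5 v4 v3 v2 x]
      p7[of b3 v5 v4 d1 v1 v2 x]
  show False
    using forbidden[simplified edges pats cm ne no_self simp_thms] not_all[simplified] new no[simplified] by argo
qed

text \<open>\<open>a5\<close> is the mirror image of \<open>a7\<close> under the reflection that
  exchanges \<open>b3\<close> and \<open>b1\<close>.\<close>

lemma a7_forces_a5:
  assumes cyc: "seven_cycle [v1, v2, v3, v4, v5, v6, v7]"
    and p1: "row d1 [v1, v2, v3, v4, v5, v6, v7] = [1, 0, 1, 1, 0, 1, 0]"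
    and p2: "row b3 [v1, v2, v3, v4, v5, v6, v7, d1] = [0, 0, 1, 0, 1, 1, 0, 0]"
    and p3: "row b1 [v1, v2, v3, v4, v5, v6, v7, d1, b3] = [1, 1, 0, 1, 0, 0, 0, 0, 0]"
    and p4: "row a7 [v1, v2, v3, v4, v5, v6, v7, d1, b3, b1] = [0, 1, 0, 0, 0, 0, 1, 0, 1, 0]"
    and new: "E x v5"
    and not_all: "row x [v1, v2, v3, v4, v5, v6, v7] \<noteq> [1, 1, 1, 1, 1, 1, 1]"
    and dist: "distinct [v1, v2, v3, v4, v5, v6, v7, d1, b3, b1, a7, x]"
  shows "row x [v1, v2, v3, v4, v5, v6, v7, d1, b3, b1, a7] \<in> {[0, 0, 0, 0, 1, 0, 1, 0, 0, 1, 1]}"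
proof (rule ccontr)
  assume no: "\<not> ?thesis"
  note edges = seven_cycle_edges[OF cyc]
  note pats = p1[simplified] p2[simplified] p3[simplified] p4[simplified] new
  note cm =
    commute_list[of d1 "[v1, v2, v3, v4, v5, v6, v7]", simplified]
    commute_list[of b3 "[v1, v2, v3, v4, v5, v6, v7, d1]", simplified]
    commute_list[of b1 "[v1, v2, v3, v4, v5, v6, v7, d1, b3]", simplified]
    commute_list[of a7 "[v1, v2, v3, v4, v5, v6, v7, d1, b3, b1]", simplified]
    commute_list[of x "[v1, v2, v3, v4, v5, v6, v7, d1, b3, b1, a7]", simplified]
  note ne = dist[simplified] iffD2[OF distinct_rev dist, simplified]
  note forbidden =
    dia[of v5 b3 v6 x v7] dia[of v5 v6 b3 x v3] c5[of v5 v6 v7 a7 x] dia[of b3 x v5 a7 v4]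
      c5[of v5 b3 a7 v7 x] dia[of v5 x v4 b3 v3] dia[of b3 x v3 v5 v2] c5[of v3 d1 x v5 b3]
      c5[of v3 d1 v6 v5 x] dia[of v6 x b3 d1 a7] dia[of b3 x v3 v5 d1] c5[of v6 d1 x a7 b3]
      c5[of v2 v3 v4 v5 x] c5[of v1 v7 v6 v5 x] c5[of v3 v4 x a7 b3] dia[of v4 x d1 v5 v1]
      c5[of v1 d1 v4 v5 x] p7[of v7 v1 d1 v3 b3 v5 x] dia[of v3 d1 v4 x v5] p7[of a7 v2 v1 d1 v4 v5 x]
      dia[of b3 x a7 v5 v7] p7[of b1 v1 d1 v3 b3 v5 x]
  show False
    using forbidden[simplified edges pats cm ne no_self simp_thms] not_all[simplified] new no[simplified] by argo
qed

lemma no_vertex_outside_F: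
  assumes cyc: "seven_cycle [v1, v2, v3, v4, v5, v6, v7]"
    and p1: "row d1 [v1, v2, v3, v4, v5, v6, v7] = [1, 0, 1, 1, 0, 1, 0]"
    and p2: "row b3 [v1, v2, v3, v4, v5, v6, v7, d1] = [0, 0, 1, 0, 1, 1, 0, 0]"
    and p3: "row b1 [v1, v2, v3, v4, v5, v6, v7, d1, b3] = [1, 1, 0, 1, 0, 0, 0, 0, 0]"
    and p4: "row a7 [v1, v2, v3, v4, v5, v6, v7, d1, b3, b1] = [0, 1, 0, 0, 0, 0, 1, 0, 1, 0]"
    and p5: "row a5 [v1, v2, v3, v4, v5, v6, v7, d1, b3, b1, a7] = [0, 0, 0, 0, 1, 0, 1, 0, 0, 1, 1]"
    and not_all: "row x [v1, v2, v3, v4, v5, v6, v7] \<noteq> [1, 1, 1, 1, 1, 1, 1]"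
    and not_none: "row x [v1, v2, v3, v4, v5, v6, v7] \<noteq> [0, 0, 0, 0, 0, 0, 0]"
    and dist: "distinct [v1, v2, v3, v4, v5, v6, v7, d1, b3, b1, a7, a5, x]"
  shows False
proof -
  note edges = seven_cycle_edges[OF cyc]
  note pats = p1[simplified] p2[simplified] p3[simplified] p4[simplified] p5[simplified]
  note cm =
    commute_list[of d1 "[v1, v2, v3, v4, v5, v6, v7]", simplified]
    commute_list[of b3 "[v1, v2, v3, v4, v5, v6, v7, d1]", simplified]
    commute_list[of b1 "[v1, v2, v3, v4, v5, v6, v7, d1, b3]", simplified]
    commute_list[of a7 "[v1, v2, v3, v4, v5, v6, v7, d1, b3, b1]", simplified]
    commute_list[of a5 "[v1, v2, v3, v4, v5, v6, v7, d1, b3, b1, a7]", simplified]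
    commute_list[of x "[v1, v2, v3, v4, v5, v6, v7, d1, b3, b1, a7, a5]", simplified]
  note ne = dist[simplified] iffD2[OF distinct_rev dist, simplified]
  note forbidden =
    dia[of v6 b3 v5 x v4] dia[of v5 b3 v6 x v7] dia[of v5 v6 b3 x v3] dia[of v4 d1 v3 x v2]
      dia[of v3 d1 v4 x v5] dia[of v3 v4 d1 x v1] dia[of v2 b1 v1 x v7] dia[of v1 b1 v2 x v3]
      dia[of v1 v2 b1 x v4] dia[of v7 a5 a7 x v2] dia[of v7 a7 a5 x v5] dia[of a7 a5 v7 x v1]
      c5[of v4 d1 v6 x b1] c5[of v2 b1 v4 x a7] c5[of v3 b3 v6 v7 x] c5[of v1 v7 a7 b3 x]
      c5[of v2 v3 v4 v5 x] c5[of v3 b3 a7 a5 x] c5[of v2 v3 d1 x a7] dia[of v3 x d1 b3 v1]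
      c5[of v1 v7 x v4 d1] c5[of v2 v3 b3 v6 x] p7[of v1 v7 a5 v5 b3 v3 x] p7[of v7 v6 v5 v4 v3 v2 x]
      c5[of v5 b3 x v7 a5] p7[of v3 v2 a7 v7 v6 v5 x] p7[of v6 d1 v4 b1 v2 a7 x] p7[of a7 v2 b1 v4 d1 v6 x]
      dia[of a7 x a5 v2 v5] dia[of b1 x v1 v4 v7] p7[of v2 a7 b3 v5 v4 d1 x] dia[of b3 x v6 a7 d1]
      p7[of a5 a7 b3 v6 d1 v1 x] p7[of v1 v7 v6 b3 v3 v4 x] p7[of d1 v1 v7 a5 v5 b3 x] dia[of v6 x v7 d1 a7]
      c5[of v3 v4 x v6 b3] dia[of v5 x v4 b3 v3] p7[of b1 a5 v7 v6 b3 v3 x] p7[of b3 v5 v4 d1 v1 v7 x]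
      c5[of v6 v7 a5 x b3] c5[of v5 b3 a7 v7 x] p7[of v4 v3 v2 v1 v7 v6 x] dia[of a5 x v7 b1 v1]
      c5[of v5 v6 v7 a7 x] dia[of b3 x v3 v6 v4] dia[of v7 x v1 a5 d1] c5[of v5 v6 x a7 a5]
      dia[of v2 x b1 a7 v4] c5[of v1 v2 a7 a5 x] dia[of v4 x d1 b1 v1] dia[of d1 x v4 v6 v5]
      c5[of v1 d1 v3 x b1] c5[of v2 b1 v4 d1 x] dia[of v1 x d1 b1 v3]
  show False
    using forbidden[simplified edges pats cm ne no_self simp_thms] not_all[simplified] not_none[simplified] by argo
qed

end

section \<open>Supplying the vertices of F from degrees and non-comparability\<close>

context extremal_graph
begin

lemma not_all_adjacent:
  "seven_cycle [v1, v2, v3, v4, v5, v6, v7] \<Longrightarrow> x \<in> V \<Longrightarrow>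
    row x [v1, v2, v3, v4, v5, v6, v7] \<noteq> [1, 1, 1, 1, 1, 1, 1]"
  using not_complete_to_seven_cycle[of "[v1, v2, v3, v4, v5, v6, v7]" x] by auto

lemma triangle_is_clique: "E a b \<Longrightarrow> E b c \<Longrightarrow> E a c \<Longrightarrow> is_clique G {a, b, c}"
  unfolding is_clique_def using sym adj_vertices by blast

lemma triangle_type_exists:
  assumes cyc: "seven_cycle vs"
  obtains ws s where "seven_cycle ws" "s \<in> V" "s \<notin> set ws" "row s ws \<in> triangle_types"
proof -
  obtain v1 v2 v3 v4 v5 v6 v7 where vs: "vs = [v1, v2, v3, v4, v5, v6, v7]"
    using seven_cycle_list[OF cyc] .
  note e = seven_cycle_edges[OF cyc[unfolded vs]]
  have d: "distinct [v1, v2, v3, v4, v5, v6, v7]" using cyc vs by (simp add: seven_cycle_def)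
  have "is_clique G {v1, v2}" "v1 \<in> V"
    using e adj_vertices by (auto simp: is_clique_def)
  then obtain x where x: "E v1 x" "x \<notin> {v2, v7}"
    using degree_neighbour[OF deg, of v1 "{v1, v2}" "{v2, v7}"] d by auto
  have xV: "x \<in> V" using x adj_vertices by blast
  have xC: "x \<notin> set vs" using x e irrefl vs by auto
  have xv: "E x v1" "v1 \<in> set vs" using x vs by (auto intro: sym)
  obtain w1 w2 w3 w4 w5 w6 w7 where ws: "seven_cycle [w1, w2, w3, w4, w5, w6, w7]"
    "{w1, w2, w3, w4, w5, w6, w7} = set vs"
    "row x [w1, w2, w3, w4, w5, w6, w7] \<in> {[1, 0, 1, 0, 0, 0, 0],
      [0, 0, 1, 0, 1, 1, 0], [1, 0, 1, 1, 0, 1, 0]}"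
    using attached_vertex_type[OF cyc xV xC xv(2,1)] by blast
  show thesis
  proof (cases "row x [w1, w2, w3, w4, w5, w6, w7] = [1, 0, 1, 0, 0, 0, 0]")
    case False
    then have "row x [w1, w2, w3, w4, w5, w6, w7] \<in> triangle_types"
      using ws(3) unfolding triangle_types_def by (metis insert_iff)
    moreover have "x \<notin> set [w1, w2, w3, w4, w5, w6, w7]" using xC ws(2) by auto
    ultimately show thesis using that[OF ws(1) xV] by blast
  next
    \<comment> \<open>\<open>x\<close> copies \<open>w2\<close> on the cycle, so a neighbour of
      \<open>w2\<close> missed by \<open>x\<close> has to be brought in.\<close>
    case True
    note p = True[simplified]
    note e' = seven_cycle_edges[OF ws(1)]
    have "w2 \<in> V" "w2 \<noteq> x" using e' adj_vertices xC ws(2) by auto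
    then obtain y where y: "E w2 y" "\<not> E x y"
      using private_neighbour[of w2 x] xV p commute[of w2 x] by auto
    have yV: "y \<in> V" using y adj_vertices by blast
    have yC: "y \<notin> {w1, w2, w3, w4, w5, w6, w7}" using y p e' irrefl by auto
    have "distinct [w1, w2, w3, w4, w5, w6, w7]" using ws(1) by (simp add: seven_cycle_def)
    moreover have "x \<notin> {w1, w2, w3, w4, w5, w6, w7}" using xC ws(2) by simp
    moreover have "x \<noteq> y" using y p commute by auto
    ultimately have "distinct [w1, w2, w3, w4, w5, w6, w7, x, y]" using yC by auto
    then obtain us where us: "seven_cycle us" "set us = {w1, w2, w3, w4, w5, w6, w7}" "row y us \<in> triangle_types"
      using private_neighbour_of_twin_type[OF ws(1) True sym[OF y(1)] _ not_all_adjacent[OF ws(1) yV]] y(2) commute by blast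
    then show thesis using that[OF us(1) yV] yC by auto
  qed
qed

lemma quadruple_exists:
  assumes cyc: "seven_cycle vs"
  obtains v1 v2 v3 v4 v5 v6 v7 d where "seven_cycle [v1, v2, v3, v4, v5, v6, v7]"
    "distinct [v1, v2, v3, v4, v5, v6, v7, d]"
    "row d [v1, v2, v3, v4, v5, v6, v7] = [1, 0, 1, 1, 0, 1, 0]"
proof -
  obtain ws b where ws: "seven_cycle ws" "b \<in> V" "b \<notin> set ws" "row b ws \<in> triangle_types"
    using triangle_type_exists[OF cyc] by blast
  obtain v1 v2 v3 v4 v5 v6 v7 where vs: "ws = [v1, v2, v3, v4, v5, v6, v7]"
    using seven_cycle_list[OF ws(1)] .
  note cyc = ws(1)[unfolded vs]
  note e = seven_cycle_edges[OF cyc]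
  have d: "distinct [v1, v2, v3, v4, v5, v6, v7, b]" using cyc ws(3) vs by (auto simp: seven_cycle_def)
  show thesis
  proof (cases "row b [v1, v2, v3, v4, v5, v6, v7] = [1, 0, 1, 1, 0, 1, 0]")
    case True
    then show thesis by (rule that[OF cyc d])
  next
    case False
    then have b: "row b [v1, v2, v3, v4, v5, v6, v7] = [0, 0, 1, 0, 1, 1, 0]"
      using ws(4) unfolding vs triangle_types_def by (metis insertE singletonD)
    note b' = b[simplified]
    have clq: "is_clique G {v5, v6, b}"
      using e b' commute[of v5 b] commute[of v6 b] by (intro triangle_is_clique) auto
    have V: "v6 \<in> V" "v7 \<in> V" "b \<in> V" using e adj_vertices ws(2) by auto
    \<comment> \<open>The triangle \<open>v5 v6 b\<close> makes every degree at least four.\<close>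
    obtain x where x: "E v6 x" "x \<notin> {v5, v7, b}"
      by (rule degree_neighbour[OF deg V(1) clq, of "{v5, v7, b}"]) (use d in auto)
    have xV: "x \<in> V" using x adj_vertices by blast
    have dx: "distinct [v1, v2, v3, v4, v5, v6, v7, b, x]" using d x e irrefl by auto
    have x': "E x v6" using x sym by blast
    have types: "row x [v1, v2, v3, v4, v5, v6, v7, b] \<in>
      {[1, 0, 0, 0, 0, 1, 0, 0], [0, 0, 1, 1, 0, 1, 0, 0],
       [1, 0, 1, 1, 0, 1, 0, 0]}"
      by (rule triple_forces[OF cyc b x' not_all_adjacent[OF cyc xV] dx])
    consider (A) "row x [v1, v2, v3, v4, v5, v6, v7, b] = [1, 0, 0, 0, 0, 1, 0, 0]"
      | (B) "row x [v1, v2, v3, v4, v5, v6, v7, b] = [0, 0, 1, 1, 0, 1, 0, 0]"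
      | (D) "row x [v1, v2, v3, v4, v5, v6, v7, b] = [1, 0, 1, 1, 0, 1, 0, 0]"
      using types by (metis insertE singletonD)
    then show thesis
    proof cases
      case A
      note A' = A[simplified]
      obtain y where y: "E v7 y" "\<not> E x y"
        by (rule private_neighbour[OF V(2) xV]) (use dx A' commute[of v7 x] in auto)
      have yV: "y \<in> V" using y adj_vertices by blast
      have yn: "E y v7" "\<not> E y x" using y commute by auto
      have "distinct [v1, v2, v3, v4, v5, v6, v7, b, x, y]"
        using dx y e A' b' irrefl commute[of v7 b] commute[of v7 x] by auto
      then show thesis using triple_with_twin_impossible[OF cyc b A yn not_all_adjacent[OF cyc yV]] by blast
    next
      case B
      note B' = B[simplified]
      obtain y where y: "E b y" "y \<notin> {v3, v5, v6}"
        by (rule degree_neighbour[OF deg V(3) clq, of "{v3, v5, v6}"]) (use d in auto)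
      have yV: "y \<in> V" using y adj_vertices by blast
      have yn: "E y b" using y sym by blast
      have "distinct [v1, v2, v3, v4, v5, v6, v7, b, x, y]"
        using dx y B' b' irrefl commute[of b x] by auto
      moreover have "row y [v1, v2, v3, v4, v5, v6, v7] \<noteq> [0, 0, 0, 0, 0, 0, 0]"
      proof -
        have "y \<notin> set [v1, v2, v3, v4, v5, v6, v7]" using calculation by auto
        then show ?thesis using seven_cycle_dominating[OF cyc yV] by auto
      qed
      ultimately show thesis using two_triples_impossible[OF cyc b B yn not_all_adjacent[OF cyc yV]] by blast
    next
      case D
      have dist: "distinct [v1, v2, v3, v4, v5, v6, v7, x]" using dx by auto
      have "row x [v1, v2, v3, v4, v5, v6, v7] = [1, 0, 1, 1, 0, 1, 0]" using D by simp
      then show thesis by (rule that[OF cyc dist])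
    qed
  qed
qed

lemma graph_iso_F:
  assumes "seven_cycle vs"
  shows "graph_iso G graph_F"
proof -
  obtain v1 v2 v3 v4 v5 v6 v7 d1 where cyc: "seven_cycle [v1, v2, v3, v4, v5, v6, v7]"
    and dist: "distinct [v1, v2, v3, v4, v5, v6, v7, d1]"
    and d1: "row d1 [v1, v2, v3, v4, v5, v6, v7] = [1, 0, 1, 1, 0, 1, 0]"
    using quadruple_exists[OF assms] .
  note e = seven_cycle_edges[OF cyc]
  have V: "v2 \<in> V" "v3 \<in> V" "v4 \<in> V" "v5 \<in> V" using e adj_vertices by auto
  have clq: "is_clique G {v3, v4, d1}"
    using e d1[simplified] commute[of v3 d1] commute[of v4 d1] by (intro triangle_is_clique) auto
  obtain b3 where b3: "E v3 b3" "b3 \<notin> {v2, v4, d1}"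
    by (rule degree_neighbour[OF deg V(2) clq, of "{v2, v4, d1}"]) (use dist in auto)
  have b3V: "b3 \<in> V" using b3 adj_vertices by blast
  have dist_b3: "distinct [v1, v2, v3, v4, v5, v6, v7, d1, b3]" using dist b3 e irrefl by auto
  have "row b3 [v1, v2, v3, v4, v5, v6, v7, d1] \<in> {[1, 0, 1, 0, 0, 0, 0, 0],
      [0, 0, 1, 0, 1, 1, 0, 0]}"
    by (rule quadruple_forces[OF cyc d1 sym[OF b3(1)] not_all_adjacent[OF cyc b3V] dist_b3])
  moreover have "row b3 [v1, v2, v3, v4, v5, v6, v7, d1] \<noteq> [1, 0, 1, 0, 0, 0, 0, 0]"
  proof
    assume A: "row b3 [v1, v2, v3, v4, v5, v6, v7, d1] = [1, 0, 1, 0, 0, 0, 0, 0]"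
    note A' = A[simplified]
    obtain y where y: "E v2 y" "\<not> E b3 y"
      by (rule private_neighbour[OF V(1) b3V]) (use dist_b3 A' commute[of v2 b3] in auto)
    have yV: "y \<in> V" using y adj_vertices by blast
    have yn: "E y v2" "\<not> E y b3" using y commute by auto
    have "distinct [v1, v2, v3, v4, v5, v6, v7, d1, b3, y]"
      using dist_b3 y e A' d1[simplified] irrefl commute[of v2 d1] commute[of v2 b3] by auto
    then show False using quadruple_with_twin_impossible[OF cyc d1 A yn not_all_adjacent[OF cyc yV]] by blast
  qed
  ultimately have p_b3: "row b3 [v1, v2, v3, v4, v5, v6, v7, d1] = [0, 0, 1, 0, 1, 1, 0, 0]"
    by (metis insertE singletonD)
  obtain b1 where b1: "E v4 b1" "b1 \<notin> {v3, v5, d1}"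
    by (rule degree_neighbour[OF deg V(3) clq, of "{v3, v5, d1}"]) (use dist in auto)
  have b1V: "b1 \<in> V" using b1 adj_vertices by blast
  have dist_b1: "distinct [v1, v2, v3, v4, v5, v6, v7, d1, b3, b1]"
    using dist_b3 b1 e p_b3[simplified] commute[of v4 b3] irrefl by auto
  have p_b1: "row b1 [v1, v2, v3, v4, v5, v6, v7, d1, b3] = [1, 1, 0, 1, 0, 0, 0, 0, 0]"
    using b3_forces_b1[OF cyc d1 p_b3 sym[OF b1(1)] not_all_adjacent[OF cyc b1V] dist_b1] by (metis singletonD)
  \<comment> \<open>The triangle \<open>v3 v4 d1\<close> still certifies degree at least four,
    although \<open>v2\<close> does not lie in it.\<close>
  obtain a7 where a7: "E v2 a7" "a7 \<notin> {v1, v3, b1}"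
    by (rule degree_neighbour[OF deg V(1) clq, of "{v1, v3, b1}"]) (use dist_b1 in auto)
  have a7V: "a7 \<in> V" using a7 adj_vertices by blast
  have dist_a7: "distinct [v1, v2, v3, v4, v5, v6, v7, d1, b3, b1, a7]"
    using dist_b1 a7 e p_b3[simplified] d1[simplified] commute[of v2 b3] commute[of v2 d1] irrefl by auto
  have p_a7: "row a7 [v1, v2, v3, v4, v5, v6, v7, d1, b3, b1] =
      [0, 1, 0, 0, 0, 0, 1, 0, 1, 0]"
    using b1_forces_a7[OF cyc d1 p_b3 p_b1 sym[OF a7(1)] not_all_adjacent[OF cyc a7V] dist_a7] by (metis singletonD)
  obtain a5 where a5: "E v5 a5" "a5 \<notin> {v4, v6, b3}"
    by (rule degree_neighbour[OF deg V(4) clq, of "{v4, v6, b3}"]) (use dist_b1 in auto)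
  have a5V: "a5 \<in> V" using a5 adj_vertices by blast
  have dist_a5: "distinct [v1, v2, v3, v4, v5, v6, v7, d1, b3, b1, a7, a5]"
    using dist_a7 a5 e p_b1[simplified] d1[simplified] p_a7[simplified] commute[of v5 b1] commute[of v5 d1]
      commute[of v5 a7] irrefl by auto
  have p_a5: "row a5 [v1, v2, v3, v4, v5, v6, v7, d1, b3, b1, a7] =
      [0, 0, 0, 0, 1, 0, 1, 0, 0, 1, 1]"
    using a7_forces_a5[OF cyc d1 p_b3 p_b1 p_a7 sym[OF a5(1)] not_all_adjacent[OF cyc a5V] dist_a5] by (metis singletonD)
  let ?L = "[v1, v2, v3, v4, v5, v6, v7, d1, b3, b1, a7, a5]"
  let ?M = "[V1, V2, V3, V4, V5, V6, V7, D1, B3, BB1, A7, A5]"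
  have L: "V = set ?L"
  proof
    show "set ?L \<subseteq> V" using V adj_vertices[OF e(1)] adj_vertices[OF e(5)] adj_vertices[OF e(6)] d1[simplified]
        adj_vertices b3V b1V a7V a5V by auto
    show "V \<subseteq> set ?L"
    proof
      fix y assume y: "y \<in> V"
      show "y \<in> set ?L"
      proof (rule ccontr)
        assume out: "y \<notin> set ?L"
        then have "row y [v1, v2, v3, v4, v5, v6, v7] \<noteq> [0, 0, 0, 0, 0, 0, 0]"
          using seven_cycle_dominating[OF cyc y] by auto
        then show False
          using no_vertex_outside_F[OF cyc d1 p_b3 p_b1 p_a7 p_a5 not_all_adjacent[OF cyc y]] out dist_a5 by auto
      qed
    qed
  qed
  \<comment> \<open>Every vertex occurs in \<open>?L\<close> by the previous step, so the
    unspecified value of \<open>the None\<close> never arises on the graph.\<close>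
  define f where "f x = the (map_of (zip ?L ?M) x)" for x
  have f: "f v1 = V1" "f v2 = V2" "f v3 = V3" "f v4 = V4" "f v5 = V5" "f v6 = V6" "f v7 = V7"
    "f d1 = D1" "f b3 = B3" "f b1 = BB1" "f a7 = A7" "f a5 = A5"
    using dist_a5 unfolding f_def by auto
  have inj: "inj_on f V" unfolding L inj_on_def using f by auto
  have img: "f ` V = vertices graph_F" unfolding L graph_F_def using f by auto
  note cm =
    commute_list[of d1 "[v1, v2, v3, v4, v5, v6, v7]", simplified]
    commute_list[of b3 "[v1, v2, v3, v4, v5, v6, v7, d1]", simplified]
    commute_list[of b1 "[v1, v2, v3, v4, v5, v6, v7, d1, b3]", simplified]
    commute_list[of a7 "[v1, v2, v3, v4, v5, v6, v7, d1, b3, b1]", simplified]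
    commute_list[of a5 "[v1, v2, v3, v4, v5, v6, v7, d1, b3, b1, a7]", simplified]
  have adj: "\<forall>u\<in>V. \<forall>v\<in>V. E u v \<longleftrightarrow> adj graph_F (f u) (f v)"
    unfolding L adj_def[of graph_F]
    using e d1[simplified] p_b3[simplified] p_b1[simplified] p_a7[simplified] p_a5[simplified]
      cm irrefl f
    by (simp add: graph_F_def doubleton_eq_iff)
  show ?thesis unfolding graph_iso_def using inj img adj by (auto simp: bij_betw_def)
qed

end

theorem theorem1p2:
  fixes G :: "'a ugraph"
  assumes "simple_graph G"
    and "connected_graph G"
    and "imperfect_graph G"
    and "graph_free G {path_graph 7, cycle_graph 5, kite, paraglider}"
    and "min_degree G \<ge> clique_number G + 1"
    and "\<not> graph_iso G graph_F"
  shows "(\<exists>K. clique_cutset G K) \<or> (\<exists>u v. comparable_pair G u v) \<or> (\<exists>K. universal_clique G K)"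
proof (rule ccontr)
  assume none: "\<not> ?thesis"
  interpret extremal_graph G
    using assms none
    unfolding extremal_graph_def extremal_graph_axioms_def forbidden_free_graph_def forbidden_free_graph_axioms_def
    by blast
  obtain x xs where "hole (adj G) x xs" "length xs = 6"
    using imperfect_7_hole[OF assms(3)] by blast
  then have "seven_cycle (x # xs)" by (rule seven_cycle_of_hole)
  then show False using graph_iso_F assms(6) by blast
qed

end
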